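(* Let $n,N$ be positive integers with $n\ge2$ and $n\mid N$. There exists a subset $S'$ of $\mathcal{P}(n,N)$ such that: (a) $\displaystyle\frac{|S'\cap\mathcal{P}(n,N,H)|}{|\mathcal{P}(n,N,H)|}=1-O\Big(\frac{\log H}{\sqrt H}\Big)$ as $H\to\infty$ (in particular $S'$ has density $1$); (b) for each $P(T)\in S'$ there is a constant $\alpha$ with $0<\alpha<1$ such that $|\mathcal{N}_n(P(T),x)|=O(x\log^{-\alpha}(x))$ as $x\to\infty$; in particular, the subset $\mathcal{N}_n(P(T))$ of $\mathcal{N}_n$ has density $0$ (i.e. $|\mathcal{N}_n(P(T),x)|/|\mathcal{N}_n(x)|\to0$).
   Context: $\mathcal{P}(n,N)$ is the set of degree $N$ polynomials $P(T)\in\mathbb{Z}[T]$ all of whose roots have multiplicity at most $n-1$; $\mathcal{P}(n,N,H)$ the subset of those with height (maximum absolute value of coefficients) at most $H$. $\mathcal{N}_n$ is the set of $n$-free integers: integers $d\notin\{0,1\}$ such that $p^n\nmid d$ for every prime $p$; $\mathcal{N}_n(x)=\{d\in\mathcal{N}_n:|d|\le x\}$. For $P(T)=\sum_{i=0}^N a_iT^i$ with $n\mid N$, let $P(T,Z)=\sum_i a_iT^iZ^{N-i}$; the superelliptic curve $C_{d\cdot P(T)}: y^n=d\cdot P(t)$ (in the weighted projective space $\mathbb{P}_{N/n,1,1}$) has a non-trivial $\mathbb{Q}$-rational point iff there exist $(y,t,z)\in\mathbb{Q}^3$ with $y\ne0$ and $y^n=d\cdot P(t,z)$. $\mathcal{N}_n(P(T))$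 is the set of $d\in\mathcal{N}_n$ such that $C_{d\cdot P(T)}$ has a non-trivial $\mathbb{Q}$-rational point, and $\mathcal{N}_n(P(T),x)=\mathcal{N}_n(P(T))\cap\mathcal{N}_n(x)$. *)

theory Defs
  imports
    Complex_Main
    "HOL-Computational_Algebra.Computational_Algebra"
    "HOL-Library.Landau_Symbols"
begin

definition height :: "int poly \<Rightarrow> int" where
  "height P = Max ((\<lambda>i. \<bar>coeff P i\<bar>) ` {..degree P})"

text \<open>Roots and their multiplicities are taken over the complex numbers.\<close>

definition polys :: "nat \<Rightarrow> nat \<Rightarrow> int poly set" where
  "polys n N = {P. degree P = N \<and>
     (\<forall>z::complex. poly (map_poly of_int P) z = 0 \<longrightarrow> order z (map_poly of_int P) \<le> n - 1)}"

definition polys_upto :: "nat \<Rightarrow> nat \<Rightarrow> real \<Rightarrow> int poly set" where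
  "polys_upto n N H = {P \<in> polys n N. real_of_int (height P) \<le> H}"

text \<open>The integer \<open>1\<close> is excluded, but \<open>-1\<close> is not.\<close>

definition free_ints :: "nat \<Rightarrow> int set" where
  "free_ints n = {d. d \<notin> {0, 1} \<and> (\<forall>p::int. prime p \<longrightarrow> \<not> p ^ n dvd d)}"

definition free_ints_upto :: "nat \<Rightarrow> real \<Rightarrow> int set" where
  "free_ints_upto n x = {d \<in> free_ints n. real_of_int \<bar>d\<bar> \<le> x}"

definition homogenized :: "int poly \<Rightarrow> rat \<Rightarrow> rat \<Rightarrow> rat" where
  "homogenized P t z = (\<Sum>i\<le>degree P. of_int (coeff P i) * t ^ i * z ^ (degree P - i))"

text \<open>
  A non-trivial rational point of \<open>y\<^sup>n = d P(t)\<close> in the weighted projective space with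
  weights \<open>(N/n, 1, 1)\<close>, where \<open>N = degree P\<close>. It is given by a representative \<open>(y, t, z)\<close>;
  \<open>y \<noteq> 0\<close> already excludes the zero triple.
\<close>

definition has_nontrivial_rational_point :: "nat \<Rightarrow> int \<Rightarrow> int poly \<Rightarrow> bool" where
  "has_nontrivial_rational_point n d P \<longleftrightarrow>
     (\<exists>y t z :: rat. y \<noteq> 0 \<and> y ^ n = of_int d * homogenized P t z)"

definition twists :: "nat \<Rightarrow> int poly \<Rightarrow> int set" where
  "twists n P = {d \<in> free_ints n. has_nontrivial_rational_point n d P}"

definition twists_upto :: "nat \<Rightarrow> int poly \<Rightarrow> real \<Rightarrow> int set" where
  "twists_upto n P x = twists n P \<inter> free_ints_upto n x"

text \<open>The sets that are counted are finite, so \<^const>\<open>card\<close> is the true number of elements.\<close>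

lemma finite_free_ints_upto: "finite (free_ints_upto n x)"
proof (rule finite_subset)
  show "free_ints_upto n x \<subseteq> {-\<lfloor>x\<rfloor>..\<lfloor>x\<rfloor>}"
    unfolding free_ints_upto_def by (auto simp: le_floor_iff minus_le_iff)
qed simp

lemma finite_twists_upto: "finite (twists_upto n P x)"
  unfolding twists_upto_def using finite_free_ints_upto by blast

lemma finite_polys_upto: "finite (polys_upto n N H)"
proof (rule finite_subset)
  let ?L = "{xs. set xs \<subseteq> {-\<lfloor>H\<rfloor>..\<lfloor>H\<rfloor>} \<and> length xs \<le> Suc N}"
  show "polys_upto n N H \<subseteq> Poly ` ?L"
  proof
    fix P assume P: "P \<in> polys_upto n N H"
    then have deg: "degree P = N" and ht: "real_of_int (height P) \<le> H"
      unfolding polys_upto_def polys_def by blast+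
    have bound: "coeff P i \<in> {-\<lfloor>H\<rfloor>..\<lfloor>H\<rfloor>}" if "i \<le> N" for i
    proof -
      have "\<bar>coeff P i\<bar> \<le> height P"
        unfolding height_def deg using that by (intro Max_ge) auto
      also have "height P \<le> \<lfloor>H\<rfloor>"
        using ht by (rule le_floor_iff[THEN iffD2])
      finally show ?thesis by arith
    qed
    have "set (coeffs P) \<subseteq> coeff P ` {..N}"
      unfolding coeffs_def deg by (cases "P = 0") (auto simp del: upt_Suc)
    also have "\<dots> \<subseteq> {-\<lfloor>H\<rfloor>..\<lfloor>H\<rfloor>}"
      using bound by blast
    finally have "set (coeffs P) \<subseteq> {-\<lfloor>H\<rfloor>..\<lfloor>H\<rfloor>}" .
    moreover have "length (coeffs P) \<le> Suc N"
      unfolding coeffs_def deg by (cases "P = 0") (simp_all del: upt_Suc)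
    ultimately have "coeffs P \<in> ?L" by blast
    then have "Poly (coeffs P) \<in> Poly ` ?L" by (rule imageI)
    then show "P \<in> Poly ` ?L" unfolding Poly_coeffs .
  qed
  show "finite (Poly ` ?L)"
    by (rule finite_imageI, rule finite_lists_length_le, rule finite_atLeastAtMost_int)
qed

end

theory Submission
  imports
    Defs
    "HOL-Analysis.Summation_Tests"
    "HOL-Number_Theory.Cong"
    "HOL-Real_Asymp.Real_Asymp"
    "Jordan_Normal_Form.Char_Poly"
    "Berlekamp_Zassenhaus.Factor_Bound"
begin

text \<open>
  The set \<open>S\<close> consists of the irreducible polynomials of degree \<open>N\<close>; a reducible \<open>P = F G\<close> is
  rare because Mahler's measure bounds the product of the heights of \<open>F\<close> and \<open>G\<close> by that of \<open>P\<close>.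

  Suppose that \<open>P\<close> has no root modulo \<open>p\<close> and that \<open>p\<close> does not divide its leading coefficient. At
  coprime integers \<open>t, z\<close> the value \<open>P(t, z)\<close> is then prime to \<open>p\<close>, so \<open>y\<^sup>n = d P(t, z)\<close> with \<open>n | N\<close>
  forces the exponent of \<open>p\<close> in \<open>d\<close> to be divisible by \<open>n\<close>, that is, \<open>p\<close> does not divide the
  \<open>n\<close>-free integer \<open>d\<close>. If these primes have positive density, a sieve saves a power of
  \<open>log x\<close>.

  Instead of the Chebotarev density theorem, the following elementary argument yields the density.
  Let \<open>\<gamma>\<close> be an algebraic integer of degree \<open>g\<close>. Every class modulo an ideal of \<open>\<int>[\<gamma>]\<close> that contains
  a non-zero element with coordinates at most \<open>A\<close> has a representative with coordinates
  \<open>O(A)\<close>, so ideals are equidistributed in boxes. Comparing the norms of the elements of a box with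
  their prime factors shows two things: an irreducible polynomial has on average at most one root
  modulo \<open>p\<close>, and its reductions have a root for a positive proportion of the primes (weighted by
  \<open>log p / p\<close>). The second fact, applied to a primitive element of a field containing two roots of
  \<open>P\<close>, gives many primes modulo which \<open>P\<close> has two roots; by the first fact these must be
  balanced by many primes without any root.
\<close>

text \<open>Irreducibility is meant over the rationals. The reducible polynomials have relative size
  \<open>O(ln H / H)\<close>, well within the required rate. The weight \<open>ln p / p\<close> is
  forced by logarithms of norms: an ideal of index \<open>p\<close> over \<open>p\<close> contains
  about \<open>1 / p\<close> of a box, and each containment accounts for \<open>ln p\<close>. The
  bound on the average number of roots needs the sharp leading constant 1, since it is played
  against the bound for primes with a root, where any positive constant will do. Sharpness is
  obtained from boxes wider by a large constant factor than the shifts needed to move a class into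
  the ideal. In the other bound the obstacles are elements of small norm and high powers of small
  primes in a norm; both are rare because the norm is a monic polynomial in the constant coordinate.
  If the average is at most \<open>1 + \<eta>\<close> and \<open>P\<close> has two roots for primes
  of density \<open>c\<close>, then taking \<open>\<eta> \<le> c / 2\<close> leaves density at least
  \<eta> for the primes without root. This density becomes the exponent \<alpha>.\<close>

hide_const (open) comm_monoid_mult_class.coprime Mahler_Measure.height UnivPoly.coeff UnivPoly.monom Module.smult Coset.order

section \<open>Estimates of Chebyshev and Mertens\<close>

definition primes_le :: "nat \<Rightarrow> nat set" where
  "primes_le n = {p. prime p \<and> p \<le> n}"

lemma finite_primes_le [simp, intro]: "finite (primes_le n)"
  unfolding primes_le_def by (rule finite_subset[of _ "{..n}"]) auto

lemma primes_le_D: "p \<in> primes_le n \<Longrightarrow> prime p" "p \<in> primes_le n \<Longrightarrow> p \<le> n"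
  "p \<in> primes_le n \<Longrightarrow> 2 \<le> p"
  unfolding primes_le_def by (auto simp: prime_ge_2_nat)

lemma prod_primes_dvd:
  fixes k :: nat
  assumes "finite A" "\<And>p. p \<in> A \<Longrightarrow> prime p" "\<And>p. p \<in> A \<Longrightarrow> p dvd k"
  shows "\<Prod>A dvd k"
  using assms
proof (induction A rule: finite_induct)
  case (insert p A)
  have "coprime p (\<Prod>A)"
    using insert by (intro prod_coprime_right) (auto intro!: primes_coprime)
  then show ?case using insert by (simp add: divides_mult)
qed simp

text \<open>Erdos's induction. For odd \<open>n = 2 * m + 1\<close> the primes between
  \<open>m + 2\<close> and \<open>n\<close> divide \<open>n choose m\<close>, and this coefficient
  is at most \<open>4 ^ m\<close> because it occurs twice in a row of sum
  \<open>2 ^ n\<close>.\<close>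

lemma prod_primes_le: "\<Prod>(primes_le n) \<le> 4 ^ n"
proof (induction n rule: less_induct)
  case (less n)
  consider "n < 2" | "n = 2" | "n > 2" "even n" | "n > 2" "odd n" by linarith
  then show ?case
  proof cases
    case 1
    then have "primes_le n = {}" by (auto simp: primes_le_def dest: prime_ge_2_nat)
    then show ?thesis by simp
  next
    case 2
    have "primes_le 2 = {2}"
      by (auto simp: primes_le_def dest: prime_ge_2_nat intro: le_antisym)
    then show ?thesis using 2 by simp
  next
    case 3
    have "\<not> prime n" using 3 prime_odd_nat by blast
    then have "p \<le> n \<longleftrightarrow> p \<le> n - 1" if "prime p" for p
      using that 3(1) by (cases "p = n") auto
    then have "primes_le n = primes_le (n - 1)" unfolding primes_le_def by blast
    then have "\<Prod>(primes_le n) \<le> 4 ^ (n - 1)" using less[of "n - 1"] 3 by simp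
    also have "\<dots> \<le> (4::nat) ^ n" by (rule power_increasing) auto
    finally show ?thesis .
  next
    case 4
    then obtain m where m: "n = 2 * m + 1" by (elim oddE)
    have m1: "m \<ge> 1" using 4 m by simp
    define B where "B = {p. prime p \<and> m + 1 < p \<and> p \<le> n}"
    have finB: "finite B" unfolding B_def by (rule finite_subset[of _ "{..n}"]) auto
    have split: "primes_le n = primes_le (m + 1) \<union> B" "primes_le (m + 1) \<inter> B = {}"
      unfolding primes_le_def B_def using m by auto
    have "\<Prod>B dvd (n choose m)"
    proof (rule prod_primes_dvd[OF finB])
      fix p assume p: "p \<in> B"
      then have pr: "prime p" by (simp add: B_def)
      have "fact m * fact (n - m) * (n choose m) = (fact n :: nat)"
        by (rule binomial_fact_lemma) (simp add: m)
      moreover have "p dvd (fact n :: nat)" using p pr by (simp add: prime_dvd_fact_iff B_def)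
      moreover have "\<not> p dvd (fact m :: nat)" "\<not> p dvd (fact (n - m) :: nat)"
        unfolding prime_dvd_fact_iff[OF pr] using p by (auto simp: B_def m)
      ultimately show "p dvd (n choose m)"
        using pr by (metis prime_dvd_mult_iff)
    qed (auto simp: B_def)
    moreover have pos: "(n choose m) > 0" using m by simp
    ultimately have "\<Prod>B \<le> (n choose m)" by (rule dvd_imp_le)
    also have "\<dots> \<le> 4 ^ m"
    proof -
      have "(n choose m) = (n choose (m + 1))"
        using binomial_symmetric[of m n] m by simp
      moreover have "(\<Sum>k\<in>{m, m + 1}. n choose k) \<le> (\<Sum>k\<le>n. n choose k)"
        by (rule sum_mono2) (use m in auto)
      ultimately have "2 * (n choose m) \<le> 2 ^ n" by (simp add: choose_row_sum)
      then show ?thesis using m by (simp add: power_mult)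
    qed
    finally have B: "\<Prod>B \<le> 4 ^ m" .
    have "\<Prod>(primes_le n) = \<Prod>(primes_le (m + 1)) * \<Prod>B"
      unfolding split(1) by (rule prod.union_disjoint) (use finB split in auto)
    also have "\<dots> \<le> 4 ^ (m + 1) * 4 ^ m"
      by (rule mult_mono) (use less[of "m + 1"] B m m1 in auto)
    also have "\<dots> = 4 ^ n" by (simp add: m flip: power_add)
    finally show ?thesis .
  qed
qed

lemma chebyshev_theta_le: "(\<Sum>p\<in>primes_le n. ln (real p)) \<le> real n * ln 4"
proof -
  have "(\<Sum>p\<in>primes_le n. ln (real p)) = ln (\<Prod>p\<in>primes_le n. real p)"
    by (rule ln_prod[symmetric]) (auto simp: primes_le_def prime_gt_0_nat)
  also have "(\<Prod>p\<in>primes_le n. real p) = real (\<Prod>(primes_le n))" by simp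
  also have "ln \<dots> \<le> ln (real (4 ^ n))"
  proof -
    have "0 < \<Prod>(primes_le n)" by (rule prod_pos) (auto simp: primes_le_def prime_gt_0_nat)
    then show ?thesis using prod_primes_le[of n]
      by (metis ln_le_cancel_iff of_nat_0_less_iff of_nat_le_iff zero_less_numeral zero_less_power)
  qed
  also have "\<dots> = real n * ln 4" by (simp add: ln_realpow)
  finally show ?thesis .
qed

text \<open>\<open>A\<close> may be any finite set of primes containing the prime factors, so that
  one index set can serve many \<open>m\<close> and sums over \<open>m\<close> and \<open>p\<close>
  can be exchanged.\<close>

lemma ln_eq_sum_multiplicity:
  assumes "m > 0" "finite A" "prime_factors m \<subseteq> A" "\<And>p. p \<in> A \<Longrightarrow> prime p"
  shows "ln (real m) = (\<Sum>p\<in>A. real (multiplicity p m) * ln (real p))"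
proof -
  have "real m = (\<Prod>p\<in>prime_factors m. real p ^ multiplicity p m)"
    using prime_factorization_nat[OF assms(1)]
    by (metis (mono_tags, lifting) semiring_1_class.of_nat_power of_nat_prod prod.cong)
  then have "ln (real m) = ln (\<Prod>p\<in>prime_factors m. real p ^ multiplicity p m)" by simp
  also have "\<dots> = (\<Sum>p\<in>prime_factors m. ln (real p ^ multiplicity p m))"
    by (rule ln_prod) (auto simp: in_prime_factors_iff prime_gt_0_nat)
  also have "\<dots> = (\<Sum>p\<in>prime_factors m. real (multiplicity p m) * ln (real p))"
    by (rule sum.cong) (auto simp: ln_realpow in_prime_factors_iff prime_gt_0_nat)
  also have "\<dots> = (\<Sum>p\<in>A. real (multiplicity p m) * ln (real p))"
  proof (rule sum.mono_neutral_left[OF assms(2,3)], safe)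
    fix p assume "p \<in> A" "p \<notin> prime_factors m"
    then have "\<not> p dvd m" using assms by (simp add: in_prime_factors_iff)
    then show "real (multiplicity p m) * ln (real p) = 0" by (simp add: not_dvd_imp_multiplicity_0)
  qed
  finally show ?thesis .
qed

lemma card_multiples: 
  assumes "d > 0" shows "card {m\<in>{1..n::nat}. d dvd m} = n div d"
proof -
  have "{m\<in>{1..n}. d dvd m} = (\<lambda>k. d * k) ` {1..n div d}"
  proof (intro equalityI subsetI)
    fix m assume "m \<in> {m\<in>{1..n}. d dvd m}"
    then obtain k where k: "m = d * k" "1 \<le> m" "m \<le> n" by auto
    then have "k \<in> {1..n div d}" using assms
      by (simp add: less_eq_div_iff_mult_less_eq mult.commute Suc_le_eq)
    then show "m \<in> (\<lambda>k. d * k) ` {1..n div d}" using k by blast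
  next
    fix m assume "m \<in> (\<lambda>k. d * k) ` {1..n div d}"
    then show "m \<in> {m\<in>{1..n}. d dvd m}" using assms
      by (auto simp: less_eq_div_iff_mult_less_eq mult.commute)
  qed
  moreover have "inj_on (\<lambda>k. d * k) {1..n div d}" using assms by (auto simp: inj_on_def)
  ultimately show ?thesis by (simp add: card_image)
qed

lemma multiplicity_eq_card:
  assumes "prime (p::nat)" "0 < m" "m < p ^ K"
  shows "multiplicity p m = card {k\<in>{1..K}. p ^ k dvd m}"
proof -
  have "\<not> is_unit p" using assms(1) by auto
  then have *: "p ^ k dvd m \<longleftrightarrow> k \<le> multiplicity p m" for k
    using assms(2) by (simp add: power_dvd_iff_le_multiplicity)
  have "p ^ multiplicity p m \<le> m" using assms by (simp add: dvd_imp_le multiplicity_dvd)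
  then have "p ^ multiplicity p m < p ^ K" using assms by linarith
  then have "multiplicity p m < K" using assms(1) power_less_imp_less_exp prime_gt_1_nat by blast
  then have "{k\<in>{1..K}. p ^ k dvd m} = {1..multiplicity p m}" unfolding * by auto
  then show ?thesis by simp
qed

lemma sum_ln_eq:
  "(\<Sum>m=1..n. ln (real m)) = (\<Sum>p\<in>primes_le n. (\<Sum>m=1..n. real (multiplicity p m)) * ln (real p))"
proof -
  have "(\<Sum>m=1..n. ln (real m)) = (\<Sum>m=1..n. \<Sum>p\<in>primes_le n. real (multiplicity p m) * ln (real p))"
  proof (rule sum.cong[OF refl])
    fix m assume m: "m \<in> {1..n}"
    show "ln (real m) = (\<Sum>p\<in>primes_le n. real (multiplicity p m) * ln (real p))"
    proof (rule ln_eq_sum_multiplicity)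
      show "prime_factors m \<subseteq> primes_le n"
        using m by (auto simp: primes_le_def in_prime_factors_iff intro: order.trans[OF dvd_imp_le])
    qed (use m in \<open>auto simp: primes_le_def\<close>)
  qed
  also have "\<dots> = (\<Sum>p\<in>primes_le n. \<Sum>m=1..n. real (multiplicity p m) * ln (real p))"
    by (rule sum.swap)
  finally show ?thesis by (simp add: sum_distrib_right)
qed

text \<open>Legendre's formula for the exponent of \<open>p\<close> in \<open>n!\<close>: counting
  the multiples of each power of \<open>p\<close> yields the sum of \<open>n div p ^ k\<close>. Its
  first term is the lower bound, a geometric series the upper bound.\<close>

lemma sum_multiplicity_bounds:
  assumes p: "prime p"
  shows "real (n div p) \<le> (\<Sum>m=1..n. real (multiplicity p m))"
    and "(\<Sum>m=1..n. real (multiplicity p m)) \<le> real n / (real p - 1)"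
proof -
  have p2: "p \<ge> 2" using p by (rule prime_ge_2_nat)
  have "(\<Sum>m=1..n. real (multiplicity p m)) = (\<Sum>m=1..n. \<Sum>k=1..n. if p ^ k dvd m then 1 else 0)"
  proof (rule sum.cong[OF refl])
    fix m assume m: "m \<in> {1..n}"
    \<comment> \<open>Every \<open>m \<le> n\<close> lies below \<open>p ^ n\<close>, so exponents
      up to \<open>n\<close> suffice for all \<open>m\<close> at once.\<close>
    have "m < p ^ n" using m p2 
      by (metis atLeastAtMost_iff le_less_trans less_exp order_less_le_trans power_mono zero_le)
    then have "multiplicity p m = card {k\<in>{1..n}. p ^ k dvd m}"
      using p m by (intro multiplicity_eq_card) auto
    then show "real (multiplicity p m) = (\<Sum>k=1..n. if p ^ k dvd m then 1 else 0)"
      by (simp add: sum.If_cases Int_def)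
  qed
  also have "\<dots> = (\<Sum>k=1..n. \<Sum>m=1..n. if p ^ k dvd m then 1 else 0)" by (rule sum.swap)
  also have "\<dots> = (\<Sum>k=1..n. real (n div p ^ k))"
  proof (rule sum.cong[OF refl])
    fix k assume "k \<in> {1..n}"
    have "card {m\<in>{1..n}. p ^ k dvd m} = n div p ^ k"
      by (rule card_multiples) (use p2 in simp)
    then show "(\<Sum>m=1..n. if p ^ k dvd m then 1 else 0) = real (n div p ^ k)"
      by (simp add: sum.If_cases Int_def)
  qed
  finally have eq: "(\<Sum>m=1..n. real (multiplicity p m)) = (\<Sum>k=1..n. real (n div p ^ k))" .
  show "real (n div p) \<le> (\<Sum>m=1..n. real (multiplicity p m))"
  proof (cases "n = 0")
    case False
    have "(\<Sum>k\<in>{1}. real (n div p ^ k)) \<le> (\<Sum>k=1..n. real (n div p ^ k))"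
      by (rule sum_mono2) (use False in auto)
    then show ?thesis using eq by simp
  qed simp
  have "(\<Sum>k=1..n. real (n div p ^ k)) \<le> (\<Sum>k=1..n. real n * (1 / real p) ^ k)"
  proof (rule sum_mono)
    fix k
    have "real (n div p ^ k) \<le> real n / real (p ^ k)" by (rule of_nat_div_le_of_nat)
    then show "real (n div p ^ k) \<le> real n * (1 / real p) ^ k" by (simp add: power_one_over)
  qed
  also have "\<dots> = real n * (\<Sum>k=1..n. (1 / real p) ^ k)" by (simp add: sum_distrib_left)
  also have "\<dots> \<le> real n * (1 / (real p - 1))"
  proof (rule mult_left_mono)
    have "(\<Sum>k=1..n. (1 / real p) ^ k) = (\<Sum>k<n. (1 / real p) ^ Suc k)"
      by (rule sum.reindex_bij_witness[of _ Suc "\<lambda>k. k - 1"]) auto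
    also have "\<dots> = (1 / real p) * (\<Sum>k<n. (1 / real p) ^ k)" by (simp add: sum_distrib_left)
    also have "(\<Sum>k<n. (1 / real p) ^ k) = (1 - (1 / real p) ^ n) / (1 - 1 / real p)"
      using p2 by (subst sum_gp_strict) auto
    also have "(1 / real p) * \<dots> \<le> (1 / real p) * (1 / (1 - 1 / real p))"
      using p2 by (intro mult_left_mono divide_right_mono) auto
    also have "\<dots> = 1 / (real p - 1)" using p2 by (simp add: field_simps)
    finally show "(\<Sum>k=1..n. (1 / real p) ^ k) \<le> 1 / (real p - 1)" .
  qed simp
  finally show "(\<Sum>m=1..n. real (multiplicity p m)) \<le> real n / (real p - 1)"
    using eq by simp
qed

lemma sum_ln_upper: "(\<Sum>m=1..n. ln (real m)) \<le> real n * ln (real n)"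
proof -
  have "(\<Sum>m=1..n. ln (real m)) \<le> (\<Sum>m=1..n. ln (real n))" by (rule sum_mono) auto
  then show ?thesis by simp
qed

lemma sum_ln_lower: "real n * ln (real n) - real n \<le> (\<Sum>m=1..n. ln (real m))"
proof (induction n)
  case (Suc n)
  show ?case
  proof (cases "n = 0")
    case False
    have "real n * (ln (real n + 1) - ln (real n)) \<le> real n * (1 / real n)"
    proof (rule mult_left_mono)
      have "ln (real n + 1) - ln (real n) = ln (1 + 1 / real n)" using False
        using ln_div[of "real n + 1" "real n"] by (simp add: add_divide_distrib)
      also have "\<dots> \<le> 1 / real n" by (rule ln_add_one_self_le_self) simp
      finally show "ln (real n + 1) - ln (real n) \<le> 1 / real n" .
    qed simp
    also have "\<dots> = 1" using False by simp
    finally have "real n * ln (real n + 1) \<le> real n * ln (real n) + 1" by (simp add: algebra_simps)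
    then show ?thesis using Suc by (simp add: algebra_simps)
  qed simp
qed simp

text \<open>Rounding \<open>n / p\<close> down loses at most the sum of \<open>ln p\<close>, which
  is at most \<open>n * ln 4\<close> by Chebyshev's bound; this is the source of the
  constant.\<close>

lemma mertens_upper:
  assumes "n \<ge> 1"
  shows "(\<Sum>p\<in>primes_le n. ln (real p) / real p) \<le> ln (real n) + ln 4"
proof -
  have "(\<Sum>p\<in>primes_le n. (real n / real p - 1) * ln (real p)) \<le> (\<Sum>m=1..n. ln (real m))"
    unfolding sum_ln_eq
  proof (rule sum_mono)
    fix p assume p: "p \<in> primes_le n"
    have "real n / real p - 1 \<le> real (n div p)"
      using real_of_int_div3[of "int n" "int p"] by (simp flip: of_nat_div)
    also have "\<dots> \<le> (\<Sum>m=1..n. real (multiplicity p m))"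
      by (rule sum_multiplicity_bounds) (use p in \<open>simp add: primes_le_def\<close>)
    finally show "(real n / real p - 1) * ln (real p) \<le> (\<Sum>m=1..n. real (multiplicity p m)) * ln (real p)"
      using p by (intro mult_right_mono) (auto dest!: primes_le_D(3))
  qed
  also have "\<dots> \<le> real n * ln (real n)" by (rule sum_ln_upper)
  also have "(\<Sum>p\<in>primes_le n. (real n / real p - 1) * ln (real p))
     = real n * (\<Sum>p\<in>primes_le n. ln (real p) / real p) - (\<Sum>p\<in>primes_le n. ln (real p))"
    by (simp add: sum_distrib_left sum_subtractf[symmetric] algebra_simps)
  finally have "real n * (\<Sum>p\<in>primes_le n. ln (real p) / real p) \<le> real n * (ln (real n) + ln 4)"
    using chebyshev_theta_le[of n] by (simp add: algebra_simps)
  then show ?thesis using assms by simp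
qed

lemma ln_le_sqrt: "x > 0 \<Longrightarrow> ln x \<le> 2 * sqrt x"
proof -
  assume x: "x > 0"
  have "ln (sqrt x) \<le> sqrt x - 1" by (rule ln_le_minus_one) (use x in simp)
  then show ?thesis using x by (simp add: ln_sqrt)
qed

lemma summable_ln_over_square: "summable (\<lambda>n. ln (real n) / (real n * (real n - 1)))"
proof (rule summable_comparison_test')
  show "summable (\<lambda>n. 4 * (real n powr (-3/2)))"
    by (intro summable_mult) (simp add: summable_real_powr_iff)
  fix n :: nat assume n: "n \<ge> 2"
  have "ln (real n) \<ge> 0" using n by simp
  have "real n * (real n - 1) \<ge> real n * (real n / 2)" using n by (intro mult_left_mono) auto
  then have "ln (real n) / (real n * (real n - 1)) \<le> 2 * sqrt (real n) / (real n * (real n / 2))"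
    using n ln_le_sqrt[of "real n"] by (intro frac_le) auto
  also have "\<dots> = 4 * (real n powr (1/2) / real n powr 2)"
    using n by (simp add: powr_half_sqrt power2_eq_square powr_numeral)
  also have "real n powr (1/2) / real n powr 2 = real n powr (1/2 - 2)" by (rule powr_diff[symmetric])
  also have "1/2 - 2 = (-3/2::real)" by simp
  finally show "norm (ln (real n) / (real n * (real n - 1))) \<le> 4 * (real n powr (-3/2))"
    using n by simp
qed

text \<open>The factor \<open>1 / (p - 1)\<close> is split into \<open>1 / p\<close> and
  \<open>1 / (p * (p - 1))\<close>; the second part contributes a convergent series.\<close>

lemma mertens_lower:
  obtains C where "\<And>n. n \<ge> 1 \<Longrightarrow> (\<Sum>p\<in>primes_le n. ln (real p) / real p) \<ge> ln (real n) - C"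
proof
  define D where "D = (\<Sum>n. ln (real n) / (real n * (real n - 1)))"
  fix n :: nat assume n: "n \<ge> 1"
  have "real n * ln (real n) - real n \<le> (\<Sum>m=1..n. ln (real m))" by (rule sum_ln_lower)
  also have "\<dots> \<le> (\<Sum>p\<in>primes_le n. real n / (real p - 1) * ln (real p))"
    unfolding sum_ln_eq
    by (intro sum_mono mult_right_mono sum_multiplicity_bounds) (auto dest: primes_le_D)
  also have "\<dots> = (\<Sum>p\<in>primes_le n. real n * (ln (real p) / real p + ln (real p) / (real p * (real p - 1))))"
    by (rule sum.cong[OF refl]) (auto simp: field_simps dest!: primes_le_D(3))
  also have "\<dots> = real n * ((\<Sum>p\<in>primes_le n. ln (real p) / real p)
       + (\<Sum>p\<in>primes_le n. ln (real p) / (real p * (real p - 1))))"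
    by (simp only: sum_distrib_left sum.distrib distrib_left)
  finally have "real n * (ln (real n) - 1) \<le> real n * ((\<Sum>p\<in>primes_le n. ln (real p) / real p)
       + (\<Sum>p\<in>primes_le n. ln (real p) / (real p * (real p - 1))))"
    by (simp add: right_diff_distrib)
  then have "ln (real n) - 1 \<le> (\<Sum>p\<in>primes_le n. ln (real p) / real p)
       + (\<Sum>p\<in>primes_le n. ln (real p) / (real p * (real p - 1)))"
    using n by simp
  also have "(\<Sum>p\<in>primes_le n. ln (real p) / (real p * (real p - 1))) \<le> D"
    unfolding D_def 
  proof (rule sum_le_suminf[OF summable_ln_over_square])
    fix k show "0 \<le> ln (real k) / (real k * (real k - 1))"
      by (cases "k \<ge> 1") (auto simp: not_le)
  qed auto
  finally show "(\<Sum>p\<in>primes_le n. ln (real p) / real p) \<ge> ln (real n) - (D + 1)" by simp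
qed

section \<open>Sieving by a set of primes of positive density\<close>

text \<open>Discrete form of the derivative of \<open>ln (ln n)\<close>: it makes the main term of
  the partial summation in \<open>sum_inverse_primes_le\<close> telescope.\<close>

lemma ln_diff_over_ln_le:
  assumes "2 \<le> (n::nat)"
  shows "ln (real n) * (1 / ln (real n) - 1 / ln (real (Suc n))) \<le> ln (ln (real (Suc n))) - ln (ln (real n))"
proof -
  define u where "u = ln (real n)"
  define v where "v = ln (real (Suc n))"
  have uv: "0 < u" "u \<le> v" unfolding u_def v_def using assms by auto
  have "ln (u / v) \<le> u / v - 1" by (rule ln_le_minus_one) (use uv in simp)
  then have "1 - u / v \<le> ln v - ln u" using uv by (simp add: ln_div)
  moreover have "u * (1 / u - 1 / v) = 1 - u / v" using uv by (simp add: field_simps)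
  ultimately show ?thesis unfolding u_def v_def by simp
qed

lemma summation_by_parts_nat:
  fixes A g :: "nat \<Rightarrow> real"
  assumes "2 \<le> n"
  shows "(\<Sum>m=2..n. (A m - A (m - 1)) * g m) = A n * g n - A 1 * g 2 + (\<Sum>m=2..<n. A m * (g m - g (Suc m)))"
  using assms
proof (induction n rule: nat_induct_at_least)
  case (Suc n)
  then show ?case by (simp add: algebra_simps)
qed (simp add: algebra_simps)

text \<open>Partial summation with the weight \<open>1 / ln n\<close>, which turns
  \<open>ln p / p\<close> into \<open>1 / p\<close>.\<close>

lemma sum_inverse_primes_le:
  fixes R :: "nat set"
  assumes R: "\<And>p. p \<in> R \<Longrightarrow> prime p" and b: "0 \<le> b" "0 \<le> C"
    and bound: "\<And>n. n \<ge> 1 \<Longrightarrow> (\<Sum>p\<in>{p\<in>R. p \<le> n}. ln (real p) / real p) \<le> b * ln (real n) + C"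
  obtains D where "\<And>n. n \<ge> 2 \<Longrightarrow> (\<Sum>p\<in>{p\<in>R. p \<le> n}. 1 / real p) \<le> b * ln (ln (real n)) + D"
proof
  define A where "A n = (\<Sum>p\<in>{p\<in>R. p \<le> n}. ln (real p) / real p)" for n :: nat
  define g where "g n = 1 / ln (real n)" for n :: nat
  fix n :: nat assume n: "n \<ge> 2"
  have fin: "finite {p\<in>R. p \<le> n}" for n by (rule finite_subset[of _ "{..n}"]) auto
  have R2: "p \<ge> 2" if "p \<in> R" for p using R[OF that] by (rule prime_ge_2_nat)
  have step: "A m - A (m - 1) = (if m \<in> R then ln (real m) / real m else 0)" if "m \<ge> 2" for m
  proof -
    have "{p\<in>R. p \<le> m} = (if m \<in> R then insert m {p\<in>R. p \<le> m - 1} else {p\<in>R. p \<le> m - 1})"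
    proof -
      have "p \<le> m \<longleftrightarrow> p = m \<or> p \<le> m - 1" for p using that by auto
      then show ?thesis by (auto simp only: split: if_splits)
    qed
    moreover have "m \<notin> {p\<in>R. p \<le> m - 1}" using that by auto
    ultimately show ?thesis unfolding A_def using fin[of "m - 1"] by simp
  qed
  have A1: "A 1 = 0"
  proof -
    have "{p\<in>R. p \<le> 1} = {}" using R2 by force
    then show ?thesis unfolding A_def by (simp only: sum.empty)
  qed
  have "(\<Sum>p\<in>{p\<in>R. p \<le> n}. 1 / real p) = (\<Sum>m=2..n. if m \<in> R then 1 / real m else 0)"
  proof -
    have "{p\<in>R. p \<le> n} = {m\<in>{2..n}. m \<in> R}" using R2 by auto
    then show ?thesis by (simp only: sum.inter_filter finite_atLeastAtMost)
  qed
  also have "\<dots> = (\<Sum>m=2..n. (A m - A (m - 1)) * g m)"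
    by (rule sum.cong[OF refl]) (use step in \<open>auto simp: g_def\<close>)
  also have "\<dots> = A n * g n + (\<Sum>m=2..<n. A m * (g m - g (Suc m)))"
    by (subst summation_by_parts_nat[OF n]) (use A1 in simp)
  also have "(\<Sum>m=2..<n. A m * (g m - g (Suc m)))
      \<le> (\<Sum>m=2..<n. b * (ln (ln (real (Suc m))) - ln (ln (real m))) + C * (g m - g (Suc m)))"
  proof (rule sum_mono)
    fix m assume m: "m \<in> {2..<n}"
    have dec: "g m - g (Suc m) \<ge> 0" using m by (simp add: g_def frac_le)
    have "A m * (g m - g (Suc m)) \<le> (b * ln (real m) + C) * (g m - g (Suc m))"
      unfolding A_def by (rule mult_right_mono[OF bound dec]) (use m in simp)
    also have "\<dots> = b * (ln (real m) * (g m - g (Suc m))) + C * (g m - g (Suc m))"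
      by (simp add: algebra_simps)
    also have "\<dots> \<le> b * (ln (ln (real (Suc m))) - ln (ln (real m))) + C * (g m - g (Suc m))"
      using ln_diff_over_ln_le[of m] m b by (intro add_right_mono mult_left_mono) (auto simp: g_def)
    finally show "A m * (g m - g (Suc m)) \<le> \<dots>" .
  qed
  also have "\<dots> = b * (\<Sum>m=2..<n. ln (ln (real (Suc m))) - ln (ln (real m))) + C * (\<Sum>m=2..<n. g m - g (Suc m))"
    by (simp only: sum.distrib sum_distrib_left)
  also have "(\<Sum>m=2..<n. ln (ln (real (Suc m))) - ln (ln (real m))) = ln (ln (real n)) - ln (ln 2)"
    using sum_Suc_diff'[OF n, of "\<lambda>m. ln (ln (real m))"] by simp
  also have "(\<Sum>m=2..<n. g m - g (Suc m)) = g 2 - g n"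
    using sum_Suc_diff'[OF n, of "\<lambda>m. - g m"] by (simp add: algebra_simps)
  also have "A n * g n \<le> (b * ln (real n) + C) * g n"
    unfolding A_def by (rule mult_right_mono[OF bound]) (use n in \<open>auto simp: g_def\<close>)
  \<comment> \<open>In this boundary term \<open>C * g n\<close> cancels against the end of the
    telescoped sum of \<open>C * (g m - g (Suc m))\<close>.\<close>
  also have "\<dots> = b + C * g n"
  proof -
    have "ln (real n) * g n = 1" using n by (simp add: g_def)
    then show ?thesis by (simp add: distrib_right mult.assoc)
  qed
  finally show "(\<Sum>p\<in>{p\<in>R. p \<le> n}. 1 / real p) \<le> b * ln (ln (real n)) + (b - b * ln (ln 2) + C * g 2)"
    by (simp add: algebra_simps)
qed

text \<open>The primes are split off one at a time: \<open>m\<close> is determined by its exponent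
  at \<open>p\<close> and its \<open>p\<close>-free part, so the sum is at most a geometric series
  times the sum for the remaining primes.\<close>

lemma sum_reciprocals_smooth_le:
  assumes "finite P" "\<And>p. p \<in> P \<Longrightarrow> prime (p::nat)" "finite M"
    "\<And>m. m \<in> M \<Longrightarrow> m > 0 \<and> prime_factors m \<subseteq> P"
  shows "(\<Sum>m\<in>M. 1 / real m) \<le> (\<Prod>p\<in>P. 1 / (1 - 1 / real p))"
  using assms
proof (induction P arbitrary: M rule: finite_induct)
  case empty
  have "m = 1" if "m \<in> M" for m
    using empty(3)[OF that] by (auto simp: prime_factorization_empty_iff)
  then have "M \<subseteq> {1}" by auto
  then have "(\<Sum>m\<in>M. 1 / real m) \<le> (\<Sum>m\<in>{1::nat}. 1 / real m)" by (intro sum_mono2) auto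
  then show ?case by simp
next
  case (insert p P)
  have p: "prime p" using insert by simp
  then have p2: "p \<ge> 2" by (rule prime_ge_2_nat)
  \<comment> \<open>Inserting 0 keeps the maximum meaningful when \<open>M\<close> is empty.\<close>
  define K where "K = Max (insert 0 (multiplicity p ` M))"
  define red where "red m = m div p ^ multiplicity p m" for m
  define M' where "M' = red ` M"
  have dec: "m = p ^ multiplicity p m * red m" for m
    unfolding red_def by (simp add: multiplicity_dvd)
  have M': "m' > 0 \<and> prime_factors m' \<subseteq> P" if "m' \<in> M'" for m'
  proof -
    from that obtain m where m: "m \<in> M" "m' = red m" unfolding M'_def by blast
    have m0: "m > 0" using insert.prems(3)[OF m(1)] by simp
    then have r0: "red m > 0" using dec[of m] by (metis mult_0_right neq0_conv)
    have "\<not> p dvd red m"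
      unfolding red_def by (rule multiplicity_decompose) (use m0 p in auto)
    moreover have "prime_factors (red m) \<subseteq> prime_factors m"
      by (rule dvd_prime_factors) (use m0 dec[of m] in \<open>auto intro: dvdI[of _ _ "p ^ multiplicity p m"] simp: mult.commute\<close>)
    ultimately show ?thesis using r0 insert.prems(3)[OF m(1)] m(2)
      by (auto simp: in_prime_factors_iff)
  qed
  have inj: "inj_on (\<lambda>m. (multiplicity p m, red m)) M"
    by (rule inj_onI) (metis dec prod.inject)
  have finM': "finite M'" using insert.prems by (simp add: M'_def)
  have sub: "(\<lambda>m. (multiplicity p m, red m)) ` M \<subseteq> {..K} \<times> M'"
    unfolding K_def M'_def using insert.prems(2) by auto
  have "(\<Sum>m\<in>M. 1 / real m) = (\<Sum>m\<in>M. (1 / real p) ^ multiplicity p m * (1 / real (red m)))"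
  proof (rule sum.cong[OF refl])
    fix m
    have "real m = real p ^ multiplicity p m * real (red m)" using dec[of m]
      by (metis of_nat_mult semiring_1_class.of_nat_power)
    then show "1 / real m = (1 / real p) ^ multiplicity p m * (1 / real (red m))"
      by (simp add: power_one_over)
  qed
  also have "\<dots> = (\<Sum>x\<in>(\<lambda>m. (multiplicity p m, red m)) ` M. (1 / real p) ^ fst x * (1 / real (snd x)))"
    by (subst sum.reindex[OF inj]) simp
  also have "\<dots> \<le> (\<Sum>x\<in>{..K} \<times> M'. (1 / real p) ^ fst x * (1 / real (snd x)))"
    by (rule sum_mono2) (use sub finM' in auto)
  also have "\<dots> = (\<Sum>k\<le>K. (1 / real p) ^ k) * (\<Sum>m\<in>M'. 1 / real m)"
    by (simp add: sum_product sum.cartesian_product case_prod_beta)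
  also have "\<dots> \<le> (1 / (1 - 1 / real p)) * (\<Prod>p\<in>P. 1 / (1 - 1 / real p))"
  proof (rule mult_mono)
    have "(\<Sum>k\<le>K. (1 / real p) ^ k) = (\<Sum>k<Suc K. (1 / real p) ^ k)" by (simp add: lessThan_Suc_atMost)
    also have "\<dots> = (1 - (1 / real p) ^ Suc K) / (1 - 1 / real p)"
      using p2 by (subst sum_gp_strict) auto
    also have "\<dots> \<le> 1 / (1 - 1 / real p)" using p2 by (intro divide_right_mono) auto
    finally show "(\<Sum>k\<le>K. (1 / real p) ^ k) \<le> 1 / (1 - 1 / real p)" .
    show "(\<Sum>m\<in>M'. 1 / real m) \<le> (\<Prod>p\<in>P. 1 / (1 - 1 / real p))"
      by (rule insert.IH) (use insert.prems finM' M' in auto)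
  qed (use p2 in \<open>auto intro!: sum_nonneg\<close>)
  finally show ?case using insert by simp
qed

lemma sum_inverse_squares_le: "(\<Sum>m=2..n. 1 / (real m)\<^sup>2) \<le> 1"
proof (cases "n \<ge> 2")
  case True
  have "(\<Sum>m=2..n. 1 / (real m)\<^sup>2) \<le> (\<Sum>m=2..n. 1 / (real m - 1) - 1 / real m)"
  proof (rule sum_mono)
    fix m assume "m \<in> {2..n}"
    then have m: "real m \<ge> 2" by simp
    have "1 / (real m)\<^sup>2 \<le> 1 / ((real m - 1) * real m)"
      using m by (intro divide_left_mono) (auto simp: power2_eq_square intro!: mult_right_mono)
    also have "\<dots> = 1 / (real m - 1) - 1 / real m" using m by (simp add: field_simps)
    finally show "1 / (real m)\<^sup>2 \<le> 1 / (real m - 1) - 1 / real m" .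
  qed
  also have "\<dots> = 1 - 1 / real n" using True
    by (induction n rule: nat_induct_at_least) auto
  finally have "(\<Sum>m=2..n. 1 / (real m)\<^sup>2) \<le> 1 - 1 / real n" .
  also have "\<dots> \<le> 1" by simp
  finally show ?thesis .
qed simp

text \<open>The correction to \<open>1 / p\<close> has size \<open>1 / p^2\<close> and is summable,
  so only the sum of \<open>1 / p\<close> determines the order of the Euler product.\<close>

lemma euler_factor_le:
  assumes "p \<ge> (2::nat)"
  shows "1 / (1 - 1 / real p) \<le> exp (1 / real p + 2 / (real p)\<^sup>2)"
proof -
  have p: "real p \<ge> 2" using assms by simp
  have "1 / (1 - 1 / real p) = 1 + 1 / (real p - 1)" using p by (simp add: field_simps)
  also have "\<dots> \<le> exp (1 / (real p - 1))" by (rule exp_ge_add_one_self)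
  also have "1 / (real p - 1) = 1 / real p + 1 / (real p * (real p - 1))" using p by (simp add: field_simps)
  also have "1 / (real p * (real p - 1)) \<le> 2 / (real p)\<^sup>2"
    using p by (simp add: field_simps power2_eq_square)
  finally show ?thesis by simp
qed

text \<open>The absence of \<open>k\<close>-th powers of primes bounds \<open>ln m\<close> by
  \<open>k\<close> times the sum of \<open>ln p\<close> over the primes dividing
  \<open>m\<close>.\<close>

definition sifted :: "nat \<Rightarrow> nat set \<Rightarrow> nat \<Rightarrow> nat set" where
  "sifted k Q x = {m\<in>{1..x}. (\<forall>p. prime p \<longrightarrow> \<not> p ^ k dvd m) \<and> (\<forall>p\<in>Q. \<not> p dvd m)}"

lemma finite_sifted [simp]: "finite (sifted k Q x)"
  unfolding sifted_def by simp

text \<open>Weighting by \<open>ln m\<close> and splitting it over the primes dividing \<open>m\<close> reduces the count to a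
  logarithmic sum, which an Euler product controls.\<close>

lemma card_sifted_ln_le:
  assumes "x \<ge> 1"
  shows "real (card (sifted k Q x)) * ln (real x) \<le> (1 + real k * ln 4) * real x * (\<Sum>m\<in>sifted k Q x. 1 / real m)"
proof -
  let ?W = "sifted k Q x"
  have mx: "1 \<le> m" "m \<le> x" if "m \<in> ?W" for m using that by (auto simp: sifted_def)
  have "real (card ?W) * ln (real x) = (\<Sum>m\<in>?W. ln (real x / real m)) + (\<Sum>m\<in>?W. ln (real m))"
    unfolding sum.distrib[symmetric]
  proof -
    have "(\<Sum>m\<in>?W. ln (real x / real m) + ln (real m)) = (\<Sum>m\<in>?W. ln (real x))"
    proof (rule sum.cong[OF refl])
      fix m assume "m \<in> ?W"
      then show "ln (real x / real m) + ln (real m) = ln (real x)"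
        using mx[of m] by (simp add: ln_div)
    qed
    then show "real (card ?W) * ln (real x) = (\<Sum>m\<in>?W. ln (real x / real m) + ln (real m))"
      by simp
  qed
  also have "(\<Sum>m\<in>?W. ln (real x / real m)) \<le> (\<Sum>m\<in>?W. real x / real m)"
  proof (rule sum_mono)
    fix m assume m: "m \<in> ?W"
    have "ln (real x / real m) \<le> real x / real m - 1"
      by (rule ln_le_minus_one) (use mx[OF m] in auto)
    then show "ln (real x / real m) \<le> real x / real m" by simp
  qed
  also have "(\<Sum>m\<in>?W. ln (real m)) \<le> (\<Sum>m\<in>?W. \<Sum>p\<in>{p\<in>primes_le x. p dvd m}. real k * ln (real p))"
  proof (rule sum_mono)
    fix m assume m: "m \<in> ?W"
    have "ln (real m) = (\<Sum>p\<in>{p\<in>primes_le x. p dvd m}. real (multiplicity p m) * ln (real p))"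
    proof (rule ln_eq_sum_multiplicity)
      show "prime_factors m \<subseteq> {p\<in>primes_le x. p dvd m}"
        using mx[OF m] by (auto simp: primes_le_def in_prime_factors_iff intro: order.trans[OF dvd_imp_le])
    qed (use mx[OF m] in \<open>auto simp: primes_le_def\<close>)
    also have "\<dots> \<le> (\<Sum>p\<in>{p\<in>primes_le x. p dvd m}. real k * ln (real p))"
    proof (rule sum_mono)
      fix p assume p: "p \<in> {p\<in>primes_le x. p dvd m}"
      then have pr: "prime p" "p \<ge> 2" by (auto dest: primes_le_D)
      have "\<not> p ^ k dvd m" using m pr by (auto simp: sifted_def)
      moreover have "p ^ multiplicity p m dvd m" by (rule multiplicity_dvd)
      ultimately have "multiplicity p m < k" by (metis le_imp_power_dvd dvd_trans not_le)
      then show "real (multiplicity p m) * ln (real p) \<le> real k * ln (real p)"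
        using pr by (intro mult_right_mono) auto
    qed
    finally show "ln (real m) \<le> (\<Sum>p\<in>{p\<in>primes_le x. p dvd m}. real k * ln (real p))" .
  qed
  also have "\<dots> = (\<Sum>(m, p)\<in>(SIGMA m:?W. {p\<in>primes_le x. p dvd m}). real k * ln (real p))"
    by (rule sum.Sigma) auto
  \<comment> \<open>Write \<open>m = p * m'\<close>: the cofactor \<open>m'\<close> is again sifted,
    and \<open>p \<le> x div m'\<close>. Chebyshev's bound then applies to the sum over
    \<open>p\<close> for fixed \<open>m'\<close>.\<close>
  also have "\<dots> \<le> (\<Sum>(m', p)\<in>(SIGMA m':?W. primes_le (x div m')). real k * ln (real p))"
  proof -
    let ?h = "\<lambda>(m, p). (m div p, p)"
    let ?S = "SIGMA m:?W. {p\<in>primes_le x. p dvd m}"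
    have inj: "inj_on ?h ?S"
      by (rule inj_onI) (auto dest: dvd_div_eq_iff elim!: dvdE simp: primes_le_def prime_gt_0_nat)
    have img: "?h ` ?S \<subseteq> (SIGMA m':?W. primes_le (x div m'))"
    proof clarify
      fix m p assume m: "m \<in> ?W" and p: "p \<in> primes_le x" "p dvd m"
      then obtain m' where m': "m = p * m'" by blast
      have p0: "p > 0" using p primes_le_D(3)[of p x] by simp
      have m0: "m' \<ge> 1" using mx[OF m] m' by (cases m') auto
      have le: "p * m' \<le> x" using mx[OF m] m' by simp
      have "m' \<le> p * m'" using p0 by simp
      then have "m' \<le> x" using le by linarith
      then have "m' \<in> ?W" using m m' m0 unfolding sifted_def by (auto intro: dvd_mult)
      moreover have "p \<le> x div m'" using le m0 by (simp add: less_eq_div_iff_mult_less_eq)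
      ultimately show "m div p \<in> ?W \<and> p \<in> primes_le (x div (m div p))"
        using m' p0 p by (auto simp: primes_le_def)
    qed
    have "(\<Sum>(m, p)\<in>?S. real k * ln (real p)) = (\<Sum>y\<in>?h ` ?S. real k * ln (real (snd y)))"
      by (subst sum.reindex[OF inj]) (auto simp: case_prod_beta intro!: sum.cong)
    also have "\<dots> \<le> (\<Sum>y\<in>(SIGMA m':?W. primes_le (x div m')). real k * ln (real (snd y)))"
      by (rule sum_mono2[OF _ img]) (auto intro!: finite_SigmaI mult_nonneg_nonneg dest!: primes_le_D(3))
    finally show ?thesis by (simp add: case_prod_beta)
  qed
  also have "\<dots> = (\<Sum>m'\<in>?W. \<Sum>p\<in>primes_le (x div m'). real k * ln (real p))"
    by (rule sum.Sigma[symmetric]) auto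
  also have "\<dots> \<le> (\<Sum>m'\<in>?W. real k * ln 4 * (real x / real m'))"
  proof (rule sum_mono)
    fix m' assume "m' \<in> ?W"
    have "(\<Sum>p\<in>primes_le (x div m'). real k * ln (real p)) = real k * (\<Sum>p\<in>primes_le (x div m'). ln (real p))"
      by (simp add: sum_distrib_left)
    also have "\<dots> \<le> real k * (real (x div m') * ln 4)"
      by (intro mult_left_mono chebyshev_theta_le) auto
    also have "\<dots> \<le> real k * (real x / real m' * ln 4)"
      by (intro mult_left_mono mult_right_mono of_nat_div_le_of_nat) auto
    finally show "(\<Sum>p\<in>primes_le (x div m'). real k * ln (real p)) \<le> real k * ln 4 * (real x / real m')"
      by (simp add: algebra_simps)
  qed
  finally show ?thesis
    by (simp add: sum_distrib_left[symmetric] sum_divide_distrib[symmetric] algebra_simps)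
       (simp add: sum_distrib_left algebra_simps)
qed

text \<open>By Mertens' upper bound the primes outside \<open>Q\<close>, the only ones that can
  divide a sifted number, have density at most \<open>1 - c\<close>. Their Euler product is
  \<open>O((ln x) powr (1 - c))\<close>, and division by \<open>ln x\<close> gives the exponent
  \<open>- c\<close>.\<close>

lemma sifted_bound:
  fixes Q :: "nat set"
  assumes Q: "\<And>p. p \<in> Q \<Longrightarrow> prime p"
    and c: "0 < c" "c < 1"
    and dense: "\<And>n. n \<ge> 1 \<Longrightarrow> (\<Sum>p\<in>{p\<in>Q. p \<le> n}. ln (real p) / real p) \<ge> c * ln (real n) - C"
  obtains D where "\<And>x. x \<ge> 2 \<Longrightarrow> real (card (sifted k Q x)) \<le> D * real x * ln (real x) powr (- c)"
proof -
  define R where "R = {p. prime p \<and> p \<notin> Q}"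
  have finQ: "finite {p\<in>Q. p \<le> n}" "finite {p\<in>R. p \<le> n}" for n by (rule finite_subset[of _ "{..n}"]; auto)+
  have bound: "(\<Sum>p\<in>{p\<in>R. p \<le> n}. ln (real p) / real p) \<le> (1 - c) * ln (real n) + (ln 4 + \<bar>C\<bar>)" if "n \<ge> 1" for n
  proof -
    have "primes_le n = {p\<in>Q. p \<le> n} \<union> {p\<in>R. p \<le> n}"
      using Q by (auto simp: R_def primes_le_def)
    then have "(\<Sum>p\<in>primes_le n. ln (real p) / real p) = (\<Sum>p\<in>{p\<in>Q. p \<le> n}. ln (real p) / real p) + (\<Sum>p\<in>{p\<in>R. p \<le> n}. ln (real p) / real p)"
      using finQ[of n] by (simp only:) (rule sum.union_disjoint, auto simp: R_def)
    then show ?thesis using mertens_upper[OF that] dense[OF that] by (simp add: algebra_simps)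
  qed
  obtain D1 where D1: "\<And>n. n \<ge> 2 \<Longrightarrow> (\<Sum>p\<in>{p\<in>R. p \<le> n}. 1 / real p) \<le> (1 - c) * ln (ln (real n)) + D1"
    using sum_inverse_primes_le[of R "1 - c" "ln 4 + \<bar>C\<bar>", OF _ _ _ bound] c by (auto simp: R_def)
  \<comment> \<open>The 2 absorbs the terms \<open>2 / p^2\<close> of
    \<open>euler_factor_le\<close>, as the sum of \<open>1 / p^2\<close> is at most 1.\<close>
  define E where "E = exp (D1 + 2)"
  show ?thesis
  proof (rule that[of "(1 + real k * ln 4) * E"])
    fix x :: nat assume x: "x \<ge> 2"
    let ?P = "{p\<in>R. p \<le> x}"
    have "(\<Sum>m\<in>sifted k Q x. 1 / real m) \<le> (\<Prod>p\<in>?P. 1 / (1 - 1 / real p))"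
    proof (rule sum_reciprocals_smooth_le)
      fix m assume m: "m \<in> sifted k Q x"
      then have "1 \<le> m" "m \<le> x" "\<And>p. p \<in> Q \<Longrightarrow> \<not> p dvd m" by (auto simp: sifted_def)
      then show "m > 0 \<and> prime_factors m \<subseteq> ?P"
        by (auto simp: R_def in_prime_factors_iff intro: order.trans[OF dvd_imp_le])
    qed (use finQ in \<open>auto simp: R_def\<close>)
    also have "\<dots> \<le> (\<Prod>p\<in>?P. exp (1 / real p + 2 / (real p)\<^sup>2))"
    proof (rule prod_mono)
      fix p assume "p \<in> ?P"
      then have "p \<ge> 2" by (auto simp: R_def prime_ge_2_nat)
      then show "0 \<le> 1 / (1 - 1 / real p) \<and> 1 / (1 - 1 / real p) \<le> exp (1 / real p + 2 / (real p)\<^sup>2)"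
        using euler_factor_le by auto
    qed
    also have "\<dots> = exp ((\<Sum>p\<in>?P. 1 / real p) + 2 * (\<Sum>p\<in>?P. 1 / (real p)\<^sup>2))"
      unfolding exp_sum[OF finQ(2), symmetric] by (simp add: sum.distrib sum_distrib_left)
    also have "\<dots> \<le> exp (((1 - c) * ln (ln (real x)) + D1) + 2 * 1)"
    proof -
      have "(\<Sum>p\<in>?P. 1 / (real p)\<^sup>2) \<le> (\<Sum>m=2..x. 1 / (real m)\<^sup>2)"
        by (rule sum_mono2) (auto simp: R_def prime_ge_2_nat)
      then have "(\<Sum>p\<in>?P. 1 / (real p)\<^sup>2) \<le> 1" using sum_inverse_squares_le[of x] by linarith
      then show ?thesis using D1[OF x] by simp
    qed
    also have "\<dots> = E * ln (real x) powr (1 - c)"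
      using x by (simp add: E_def powr_def exp_add[symmetric] algebra_simps)
    finally have *: "(\<Sum>m\<in>sifted k Q x. 1 / real m) \<le> E * ln (real x) powr (1 - c)" .
    have lx: "ln (real x) > 0" using x by simp
    have "real (card (sifted k Q x)) * ln (real x) \<le> (1 + real k * ln 4) * real x * (\<Sum>m\<in>sifted k Q x. 1 / real m)"
      by (rule card_sifted_ln_le) (use x in simp)
    also have "\<dots> \<le> (1 + real k * ln 4) * real x * (E * ln (real x) powr (1 - c))"
      by (rule mult_left_mono[OF *]) simp
    also have "ln (real x) powr (1 - c) = ln (real x) powr (- c) * ln (real x)"
      using lx powr_add[of "ln (real x)" "-c" 1] by (simp add: algebra_simps)
    finally have "real (card (sifted k Q x)) * ln (real x)
        \<le> ((1 + real k * ln 4) * E * real x * ln (real x) powr (- c)) * ln (real x)"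
      by (simp add: mult_ac)
    then show "real (card (sifted k Q x)) \<le> (1 + real k * ln 4) * E * real x * ln (real x) powr (- c)"
      using lx by (simp only: mult_le_cancel_right_pos)
  qed
qed

section \<open>Boxes in an order of a number field\<close>

abbreviation cpoly :: "int poly \<Rightarrow> complex poly" where "cpoly \<equiv> map_poly of_int"

text \<open>A polynomial is read as the vector of its coefficients; half-open intervals make the
  number of elements exactly \<open>X ^ n\<close>.\<close>

definition ibox :: "nat \<Rightarrow> nat \<Rightarrow> int poly set" where
  "ibox n X = {f. (\<forall>i<n. 0 \<le> coeff f i \<and> coeff f i < int X) \<and> (\<forall>i\<ge>n. coeff f i = 0)}"

lemma ibox_0: "ibox 0 X = {0}"
  unfolding ibox_def by (auto simp: poly_eq_iff)

lemma ibox_Suc: "ibox (Suc n) X = (\<lambda>(x, b). pCons x b) ` ({0..<int X} \<times> ibox n X)"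
proof (intro equalityI subsetI)
  fix f assume f: "f \<in> ibox (Suc n) X"
  obtain x b where xb: "f = pCons x b" by (cases f) auto
  have "0 \<le> coeff f 0 \<and> coeff f 0 < int X" using f by (auto simp: ibox_def)
  moreover have "0 \<le> coeff f (Suc i) \<and> coeff f (Suc i) < int X" if "i < n" for i
    using f that by (auto simp: ibox_def)
  moreover have "coeff f (Suc i) = 0" if "i \<ge> n" for i
    using f that by (auto simp: ibox_def)
  ultimately have "x \<in> {0..<int X}" "b \<in> ibox n X" unfolding xb ibox_def by auto
  then show "f \<in> (\<lambda>(x, b). pCons x b) ` ({0..<int X} \<times> ibox n X)" using xb by auto
qed (auto simp: ibox_def coeff_pCons split: nat.splits)

lemma finite_ibox [simp]: "finite (ibox n X)"
  by (induction n) (auto simp: ibox_0 ibox_Suc)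

lemma card_ibox: "card (ibox n X) = X ^ n"
proof (induction n)
  case (Suc n)
  have "inj_on (\<lambda>(x, b). pCons x b) ({0..<int X} \<times> ibox n X)" by (auto simp: inj_on_def)
  then show ?case using Suc by (simp add: ibox_Suc card_image card_cartesian_product)
qed (simp add: ibox_0)

text \<open>Only the constant coefficient varies in a fibre. It is the variable in which the norm
  will be a monic polynomial.\<close>

lemma card_ibox_fibres:
  assumes "\<And>b. real (card {x\<in>{0..<int X}. P (pCons x b)}) \<le> K"
  shows "real (card {a\<in>ibox (Suc n) X. P a}) \<le> K * real X ^ n"
proof -
  let ?S = "SIGMA b:ibox n X. {x\<in>{0..<int X}. P (pCons x b)}"
  have "{a\<in>ibox (Suc n) X. P a} \<subseteq> (\<lambda>(b, x). pCons x b) ` ?S"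
    unfolding ibox_Suc by auto
  then have "card {a\<in>ibox (Suc n) X. P a} \<le> card ?S"
  proof (rule surj_card_le[rotated])
    show "finite ?S"
      by (intro finite_SigmaI finite_ibox, rule finite_subset[of _ "{0..<int X}"]) auto
  qed
  also have "card ?S = (\<Sum>b\<in>ibox n X. card {x\<in>{0..<int X}. P (pCons x b)})"
    by (rule card_SigmaI) (auto intro: finite_subset[of _ "{0..<int X}"])
  finally have "real (card {a\<in>ibox (Suc n) X. P a}) \<le> (\<Sum>b\<in>ibox n X. real (card {x\<in>{0..<int X}. P (pCons x b)}))"
    by (simp only: of_nat_le_iff flip: of_nat_sum)
  also have "\<dots> \<le> (\<Sum>b\<in>ibox n X. K)" by (rule sum_mono) (rule assms)
  finally show ?thesis by (simp add: card_ibox mult.commute)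
qed

section \<open>Ideals of Z[T] and sets of incongruent elements\<close>

definition poly_ideal :: "int poly set \<Rightarrow> bool" where
  "poly_ideal J \<longleftrightarrow> 0 \<in> J \<and> (\<forall>a\<in>J. \<forall>b\<in>J. a + b \<in> J) \<and> (\<forall>a\<in>J. \<forall>f. f * a \<in> J)"

lemma poly_idealD:
  assumes "poly_ideal J"
  shows "0 \<in> J" "a \<in> J \<Longrightarrow> b \<in> J \<Longrightarrow> a + b \<in> J" "a \<in> J \<Longrightarrow> f * a \<in> J" "a \<in> J \<Longrightarrow> a * f \<in> J"
  using assms unfolding poly_ideal_def by (auto simp: mult.commute)

lemma poly_ideal_uminus:
  assumes "poly_ideal J" "a \<in> J" shows "- a \<in> J"
  using poly_idealD(3)[OF assms, of "-1"] by simp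

lemma poly_ideal_diff:
  assumes "poly_ideal J" "a \<in> J" "b \<in> J" shows "a - b \<in> J"
  using poly_idealD(2)[OF assms(1,2) poly_ideal_uminus[OF assms(1,3)]] by simp

lemma poly_ideal_dvd:
  assumes "poly_ideal J" "a \<in> J" "a dvd b" shows "b \<in> J"
  using assms by (auto elim!: dvdE intro: poly_idealD)

lemma poly_ideal_sum:
  assumes "poly_ideal J" "\<And>x. x \<in> A \<Longrightarrow> f x \<in> J" shows "sum f A \<in> J"
  using assms(2) by (induction A rule: infinite_finite_induct) (auto intro: poly_idealD[OF assms(1)])

text \<open>Stands in for the index: the size of such a \<open>V\<close> bounds the number of
  classes modulo \<open>J\<close> from below, without forming a quotient ring.\<close>

definition incongruent :: "int poly set \<Rightarrow> int poly set \<Rightarrow> bool" where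
  "incongruent J V \<longleftrightarrow> (\<forall>v\<in>V. \<forall>w\<in>V. v - w \<in> J \<longrightarrow> v = w)"

lemma ibox_add:
  assumes "u \<in> ibox n X" "v \<in> ibox n Y" "0 < Y" shows "u + v \<in> ibox n (X + Y)"
  using assms unfolding ibox_def by (auto intro: add_strict_mono)

text \<open>Packing: the translates of \<open>J \<inter> ibox n X\<close> by the elements of
  \<open>V\<close> are disjoint and lie in one larger box.\<close>

lemma card_incongruent_times_le:
  assumes J: "poly_ideal J" and V: "incongruent J V" "V \<subseteq> ibox n Y" "0 < Y"
  shows "card V * card (J \<inter> ibox n X) \<le> (X + Y) ^ n"
proof -
  have fin: "finite V" using V(2) finite_ibox finite_subset by blast
  have inj: "inj_on (\<lambda>(v, u). v + u) (V \<times> (J \<inter> ibox n X))"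
  proof (rule inj_onI, clarify)
    fix v u v' u' assume *: "v \<in> V" "v' \<in> V" "u \<in> J" "u' \<in> J" "v + u = v' + u'"
    then have "v - v' = u' - u" by (simp add: algebra_simps)
    then have "v - v' \<in> J" using poly_ideal_diff[OF J] * by metis
    then have "v = v'" using V(1) * by (auto simp: incongruent_def)
    then show "v = v' \<and> u = u'" using * by simp
  qed
  have "(\<lambda>(v, u). v + u) ` (V \<times> (J \<inter> ibox n X)) \<subseteq> ibox n (X + Y)"
  proof clarify
    fix v u assume "v \<in> V" "u \<in> ibox n X"
    then show "v + u \<in> ibox n (X + Y)" using ibox_add[of u n X v Y] V(2,3) by (auto simp: add.commute)
  qed
  then have "card ((\<lambda>(v, u). v + u) ` (V \<times> (J \<inter> ibox n X))) \<le> (X + Y) ^ n"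
    unfolding card_ibox[symmetric] by (rule card_mono[OF finite_ibox])
  then show ?thesis using inj by (simp add: card_image card_cartesian_product)
qed

text \<open>The order \<open>\<int>[\<gamma>]\<close>, where \<open>\<gamma>\<close> is an algebraic integer with minimal polynomial \<open>R\<close>. Its elements are
  represented by integer polynomials modulo \<open>R\<close>, its ideals by the ideals of \<open>\<int>[T]\<close> that contain \<open>R\<close>.\<close>

locale number_order =
  fixes \<gamma> :: complex and R :: "int poly" and g :: nat
  assumes monic: "lead_coeff R = 1" and deg: "degree R = g" and gpos: "g > 0"
    and root: "poly (cpoly R) \<gamma> = 0"
    and minimal: "\<And>f. f \<noteq> 0 \<Longrightarrow> poly (cpoly f) \<gamma> = 0 \<Longrightarrow> g \<le> degree f"
begin

definition ev :: "int poly \<Rightarrow> complex" where "ev f = poly (cpoly f) \<gamma>"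

lemma ev_simps [simp]:
  "ev 0 = 0" "ev 1 = 1" "ev (f + h) = ev f + ev h" "ev (f - h) = ev f - ev h" "ev (f * h) = ev f * ev h"
  "ev (smult c f) = of_int c * ev f" "ev (pCons c f) = of_int c + \<gamma> * ev f" "ev R = 0"
  using root by (simp_all add: ev_def of_int_poly_hom.hom_add of_int_poly_hom.hom_mult of_int_poly_hom.hom_minus
       map_poly_pCons hom_distribs)

lemma R_nz: "R \<noteq> 0" using gpos deg by auto

text \<open>As \<open>R\<close> is monic, pseudo-division by it is true division with
  remainder.\<close>

definition red :: "int poly \<Rightarrow> int poly" where "red f = pseudo_mod f R"

lemma R_dvd_diff_red: "R dvd f - red f"
proof -
  obtain q r where qr: "pseudo_divmod f R = (q, r)" by force
  from pseudo_divmod(1)[OF R_nz qr] monic have "f = R * q + r" by (simp add: deg)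
  moreover have "red f = r" using qr by (simp add: red_def pseudo_mod_def)
  ultimately show ?thesis by simp
qed

lemma degree_red: "degree (red f) < g"
  using pseudo_mod(2)[OF R_nz, of f] gpos deg unfolding red_def by auto

lemma R_dvd_small: "R dvd f \<Longrightarrow> degree f < g \<Longrightarrow> f = 0"
  using dvd_imp_degree_le[of R f] deg by fastforce

lemma red_unique:
  assumes "R dvd f - r" "degree r < g" shows "red f = r"
proof -
  have "R dvd (f - r) - (f - red f)" using assms(1) R_dvd_diff_red by (rule dvd_diff)
  then have "R dvd red f - r" by simp
  moreover have "degree (red f - r) < g" using degree_red assms(2) by (rule degree_diff_less)
  ultimately show ?thesis using R_dvd_small by fastforce
qed

lemma red_cong: "R dvd f - h \<Longrightarrow> red f = red h"
proof -
  assume "R dvd f - h"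
  then have "R dvd (f - h) + (h - red h)" using R_dvd_diff_red by (rule dvd_add)
  then show ?thesis by (intro red_unique) (simp_all add: degree_red)
qed

lemma red_small: "degree f < g \<Longrightarrow> red f = f"
  by (rule red_unique) auto

lemma red_add: "red (f + h) = red f + red h"
proof (rule red_unique)
  have "R dvd (f - red f) + (h - red h)" by (intro dvd_add R_dvd_diff_red)
  then show "R dvd (f + h) - (red f + red h)" by (simp add: algebra_simps)
qed (simp add: degree_add_less degree_red)

lemma red_smult: "red (smult c f) = smult c (red f)"
proof (rule red_unique)
  have "R dvd smult c (f - red f)" by (intro dvd_smult R_dvd_diff_red)
  then show "R dvd smult c f - smult c (red f)" by (simp add: smult_diff_right)
  show "degree (smult c (red f)) < g" using degree_smult_le degree_red by (rule le_less_trans)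
qed

lemma red_0 [simp]: "red 0 = 0" using gpos by (simp add: red_small)

lemma red_sum: "red (sum f A) = (\<Sum>x\<in>A. red (f x))"
  by (induction A rule: infinite_finite_induct) (auto simp: red_add)

lemma red_mult_red: "red (red f * h) = red (f * h)"
proof (rule red_cong)
  have "R dvd (f - red f) * h" using R_dvd_diff_red by (rule dvd_mult2)
  then have "R dvd - ((f - red f) * h)" by simp
  then show "R dvd red f * h - f * h" by (simp add: algebra_simps)
qed

lemma coeff_red_ge: "i \<ge> g \<Longrightarrow> coeff (red f) i = 0"
  using degree_red[of f] by (simp add: coeff_eq_0)

lemma ev_red: "ev (red f) = ev f"
proof -
  obtain q where "f - red f = R * q" using R_dvd_diff_red by blast
  then have "ev (f - red f) = ev R * ev q" by (metis ev_simps(5))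
  then show ?thesis by simp
qed

lemma ev_eq_0_iff: "ev f = 0 \<longleftrightarrow> R dvd f"
proof
  assume "ev f = 0"
  then have "ev (red f) = 0" by (simp add: ev_red)
  then have "red f = 0" using minimal[of "red f"] degree_red[of f] by (auto simp: ev_def)
  then show "R dvd f" using R_dvd_diff_red[of f] by simp
qed auto

lemma ev_small_nz: "f \<noteq> 0 \<Longrightarrow> degree f < g \<Longrightarrow> ev f \<noteq> 0"
  using R_dvd_small ev_eq_0_iff by blast

text \<open>A non-zero element \<open>f\<close> of least degree in the ideal generated by
  \<open>a\<close> and \<open>R\<close> divides both up to integer factors. It does not vanish at
  \<gamma> because \<open>a\<close> does not, so the cofactor of \<open>R\<close> does; by
  minimality that cofactor has full degree \<open>g\<close>, and \<open>f\<close> is a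
  constant.\<close>

lemma inverse_exists:
  assumes "ev a \<noteq> 0"
  obtains b m where "m > (0::int)" "R dvd a * b - [:m:]"
proof -
  define I where "I = {f. \<exists>u w. f = u * a + w * R}"
  have I: "poly_ideal I"
    unfolding poly_ideal_def I_def
  proof (intro conjI ballI allI; clarify)
    show "\<exists>u w. 0 = u * a + w * R" by (rule exI[of _ 0], rule exI[of _ 0]) simp
    fix u w u' w' show "\<exists>u'' w''. u * a + w * R + (u' * a + w' * R) = u'' * a + w'' * R"
      by (rule exI[of _ "u + u'"], rule exI[of _ "w + w'"]) (simp add: algebra_simps)
  next
    fix f u w show "\<exists>u'' w''. f * (u * a + w * R) = u'' * a + w'' * R"
      by (rule exI[of _ "f * u"], rule exI[of _ "f * w"]) (simp add: algebra_simps)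
  qed
  have aI: "a \<in> I" unfolding I_def mem_Collect_eq by (rule exI[of _ 1], rule exI[of _ 0]) simp
  have RI: "R \<in> I" unfolding I_def mem_Collect_eq by (rule exI[of _ 0], rule exI[of _ 1]) simp
  have a0: "a \<noteq> 0" using assms by auto
  obtain f where f: "f \<in> I" "f \<noteq> 0" "\<And>h. h \<in> I \<Longrightarrow> h \<noteq> 0 \<Longrightarrow> degree f \<le> degree h"
    using exists_least_iff[of "\<lambda>n. \<exists>f\<in>I. f \<noteq> 0 \<and> degree f = n"] aI a0
    by (metis not_less)
  have dvd: "\<exists>c q. c \<noteq> 0 \<and> smult c h = f * q" if h: "h \<in> I" for h
  proof -
    obtain c q where cq: "c \<noteq> 0" "smult c h = f * q + pseudo_mod h f"
      using pseudo_mod(1)[OF f(2), of h] by blast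
    then have "pseudo_mod h f = [:c:] * h - f * q" by simp
    then have "pseudo_mod h f \<in> I"
      using poly_ideal_diff[OF I poly_idealD(3)[OF I h, of "[:c:]"] poly_idealD(4)[OF I f(1), of q]] by simp
    then have "pseudo_mod h f = 0" using f(3)[of "pseudo_mod h f"] pseudo_mod(2)[OF f(2), of h] by fastforce
    then show ?thesis using cq by auto
  qed
  obtain c q where c: "c \<noteq> 0" "smult c R = f * q" using dvd[OF RI] by blast
  obtain c' q' where c': "c' \<noteq> 0" "smult c' a = f * q'" using dvd[OF aI] by blast
  have "of_int c' * ev a = ev f * ev q'" using c'(2) by (metis ev_simps(5,6))
  then have "ev f \<noteq> 0" using c'(1) assms by auto
  moreover have "0 = ev f * ev q" using c(2) by (metis ev_simps(5,6,8) mult_zero_right)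
  ultimately have "ev q = 0" by simp
  moreover have q0: "q \<noteq> 0" using c R_nz by auto
  ultimately have "g \<le> degree q" using minimal by (auto simp: ev_def)
  moreover have "g = degree f + degree q"
    using arg_cong[OF c(2), of degree] c(1) f(2) q0 deg by (simp add: degree_mult_eq)
  ultimately have "degree f = 0" by simp
  then obtain m where m: "f = [:m:]" by (auto elim: degree_eq_zeroE)
  obtain u w where uw: "f = u * a + w * R" using f(1) by (auto simp: I_def)
  have "a * u - [:m:] = - (w * R)" using uw m by (simp add: algebra_simps)
  then have d: "R dvd a * u - [:m:]" by (metis dvd_minus_iff dvd_triv_right)
  have m0: "m \<noteq> 0" using m f by auto
  show ?thesis
  proof (cases "m > 0")
    case True then show ?thesis using d that by blast
  next
    case False
    have "a * (- u) - [:- m:] = - (a * u - [:m:])" by simp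
    then have "R dvd a * (- u) - [:- m:]" using d by (metis dvd_minus_iff)
    then show ?thesis using that[of "- m" "- u"] m0 False by simp
  qed
qed

text \<open>Growth constant of the reduction modulo \<open>R\<close>, applied to products of two
  reduced elements; these have degree below \<open>2 * g\<close>.\<close>

definition \<kappa> :: nat where
  "\<kappa> = nat (1 + (\<Sum>l<2*g. \<Sum>j<g. \<bar>coeff (red (monom 1 l)) j\<bar>))"

lemma kappa_pos: "\<kappa> \<ge> 1"
proof -
  have "(\<Sum>l<2*g. \<Sum>j<g. \<bar>coeff (red (monom 1 l)) j\<bar>) \<ge> 0" by (intro sum_nonneg) auto
  then show ?thesis unfolding \<kappa>_def by linarith
qed

lemma coeff_red_bound:
  assumes "degree f < 2 * g" "\<And>l. \<bar>coeff f l\<bar> \<le> B"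
  shows "\<bar>coeff (red f) j\<bar> \<le> int \<kappa> * B"
proof -
  have B0: "B \<ge> 0" using assms(2)[of 0] by linarith
  have "f = (\<Sum>l<2*g. smult (coeff f l) (monom 1 l))"
    using assms(1) by (intro poly_eqI) (auto simp: coeff_sum coeff_eq_0 if_distrib cong: if_cong)
  then have "red f = (\<Sum>l<2*g. smult (coeff f l) (red (monom 1 l)))"
    by (metis (no_types, lifting) red_sum red_smult sum.cong)
  then have "\<bar>coeff (red f) j\<bar> = \<bar>\<Sum>l<2*g. coeff f l * coeff (red (monom 1 l)) j\<bar>"
    by (simp add: coeff_sum)
  also have "\<dots> \<le> (\<Sum>l<2*g. \<bar>coeff f l * coeff (red (monom 1 l)) j\<bar>)" by (rule sum_abs)
  also have "\<dots> \<le> (\<Sum>l<2*g. B * (\<Sum>j<g. \<bar>coeff (red (monom 1 l)) j\<bar>))"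
  proof (rule sum_mono)
    fix l
    have "\<bar>coeff (red (monom 1 l)) j\<bar> \<le> (\<Sum>j<g. \<bar>coeff (red (monom 1 l)) j\<bar>)"
    proof (cases "j < g")
      case True then show ?thesis by (intro member_le_sum) auto
    next
      case False then show ?thesis by (simp add: coeff_red_ge sum_nonneg)
    qed
    then show "\<bar>coeff f l * coeff (red (monom 1 l)) j\<bar> \<le> B * (\<Sum>j<g. \<bar>coeff (red (monom 1 l)) j\<bar>)"
      unfolding abs_mult using assms(2) B0 by (intro mult_mono) auto
  qed
  also have "\<dots> = B * (\<Sum>l<2*g. \<Sum>j<g. \<bar>coeff (red (monom 1 l)) j\<bar>)" by (simp add: sum_distrib_left)
  also have "\<dots> \<le> B * int \<kappa>" using B0 unfolding \<kappa>_def by (intro mult_left_mono) auto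
  finally show ?thesis by (simp add: mult.commute)
qed

text \<open>Choose \<open>b\<close> with \<open>a b = m\<close> a positive integer. Rounding the coordinates of \<open>v b / m\<close> to integers
  gives a multiple of \<open>a\<close> close to \<open>v\<close>.\<close>

lemma covering_sym:
  assumes J: "poly_ideal J" "R \<in> J" and a: "a \<in> J" "a \<noteq> 0" "degree a < g" "\<And>i. \<bar>coeff a i\<bar> \<le> A"
  shows "\<exists>v'. degree v' < g \<and> v - v' \<in> J \<and> (\<forall>i. \<bar>coeff v' i\<bar> \<le> int (\<kappa> * g) * A)"
proof -
  obtain b m where bm: "m > 0" "R dvd a * b - [:m:]"
    using inverse_exists[OF ev_small_nz[OF a(2,3)]] by blast
  define c where "c = red (v * b)"
  define q where "q = map_poly (\<lambda>x. x div m) c"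
  define \<rho> where "\<rho> = map_poly (\<lambda>x. x mod m) c"
  have c: "c = smult m q + \<rho>"
    unfolding q_def \<rho>_def by (intro poly_eqI) (simp add: coeff_map_poly)
  have degrho: "degree \<rho> < g" unfolding \<rho>_def c_def
    using degree_red[of "v * b"] by (metis degree_map_poly_le order_le_less_trans)
  have rho: "\<bar>coeff \<rho> i\<bar> \<le> m" for i unfolding \<rho>_def using bm(1) by (simp add: coeff_map_poly less_imp_le)
  define v' where "v' = red (v - q * a)"
  have A0: "A \<ge> 0" using a(4)[of 0] by linarith
  \<comment> \<open>Modulo \<open>R\<close>,
    \<open>m * (v - q * a) = (v * b - m * q) * a = \<rho> * a\<close>. The coefficients of \<rho>
    are at most \<open>m\<close>, so \<open>m\<close> cancels and the bound depends on neither
    \<open>m\<close> nor \<open>v\<close>.\<close>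
  have "smult m v' = red (\<rho> * a)"
  proof -
    have "R dvd (v * b - c) * a" unfolding c_def by (intro dvd_mult2 R_dvd_diff_red)
    moreover have "R dvd v * (a * b - [:m:])" using bm(2) by (rule dvd_mult)
    ultimately have "R dvd (v * b - c) * a - v * (a * b - [:m:])" by (rule dvd_diff)
    also have "(v * b - c) * a - v * (a * b - [:m:]) = smult m (v - q * a) - \<rho> * a"
      unfolding c by (simp add: algebra_simps smult_diff_right)
    finally have "red (smult m (v - q * a)) = red (\<rho> * a)" by (rule red_cong)
    then show ?thesis by (simp add: v'_def red_smult)
  qed
  moreover have "\<bar>coeff (red (\<rho> * a)) i\<bar> \<le> int \<kappa> * (int g * (m * A))" for i
  proof (rule coeff_red_bound)
    show "degree (\<rho> * a) < 2 * g" using degree_mult_le[of \<rho> a] degrho a(3) by linarith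
    fix l
    have "\<bar>coeff (\<rho> * a) l\<bar> \<le> (\<Sum>i\<le>l. \<bar>coeff \<rho> i * coeff a (l - i)\<bar>)"
      unfolding coeff_mult by (rule sum_abs)
    also have "\<dots> = (\<Sum>i\<in>{..l} \<inter> {..<g}. \<bar>coeff \<rho> i * coeff a (l - i)\<bar>)"
      using degrho by (intro sum.mono_neutral_right) (auto dest!: le_degree)
    also have "\<dots> \<le> (\<Sum>i\<in>{..l} \<inter> {..<g}. m * A)"
      unfolding abs_mult using rho a(4) bm(1) by (intro sum_mono mult_mono) auto
    also have "\<dots> = int (card ({..l} \<inter> {..<g})) * (m * A)" by simp
    also have "\<dots> \<le> int g * (m * A)"
    proof (rule mult_right_mono)
      have "card ({..l} \<inter> {..<g}) \<le> card {..<g}" by (rule card_mono) auto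
      then show "int (card ({..l} \<inter> {..<g})) \<le> int g" by simp
    qed (use A0 bm(1) in auto)
    finally show "\<bar>coeff (\<rho> * a) l\<bar> \<le> int g * (m * A)" .
  qed
  ultimately have "\<bar>coeff (smult m v') i\<bar> \<le> int \<kappa> * (int g * (m * A))" for i by metis
  then have "m * \<bar>coeff v' i\<bar> \<le> m * (int (\<kappa> * g) * A)" for i
    using bm(1) by (simp add: abs_mult algebra_simps)
  then have "\<bar>coeff v' i\<bar> \<le> int (\<kappa> * g) * A" for i
    using bm(1) by (simp only: mult_le_cancel_left_pos)
  moreover have "degree v' < g" unfolding v'_def by (rule degree_red)
  moreover have "v - v' \<in> J"
  proof -
    have "(v - q * a) - v' \<in> J" unfolding v'_def using R_dvd_diff_red J by (metis poly_ideal_dvd)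
    moreover have "q * a \<in> J" using J a by (intro poly_idealD)
    ultimately have "((v - q * a) - v') + q * a \<in> J" by (rule poly_idealD(2)[OF J(1)])
    then show ?thesis by (simp add: algebra_simps)
  qed
  ultimately show ?thesis by blast
qed

text \<open>Twice the constant of \<open>covering_sym\<close>: a symmetric range is shifted to a
  range starting at 0.\<close>

definition cov :: nat where "cov = 2 * \<kappa> * g"

lemma covering:
  assumes J: "poly_ideal J" "R \<in> J" and a: "a \<in> J" "a \<noteq> 0" "degree a < g" "\<And>i. \<bar>coeff a i\<bar> \<le> int A"
  shows "\<exists>v'\<in>ibox g (cov * A + 1). v - v' \<in> J"
proof -
  define w where "w = (\<Sum>i<g. monom (int (\<kappa> * g * A)) i)"
  have w: "coeff w i = (if i < g then int (\<kappa> * g * A) else 0)" for i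
    by (simp add: w_def coeff_sum)
  obtain v' where v': "degree v' < g" "v - w - v' \<in> J" "\<And>i. \<bar>coeff v' i\<bar> \<le> int (\<kappa> * g) * int A"
    using covering_sym[OF J a, of "v - w"] by blast
  have eq: "int (cov * A + 1) = 2 * (int (\<kappa> * g) * int A) + 1" "int (\<kappa> * g * A) = int (\<kappa> * g) * int A"
    by (simp_all add: cov_def algebra_simps)
  have "v' + w \<in> ibox g (cov * A + 1)"
    unfolding ibox_def
  proof (intro CollectI conjI allI impI)
    fix i assume "i < g"
    then have *: "coeff (v' + w) i = coeff v' i + int (\<kappa> * g * A)" by (simp add: w)
    show "0 \<le> coeff (v' + w) i" "coeff (v' + w) i < int (cov * A + 1)"
      unfolding * using v'(3)[of i] unfolding eq abs_le_iff by linarith+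
  next
    fix i assume "i \<ge> g" then show "coeff (v' + w) i = 0" using v'(1) by (simp add: w coeff_eq_0)
  qed
  moreover have "v - (v' + w) \<in> J" using v'(2) by (simp add: algebra_simps)
  ultimately show ?thesis by blast
qed

lemma ibox_degree: "f \<in> ibox g X \<Longrightarrow> degree f < g"
  using gpos by (auto simp: ibox_def intro!: degree_lessI)

lemma ibox_abs_le: "f \<in> ibox n X \<Longrightarrow> \<bar>coeff f i\<bar> \<le> int X"
  by (cases "i < n") (auto simp: ibox_def)

text \<open>Packing needs \<open>V\<close> inside a box. The non-zero element \<open>a\<close> makes
  \<open>covering\<close> available, which replaces \<open>V\<close> by congruent elements in a box
  of side comparable to \<open>X\<close>, however large the original elements are.\<close>

lemma card_ideal_box_le:
  assumes J: "poly_ideal J" "R \<in> J" and V: "incongruent J V" "finite V" and X: "X \<ge> 1"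
    and a: "a \<in> J" "a \<noteq> 0" "a \<in> ibox g X"
  shows "card V * card (J \<inter> ibox g X) \<le> ((cov + 2) * X) ^ g"
proof -
  have "\<exists>v'\<in>ibox g (cov * X + 1). v - v' \<in> J" for v
    by (rule covering[OF J a(1,2)]) (use a(3) ibox_degree ibox_abs_le in auto)
  then obtain h where h: "\<And>v. h v \<in> ibox g (cov * X + 1)" "\<And>v. v - h v \<in> J" by metis
  have cong: "v - w \<in> J" if "h v - h w \<in> J" for v w
  proof -
    have "(v - h v) + (h v - h w) - (w - h w) \<in> J"
      by (rule poly_ideal_diff[OF J(1) poly_idealD(2)[OF J(1) h(2) that] h(2)])
    then show ?thesis by simp
  qed
  have inj: "inj_on h V"
    by (rule inj_onI) (metis V(1) cong incongruent_def diff_self poly_idealD(1)[OF J(1)])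
  have "incongruent J (h ` V)" using V(1) cong unfolding incongruent_def by blast
  then have "card (h ` V) * card (J \<inter> ibox g X) \<le> (X + (cov * X + 1)) ^ g"
    by (rule card_incongruent_times_le[OF J(1)]) (use h in auto)
  also have "\<dots> \<le> ((cov + 2) * X) ^ g" using X by (intro power_mono) auto
  finally show ?thesis using inj by (simp add: card_image)
qed

end

section \<open>Average number of roots modulo primes\<close>

lemma ln_of_nat_mono: "0 < a \<Longrightarrow> a \<le> b \<Longrightarrow> ln (real a) \<le> ln (real b)"
  by (subst ln_le_cancel_iff) auto

lemma ln_of_nat_mult: "0 < a \<Longrightarrow> 0 < b \<Longrightarrow> ln (real (a * b)) = ln (real a) + ln (real b)"
  by (simp add: ln_mult)

lemma coprime_int_if_not_dvd:
  assumes "prime p" "\<not> int p dvd a" shows "coprime a (int p)"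
  using assms prime_imp_coprime_int[of "int p" a] by (subst algebraic_semidom_class.coprime_commute) simp

definition roots_mod :: "int poly \<Rightarrow> nat \<Rightarrow> int set" where
  "roots_mod f p = {r\<in>{0..<int p}. int p dvd poly f r}"

lemma finite_roots_mod [simp]: "finite (roots_mod f p)"
  unfolding roots_mod_def by (rule finite_subset[of _ "{0..<int p}"]) auto

text \<open>Lagrange interpolation and Chinese remaindering combined: the product of
  \<open>T - r'\<close> for the other residues at the same prime and of the constants
  \<open>p'\<close> for the other primes, normalised at \<open>r\<close>.\<close>

lemma interpolation_unit:
  fixes T :: "(nat \<times> int) set"
  assumes T: "finite T" "\<And>p r. (p, r) \<in> T \<Longrightarrow> prime p \<and> r \<in> {0..<int p}" and t: "(p, r) \<in> T"
  shows "\<exists>e. [poly e r = 1] (mod int p) \<and> (\<forall>(p', r')\<in>T - {(p, r)}. int p' dvd poly e r')"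
proof -
  define h where "h = (\<lambda>(p', r'). if p' = p then [:- r', 1:] else [:int p':])"
  define e0 where "e0 = (\<Prod>t\<in>T - {(p, r)}. h t)"
  have pr: "prime (int p)" using T(2)[OF t] by simp
  have "\<not> int p dvd poly (h t') r" if "t' \<in> T - {(p, r)}" for t'
  proof -
    obtain p' r' where t': "t' = (p', r')" by force
    show ?thesis
    proof (cases "p' = p")
      case True
      then have "r' \<noteq> r" "r' \<in> {0..<int p}" "r \<in> {0..<int p}" using that t' T(2) t by auto
      then have "\<not> int p dvd r - r'" using zdvd_not_zless[of "r - r'" "int p"] zdvd_not_zless[of "r' - r" "int p"]
        by (cases "r > r'") (auto simp: dvd_diff_commute)
      then show ?thesis using True by (simp add: h_def t')
    next
      case False
      have "prime p'" using T(2) that t' by blast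
      then have "\<not> p dvd p'" using False T(2)[OF t] primes_dvd_imp_eq by blast
      then show ?thesis using False by (simp add: h_def t')
    qed
  qed
  moreover have "int p dvd poly e0 r \<longleftrightarrow> (\<exists>t'\<in>T - {(p, r)}. int p dvd poly (h t') r)"
    unfolding e0_def poly_prod by (rule prime_dvd_prod_iff) (use T(1) pr in auto)
  ultimately have "\<not> int p dvd poly e0 r" by simp
  then have "coprime (poly e0 r) (int p)" using T(2)[OF t] by (intro coprime_int_if_not_dvd) auto
  then obtain u where u: "[poly e0 r * u = 1] (mod int p)" using cong_solve_coprime_int by blast
  have "int p' dvd poly (smult u e0) r'" if "(p', r') \<in> T - {(p, r)}" for p' r'
  proof -
    have "h (p', r') dvd e0" unfolding e0_def using T(1) that by (intro dvd_prodI) auto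
    then have "poly (h (p', r')) r' dvd poly e0 r'" by (auto elim!: dvdE)
    moreover have "int p' dvd poly (h (p', r')) r'" by (simp add: h_def)
    ultimately show ?thesis by (metis dvd_mult dvd_trans poly_smult)
  qed
  then show ?thesis using u by (intro exI[of _ "smult u e0"]) (auto simp: mult.commute)
qed

text \<open>The interpolation units realise every choice of values modulo \<open>p\<close> at all
  pairs \<open>(p, r)\<close> independently. This is the lower bound for the index of an
  intersection of ideals of index \<open>p\<close>.\<close>

lemma exists_incongruent_family:
  fixes T :: "(nat \<times> int) set"
  assumes T: "finite T" "\<And>p r. (p, r) \<in> T \<Longrightarrow> prime p \<and> r \<in> {0..<int p}"
  obtains V where "finite V" "card V = (\<Prod>(p, r)\<in>T. p)"
    "incongruent {f. \<forall>(p, r)\<in>T. int p dvd poly f r} V"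
proof -
  have "\<forall>t\<in>T. \<exists>e. [poly e (snd t) = 1] (mod int (fst t)) \<and> (\<forall>(p', r')\<in>T - {t}. int p' dvd poly e r')"
    using interpolation_unit[OF T] by fastforce
  then obtain e where e: "\<And>t. t \<in> T \<Longrightarrow> [poly (e t) (snd t) = 1] (mod int (fst t))"
    "\<And>t p' r'. t \<in> T \<Longrightarrow> (p', r') \<in> T - {t} \<Longrightarrow> int p' dvd poly (e t) r'"
    by (metis (no_types, lifting) case_prodD)
  define F where "F c = (\<Sum>t\<in>T. smult (c t) (e t))" for c
  define P where "P = PiE T (\<lambda>t. {0..<int (fst t)})"
  have val: "[poly (F c) r = c (p, r)] (mod int p)" if t: "(p, r) \<in> T" for c p r
  proof -
    have "poly (F c) r = (\<Sum>t\<in>T. c t * poly (e t) r)" by (simp add: F_def poly_sum)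
    also have "\<dots> = c (p, r) * poly (e (p, r)) r + (\<Sum>t\<in>T - {(p, r)}. c t * poly (e t) r)"
      by (rule sum.remove[OF T(1) t])
    also have "[\<dots> = c (p, r) * 1 + 0] (mod int p)"
    proof (rule cong_add)
      show "[c (p, r) * poly (e (p, r)) r = c (p, r) * 1] (mod int p)"
        using e(1)[OF t] by (intro cong_mult) auto
      have "int p dvd (\<Sum>t\<in>T - {(p, r)}. c t * poly (e t) r)"
      proof (rule dvd_sum)
        fix t' assume "t' \<in> T - {(p, r)}"
        then have "int p dvd poly (e t') r" using e(2)[of t' p r] t by auto
        then show "int p dvd c t' * poly (e t') r" by simp
      qed
      then show "[(\<Sum>t\<in>T - {(p, r)}. c t * poly (e t) r) = 0] (mod int p)" by (simp add: cong_0_iff)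
    qed
    finally show ?thesis by simp
  qed
  have inc: "c = c'" if c: "c \<in> P" "c' \<in> P" and d: "\<forall>(p, r)\<in>T. int p dvd poly (F c - F c') r" for c c'
  proof (rule PiE_ext[OF c[unfolded P_def]])
    fix t assume t: "t \<in> T"
    obtain p r where pr: "t = (p, r)" by force
    have "int p dvd poly (F c) r - poly (F c') r" using d t pr by auto
    then have "[poly (F c) r = poly (F c') r] (mod int p)" by (simp add: cong_iff_dvd_diff)
    then have "[c (p, r) = c' (p, r)] (mod int p)" using val t pr by (metis cong_sym cong_trans)
    moreover have "c t \<in> {0..<int p}" "c' t \<in> {0..<int p}" using c t pr by (auto simp: P_def PiE_iff)
    ultimately show "c t = c' t" using pr by (auto simp: cong_def)
  qed
  have inj: "inj_on F P"
  proof (rule inj_onI)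
    fix c c' assume "c \<in> P" "c' \<in> P" "F c = F c'"
    then show "c = c'" by (intro inc) auto
  qed
  show ?thesis
  proof
    show "finite (F ` P)" unfolding P_def using T(1) by (intro finite_imageI finite_PiE) auto
    show "card (F ` P) = (\<Prod>(p, r)\<in>T. p)"
      using inj T(1) by (simp add: card_image P_def card_PiE case_prod_beta)
    show "incongruent {f. \<forall>(p, r)\<in>T. int p dvd poly f r} (F ` P)"
      unfolding incongruent_def using inc by auto
  qed
qed

context number_order begin

lemma root_ideal:
  assumes "\<And>p r. (p, r) \<in> T \<Longrightarrow> int p dvd poly R r"
  shows "poly_ideal {f. \<forall>(p, r)\<in>T. int p dvd poly f r}" "R \<in> {f. \<forall>(p, r)\<in>T. int p dvd poly f r}"
  using assms unfolding poly_ideal_def by (auto intro!: dvd_add dvd_mult; blast)+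

text \<open>Counterpart of the fact that the norms of distinct prime ideals containing
  \<open>a\<close> multiply to at most the norm of \<open>a\<close>. The ideal of all polynomials
  with the roots in \<open>T\<close> meets the box at least in \<open>a\<close>, so its index is
  bounded by \<open>card_ideal_box_le\<close>.\<close>

lemma prod_common_roots_le:
  fixes T :: "(nat \<times> int) set"
  assumes T: "finite T" "\<And>p r. (p, r) \<in> T \<Longrightarrow> prime p \<and> r \<in> roots_mod R p \<and> int p dvd poly a r"
    and a: "a \<noteq> 0" "a \<in> ibox g Z" "Z \<ge> 1"
  shows "(\<Prod>(p, r)\<in>T. p) \<le> ((cov + 2) * Z) ^ g"
proof -
  let ?J = "{f. \<forall>(p, r)\<in>T. int p dvd poly f r}"
  have J: "poly_ideal ?J" "R \<in> ?J" using T(2) by (intro root_ideal; auto simp: roots_mod_def)+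
  have T': "\<And>p r. (p, r) \<in> T \<Longrightarrow> prime p \<and> r \<in> {0..<int p}" using T(2) by (auto simp: roots_mod_def)
  obtain V where V: "finite V" "card V = (\<Prod>(p, r)\<in>T. p)" "incongruent ?J V"
    using exists_incongruent_family[OF T(1) T'] by blast
  have aJ: "a \<in> ?J" using T(2) by auto
  have "card V * 1 \<le> card V * card (?J \<inter> ibox g Z)"
  proof (rule mult_left_mono)
    have "a \<in> ?J \<inter> ibox g Z" using aJ a by auto
    then have "?J \<inter> ibox g Z \<noteq> {}" by blast
    then show "1 \<le> card (?J \<inter> ibox g Z)" by (simp add: Suc_le_eq card_gt_0_iff)
  qed simp
  also have "\<dots> \<le> ((cov + 2) * Z) ^ g"
    by (rule card_ideal_box_le[OF J V(3,1) a(3) aJ a(1,2)])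
  finally show ?thesis using V by simp
qed

text \<open>By pigeonhole, more than \<open>p\<close> vectors yield a non-zero element of the ideal
  with coordinates at most \<open>A\<close>. Hence each of the \<open>p\<close> classes in the box
  can be moved into the ideal by a shift of size \<open>cov * A + 1\<close> only, and no class has
  more elements than the ideal in the enlarged box.\<close>

lemma card_root_ideal_ge:
  assumes p: "prime p" "r \<in> roots_mod R p" "p < (A + 1) ^ g"
  shows "X ^ g \<le> p * card ({f. int p dvd poly f r} \<inter> ibox g (X + (cov * A + 1)))"
proof -
  define J where "J = {f. int p dvd poly f r}"
  have J: "poly_ideal J" "R \<in> J" using p by (auto simp: J_def poly_ideal_def roots_mod_def)
  have p0: "int p > 0" using p by (simp add: prime_gt_0_nat)
  have val: "(\<lambda>f. poly f r mod int p) ` B \<subseteq> {0..<int p}" for B using p0 by auto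
  have "card ((\<lambda>f. poly f r mod int p) ` ibox g (A + 1)) \<le> p"
    using card_mono[OF _ val] by simp
  then have "\<not> inj_on (\<lambda>f. poly f r mod int p) (ibox g (A + 1))"
    using p(3) by (metis card_ibox card_image not_less)
  then obtain f h where fh: "f \<in> ibox g (A + 1)" "h \<in> ibox g (A + 1)" "poly f r mod int p = poly h r mod int p" "f \<noteq> h"
    unfolding inj_on_def by blast
  define a where "a = f - h"
  have a: "a \<in> J" "a \<noteq> 0" "degree a < g" "\<bar>coeff a i\<bar> \<le> int A" for i
  proof -
    show "a \<in> J" using fh(3) by (simp add: a_def J_def mod_eq_dvd_iff)
    show "a \<noteq> 0" using fh by (simp add: a_def)
    show "degree a < g" unfolding a_def using fh ibox_degree by (intro degree_diff_less) auto
    show "\<bar>coeff a i\<bar> \<le> int A" using fh(1,2) by (cases "i < g") (fastforce simp: a_def ibox_def)+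
  qed
  have "\<exists>v'\<in>ibox g (cov * A + 1). v - v' \<in> J" for v by (rule covering[OF J a])
  then obtain v' where v': "\<And>v. v' v \<in> ibox g (cov * A + 1)" "\<And>v. v - v' v \<in> J" by metis
  define cls where "cls c = {f\<in>ibox g X. poly f r mod int p = c}" for c
  have fin: "finite (cls c)" for c by (simp add: cls_def)
  have "card (cls c) \<le> card (J \<inter> ibox g (X + (cov * A + 1)))" for c
  proof (rule card_inj_on_le[of "\<lambda>f. f + v' [:- c:]"])
    show "(\<lambda>f. f + v' [:- c:]) ` cls c \<subseteq> J \<inter> ibox g (X + (cov * A + 1))"
    proof clarify
      fix f assume f: "f \<in> cls c"
      have "f + v' [:- c:] \<in> ibox g (X + (cov * A + 1))"
        by (rule ibox_add) (use f v' in \<open>auto simp: cls_def\<close>)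
      moreover have "f + v' [:- c:] \<in> J"
      proof -
        have "int p dvd - c - poly (v' [:- c:]) r" using v'(2)[of "[:- c:]"] by (simp add: J_def)
        moreover have "int p dvd poly f r - c" using f by (auto simp: cls_def simp flip: mod_eq_dvd_iff)
        ultimately have "int p dvd (poly f r - c) - (- c - poly (v' [:- c:]) r)" by (metis dvd_diff)
        then show ?thesis by (simp add: J_def)
      qed
      ultimately show "f + v' [:- c:] \<in> J \<inter> ibox g (X + (cov * A + 1))" by simp
    qed
  qed (auto simp: inj_on_def)
  then have "(\<Sum>c\<in>{0..<int p}. card (cls c)) \<le> (\<Sum>c\<in>{0..<int p}. card (J \<inter> ibox g (X + (cov * A + 1))))"
    by (rule sum_mono)
  also have "\<dots> = p * card (J \<inter> ibox g (X + (cov * A + 1)))" by simp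
  also have "(\<Sum>c\<in>{0..<int p}. card (cls c)) = card (\<Union>c\<in>{0..<int p}. cls c)"
    by (rule card_UN_disjoint[symmetric]) (auto simp: cls_def)
  also have "(\<Union>c\<in>{0..<int p}. cls c) = ibox g X" using p0 by (auto simp: cls_def)
  finally show ?thesis by (simp add: card_ibox J_def)
qed

text \<open>Double counting, with weight \<open>ln p\<close>, of the pairs of a root
  \<open>r\<close> modulo \<open>p\<close> and a non-zero \<open>a\<close> in a box of side
  \<open>Z\<close> with \<open>p\<close> dividing \<open>a(r)\<close>. Each root accounts for nearly
  \<open>Z ^ g / p\<close> elements, and each element carries total weight at most
  \<open>ln n + O(1)\<close>.\<close>

lemma sum_roots_mod_upper:
  assumes \<eta>: "\<eta> > 0"
  obtains C where "\<And>n. n \<ge> 1 \<Longrightarrow>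
    (\<Sum>p\<in>primes_le n. real (card (roots_mod R p)) * (ln (real p) / real p)) \<le> (1 + \<eta>) * ln (real n) + C"
proof -
  \<comment> \<open>Chosen so that two losses of relative size \<delta> leave exactly the factor
    \<open>1 / (1 + \<eta>)\<close>.\<close>
  define \<delta> where "\<delta> = \<eta> / (2 * (1 + \<eta>))"
  have \<delta>: "\<delta> > 0" "1 - 2 * \<delta> = 1 / (1 + \<eta>)" using \<eta> by (simp_all add: \<delta>_def field_simps)
  \<comment> \<open>\<open>L\<close> is the ratio of the side of the box to \<open>A\<close>. Its
    size keeps two relative losses below \<delta>: the one from the shift \<open>Y\<close> and the
    one from discarding the zero polynomial.\<close>
  define L where "L = nat \<lceil>(real g * (real cov + 1) + 1) / \<delta>\<rceil>"
  have "real L \<ge> (real g * (real cov + 1) + 1) / \<delta>" unfolding L_def by linarith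
  then have "real L * \<delta> \<ge> real g * (real cov + 1) + 1" using \<delta> by (simp add: field_simps)
  moreover have "real g * (real cov + 1) \<ge> 0" by simp
  ultimately have L: "real L * \<delta> \<ge> real g * (real cov + 1)" "real L * \<delta> \<ge> 1" by linarith+
  have L1: "L \<ge> 1" using L(2) by (cases L) auto
  define C where "C = (1 + \<eta>) * ln (real (((cov + 2) * L * 2) ^ g))"
  show ?thesis
  proof (rule that[of C])
    fix n :: nat assume n: "n \<ge> 1"
    \<comment> \<open>About \<open>n\<close> to the power \<open>1 / g\<close>, so that the
      pigeonhole argument covers every \<open>p \<le> n\<close> while \<open>A ^ g\<close> stays
      within the factor \<open>2 ^ g\<close> of \<open>n\<close>; the latter is what yields leading
      coefficient 1.\<close>
    define A where "A = (LEAST k. n \<le> k ^ g)"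
    have "n \<le> n ^ g" using gpos n by (simp add: self_le_power)
    then have A: "n \<le> A ^ g" unfolding A_def by (rule LeastI)
    have A1: "A \<ge> 1" using A n gpos by (cases A) (auto simp: zero_power)
    have A2: "A ^ g \<le> 2 ^ g * n"
    proof (cases "A = 1")
      case False
      have "\<not> n \<le> (A - 1) ^ g" using A1 not_less_Least[of "A - 1" "\<lambda>k. n \<le> k ^ g"] by (auto simp flip: A_def)
      have "A ^ g \<le> (2 * (A - 1)) ^ g" by (rule power_mono) (use A1 False in auto)
      also have "\<dots> = 2 ^ g * (A - 1) ^ g" by (simp add: power_mult_distrib)
      also have "\<dots> \<le> 2 ^ g * n" using \<open>\<not> n \<le> (A - 1) ^ g\<close> by simp
      finally show ?thesis .
    qed (use n in simp)
    define Z where "Z = L * A"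
    define Y where "Y = cov * A + 1"
    have Z1: "Z \<ge> 1" using L1 A1 by (simp add: Z_def)
    have YZ: "real g * real Y \<le> \<delta> * real Z"
    proof -
      have "real Y \<le> (real cov + 1) * real A" using A1 by (simp add: Y_def algebra_simps)
      then have "real g * real Y \<le> real g * ((real cov + 1) * real A)" by (rule mult_left_mono) simp
      also have "\<dots> = (real g * (real cov + 1)) * real A" by simp
      also have "\<dots> \<le> (real L * \<delta>) * real A" by (rule mult_right_mono[OF L(1)]) simp
      finally show ?thesis by (simp add: Z_def algebra_simps)
    qed
    have "1 / (1 + \<eta>) > 0" using \<eta> by simp
    then have \<delta>1: "\<delta> < 1" using \<delta> by linarith
    have YZ': "Y \<le> Z"
    proof -
      have "real Y \<le> real g * real Y" using gpos by (cases g) (auto simp: algebra_simps)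
      also have "\<dots> \<le> \<delta> * real Z" by (rule YZ)
      also have "\<dots> \<le> 1 * real Z" using \<delta>1 by (intro mult_right_mono) auto
      finally show ?thesis by simp
    qed
    have Zg: "real n \<le> \<delta> * real Z ^ g"
    proof -
      have "real n \<le> real A ^ g" using A by (metis of_nat_le_iff semiring_1_class.of_nat_power)
      also have "\<dots> \<le> (\<delta> * real L) * real A ^ g" using L(2) by (simp add: mult.commute mult_le_cancel_right1)
      also have "\<dots> \<le> (\<delta> * real L ^ g) * real A ^ g"
        using L1 gpos \<delta> by (intro mult_right_mono mult_left_mono) (auto simp: self_le_power)
      finally show ?thesis by (simp add: Z_def power_mult_distrib)
    qed
    have lower: "(1 - 2 * \<delta>) * real Z ^ g / real p \<le> real (card ({f. int p dvd poly f r} \<inter> ibox g Z - {0}))"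
      if p: "p \<in> primes_le n" "r \<in> roots_mod R p" for p r
    proof -
      have pr: "prime p" "p \<le> n" using p by (auto dest: primes_le_D)
      have p0: "real p > 0" using pr by (simp add: prime_gt_0_nat)
      let ?N = "card ({f. int p dvd poly f r} \<inter> ibox g Z)"
      have "p < (A + 1) ^ g"
        using pr(2) A gpos power_strict_mono[of A "A + 1" g] by simp
      from card_root_ideal_ge[OF pr(1) p(2) this, of "Z - Y"]
      have "(Z - Y) ^ g \<le> p * ?N" using YZ' by (simp add: Y_def)
      then have "real (Z - Y) ^ g \<le> real p * real ?N" by (metis of_nat_le_iff of_nat_mult semiring_1_class.of_nat_power)
      moreover have "real (Z - Y) ^ g = real Z ^ g * (1 + (- (real Y / real Z))) ^ g"
        using YZ' Z1 by (simp add: of_nat_diff field_simps flip: power_mult_distrib)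
      moreover have "1 + real g * (- (real Y / real Z)) \<le> (1 + (- (real Y / real Z))) ^ g"
        by (rule Bernoulli_inequality) (use YZ' Z1 in simp)
      moreover have "1 - \<delta> \<le> 1 + real g * (- (real Y / real Z))"
        using YZ Z1 by (simp add: field_simps)
      moreover from calculation(3,4)
      have "real Z ^ g * (1 - \<delta>) \<le> real Z ^ g * (1 + (- (real Y / real Z))) ^ g"
        by (intro mult_left_mono) auto
      ultimately have "real Z ^ g * (1 - \<delta>) \<le> real p * real ?N" by linarith
      moreover have "real p \<le> \<delta> * real Z ^ g" using Zg pr(2) by linarith
      ultimately have "(1 - 2 * \<delta>) * real Z ^ g \<le> real p * (real ?N - 1)"
        by (simp add: algebra_simps)
      moreover have cardN: "real (card ({f. int p dvd poly f r} \<inter> ibox g Z - {0})) \<ge> real ?N - 1"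
      proof -
        have "?N - 1 \<le> card ({f. int p dvd poly f r} \<inter> ibox g Z - {0})" using diff_card_le_card_Diff[of "{0}" "{f. int p dvd poly f r} \<inter> ibox g Z"] by simp
        then show ?thesis by linarith
      qed
      ultimately have "(1 - 2 * \<delta>) * real Z ^ g \<le> real p * real (card ({f. int p dvd poly f r} \<inter> ibox g Z - {0}))"
        using mult_left_mono[OF cardN, of "real p"] p0 by linarith
      then show ?thesis using p0 by (simp add: pos_divide_le_eq mult.commute)
    qed
    define TT where "TT = (SIGMA p:primes_le n. roots_mod R p)"
    have finTT: "finite TT" unfolding TT_def by auto
    have "(1 - 2 * \<delta>) * real Z ^ g * (\<Sum>p\<in>primes_le n. real (card (roots_mod R p)) * (ln (real p) / real p))
        = (\<Sum>p\<in>primes_le n. \<Sum>r\<in>roots_mod R p. ln (real p) * ((1 - 2 * \<delta>) * real Z ^ g / real p))"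
      by (simp add: sum_distrib_left mult_ac)
    also have "\<dots> \<le> (\<Sum>p\<in>primes_le n. \<Sum>r\<in>roots_mod R p. ln (real p) * real (card ({f. int p dvd poly f r} \<inter> ibox g Z - {0})))"
      by (intro sum_mono mult_left_mono lower) (auto dest: primes_le_D)
    also have "\<dots> = (\<Sum>(p, r)\<in>TT. \<Sum>a\<in>ibox g Z - {0}. if int p dvd poly a r then ln (real p) else 0)"
    proof -
      have "ln (real p) * real (card ({f. int p dvd poly f r} \<inter> ibox g Z - {0}))
        = (\<Sum>a\<in>ibox g Z - {0}. if int p dvd poly a r then ln (real p) else 0)" for p r
      proof -
        have "{f. int p dvd poly f r} \<inter> ibox g Z - {0} = (ibox g Z - {0}) \<inter> {f. int p dvd poly f r}" by auto
        then show ?thesis by (simp add: sum.If_cases mult.commute)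
      qed
      then show ?thesis unfolding TT_def by (subst sum.Sigma) auto
    qed
    also have "\<dots> = (\<Sum>a\<in>ibox g Z - {0}. \<Sum>(p, r)\<in>TT. if int p dvd poly a r then ln (real p) else 0)"
      by (simp add: case_prod_beta) (rule sum.swap)
    also have "\<dots> \<le> (\<Sum>a\<in>ibox g Z - {0}. ln (real (((cov + 2) * Z) ^ g)))"
    proof (rule sum_mono)
      fix a assume a: "a \<in> ibox g Z - {0}"
      define T where "T = {(p, r)\<in>TT. int p dvd poly a r}"
      have T_alt: "T = {t\<in>TT. int (fst t) dvd poly a (snd t)}" by (auto simp: T_def)
      have finT: "finite T" unfolding T_def by (rule finite_subset[OF _ finTT]) auto
      have T: "prime p \<and> r \<in> roots_mod R p \<and> int p dvd poly a r" if "(p, r) \<in> T" for p r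
        using that by (auto simp: T_def TT_def dest: primes_le_D)
      have "(\<Sum>(p, r)\<in>TT. if int p dvd poly a r then ln (real p) else 0) = (\<Sum>t\<in>T. ln (real (fst t)))"
        unfolding T_alt sum.inter_filter[OF finTT] by (simp add: case_prod_beta)
      also have "\<dots> = ln (\<Prod>t\<in>T. real (fst t))"
        by (rule ln_prod[symmetric, OF finT]) (use T prime_gt_0_nat in force)
      also have "(\<Prod>t\<in>T. real (fst t)) = real (\<Prod>(p, r)\<in>T. p)" by (simp add: case_prod_beta)
      also have "ln \<dots> \<le> ln (real (((cov + 2) * Z) ^ g))"
      proof -
        have le: "(\<Prod>(p, r)\<in>T. p) \<le> ((cov + 2) * Z) ^ g"
          by (rule prod_common_roots_le[OF finT T]) (use a Z1 in auto)
        have "0 < (\<Prod>(p, r)\<in>T. p)" by (rule prod_pos) (use T prime_gt_0_nat in auto)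
        then show ?thesis using le by (rule ln_of_nat_mono)
      qed
      finally show "(\<Sum>(p, r)\<in>TT. if int p dvd poly a r then ln (real p) else 0) \<le> ln (real (((cov + 2) * Z) ^ g))" .
    qed
    also have "\<dots> = real (card (ibox g Z - {0})) * ln (real (((cov + 2) * Z) ^ g))" by simp
    also have "\<dots> \<le> real Z ^ g * (ln (real n) + ln (real (((cov + 2) * L * 2) ^ g)))"
    proof (rule mult_mono)
      have "card (ibox g Z - {0}) \<le> card (ibox g Z)" by (rule card_mono) auto
      then show "real (card (ibox g Z - {0})) \<le> real Z ^ g" by (simp add: card_ibox flip: semiring_1_class.of_nat_power)
      have "((cov + 2) * Z) ^ g \<le> ((cov + 2) * L * 2) ^ g * n"
        using mult_left_mono[OF A2, of "((cov + 2) * L) ^ g"] by (simp only: Z_def power_mult_distrib mult_ac)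
      moreover have "0 < ((cov + 2) * Z) ^ g" using Z1 by simp
      ultimately have "ln (real (((cov + 2) * Z) ^ g)) \<le> ln (real (((cov + 2) * L * 2) ^ g * n))"
        by (intro ln_of_nat_mono)
      also have "\<dots> = ln (real n) + ln (real (((cov + 2) * L * 2) ^ g))"
        using n L1 by (subst add.commute, intro ln_of_nat_mult) auto
      finally show "ln (real (((cov + 2) * Z) ^ g)) \<le> ln (real n) + ln (real (((cov + 2) * L * 2) ^ g))" .
      have "1 \<le> ((cov + 2) * Z) ^ g" using Z1 by simp
      then show "0 \<le> ln (real (((cov + 2) * Z) ^ g))" by (metis ln_ge_zero of_nat_1 of_nat_le_iff)
    qed auto
    finally have "real Z ^ g * ((1 - 2 * \<delta>) * (\<Sum>p\<in>primes_le n. real (card (roots_mod R p)) * (ln (real p) / real p)))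
      \<le> real Z ^ g * (ln (real n) + ln (real (((cov + 2) * L * 2) ^ g)))" by (simp only: mult_ac)
    then have "(1 - 2 * \<delta>) * (\<Sum>p\<in>primes_le n. real (card (roots_mod R p)) * (ln (real p) / real p))
      \<le> ln (real n) + ln (real (((cov + 2) * L * 2) ^ g))"
      using Z1 by (subst (asm) mult_le_cancel_left_pos) auto
    then have "(1 + \<eta>) * ((1 - 2 * \<delta>) * (\<Sum>p\<in>primes_le n. real (card (roots_mod R p)) * (ln (real p) / real p)))
      \<le> (1 + \<eta>) * (ln (real n) + ln (real (((cov + 2) * L * 2) ^ g)))"
      using \<eta> by (intro mult_left_mono) auto
    then show "(\<Sum>p\<in>primes_le n. real (card (roots_mod R p)) * (ln (real p) / real p)) \<le> (1 + \<eta>) * ln (real n) + C"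
      using \<eta> unfolding \<delta>(2) C_def by (simp add: distrib_left)
  qed
qed

end

section \<open>Norms\<close>

lemma prime_power_dvd_cancel:
  fixes p a b :: int
  assumes p: "prime p" and a: "\<not> p ^ Suc k dvd a" and ab: "p ^ (k + m) dvd a * b"
  shows "p ^ m dvd b"
proof (cases "b = 0")
  case False
  have a0: "a \<noteq> 0" using a by auto
  have nu: "\<not> is_unit p" using prime_gt_1_int[OF p] by auto
  have "\<not> Suc k \<le> multiplicity p a" using a multiplicity_dvd'[of "Suc k" p a] by blast
  moreover have "k + m \<le> multiplicity p (a * b)" using ab a0 False nu by (simp add: power_dvd_iff_le_multiplicity)
  moreover have "multiplicity p (a * b) = multiplicity p a + multiplicity p b"
    using a0 False by (intro prime_elem_multiplicity_mult_distrib prime_imp_prime_elem p)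
  ultimately have "m \<le> multiplicity p b" by linarith
  then show ?thesis using False nu by (simp add: power_dvd_iff_le_multiplicity)
qed simp

lemma synthetic_div_monic:
  fixes f :: "int poly"
  assumes "lead_coeff f = 1" "degree f = Suc d"
  shows "lead_coeff (synthetic_div f c) = 1" "degree (synthetic_div f c) = d"
    "poly f x - poly f c = (x - c) * poly (synthetic_div f c) x"
proof -
  have eq: "f = [:poly f c:] + [:- c, 1:] * synthetic_div f c"
    using synthetic_div_correct'[of c f] by (simp add: add.commute)
  show dg: "degree (synthetic_div f c) = d" using assms by (simp add: degree_synthetic_div)
  have "poly f x = poly ([:poly f c:] + [:- c, 1:] * synthetic_div f c) x" using eq by simp
  then show "poly f x - poly f c = (x - c) * poly (synthetic_div f c) x" by (simp add: algebra_simps)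
  have "coeff f (Suc d) = coeff ([:poly f c:] + [:- c, 1:] * synthetic_div f c) (Suc d)" using eq by simp
  also have "\<dots> = coeff (synthetic_div f c) d" using dg by (simp add: coeff_eq_0)
  finally show "lead_coeff (synthetic_div f c) = 1" using assms dg by simp
qed

text \<open>Passing to the divided difference \<open>(f(x) - f(c)) / (x - c)\<close> lowers the degree and costs at most
  \<open>k\<close> factors \<open>p\<close>.\<close>

lemma card_roots_prime_power:
  fixes f :: "int poly"
  assumes "prime (p::int)" "lead_coeff f = 1" "degree f = d" "finite S"
    "\<And>x. x \<in> S \<Longrightarrow> p ^ (d * k + 1) dvd poly f x"
    "\<And>x y. x \<in> S \<Longrightarrow> y \<in> S \<Longrightarrow> x \<noteq> y \<Longrightarrow> \<not> p ^ Suc k dvd x - y"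
  shows "card S \<le> d"
  using assms(2-)
proof (induction d arbitrary: f S)
  case 0
  then have "f = 1" by (metis degree_0_id one_pCons lead_coeff_pCons(2) degree_eq_zeroE)
  then have "S = {}" using 0(4) prime_gt_1_int[OF assms(1)] by auto
  then show ?case by simp
next
  case (Suc d)
  show ?case
  proof (cases "S = {}")
    case False
    then obtain x0 where x0: "x0 \<in> S" by blast
    note sd = synthetic_div_monic[OF Suc.prems(1,2), where c = x0]
    have "card (S - {x0}) \<le> d"
    proof (rule Suc.IH[OF sd(1,2)])
      fix x assume x: "x \<in> S - {x0}"
      have "p ^ (Suc d * k + 1) dvd poly f x - poly f x0" using Suc.prems(4) x x0 by (intro dvd_diff) auto
      then have "p ^ (k + (d * k + 1)) dvd (x - x0) * poly (synthetic_div f x0) x"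
        unfolding sd(3) by simp
      moreover have "\<not> p ^ Suc k dvd x - x0" using Suc.prems(5) x x0 by blast
      ultimately show "p ^ (d * k + 1) dvd poly (synthetic_div f x0) x"
        using prime_power_dvd_cancel[OF assms(1)] by blast
    qed (use Suc.prems in auto)
    then show ?thesis using x0 Suc.prems(3) by (simp add: card_Diff_singleton)
  qed simp
qed

text \<open>The descent by divided differences for the absolute value in place of the
  \<open>p\<close>-adic one: each step replaces the bound \<open>Y\<close> by
  \<open>2 * Y / E\<close>. In degree 0 the polynomial is 1 while \<open>Y < 1\<close>, so no point
  is left.\<close>

lemma card_small_values:
  fixes f :: "int poly"
  assumes "lead_coeff f = 1" "degree f = d" "finite S" "E > 0"
    "\<And>x. x \<in> S \<Longrightarrow> \<bar>real_of_int (poly f x)\<bar> \<le> Y"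
    "\<And>x y. x \<in> S \<Longrightarrow> y \<in> S \<Longrightarrow> x \<noteq> y \<Longrightarrow> real_of_int \<bar>x - y\<bar> \<ge> E"
    "2 ^ d * Y < E ^ d"
  shows "card S \<le> d"
  using assms
proof (induction d arbitrary: f S Y)
  case 0
  then have "f = 1" by (metis degree_0_id one_pCons lead_coeff_pCons(2) degree_eq_zeroE)
  then have "S = {}" using 0(5,7) by force
  then show ?case by simp
next
  case (Suc d)
  show ?case
  proof (cases "S = {}")
    case False
    then obtain x0 where x0: "x0 \<in> S" by blast
    note sd = synthetic_div_monic[OF Suc.prems(1,2), where c = x0]
    have "card (S - {x0}) \<le> d"
    proof (rule Suc.IH[OF sd(1,2) _ Suc.prems(4), where Y = "2 * Y / E"])
      fix x assume x: "x \<in> S - {x0}"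
      have "E * \<bar>real_of_int (poly (synthetic_div f x0) x)\<bar> \<le> real_of_int \<bar>x - x0\<bar> * \<bar>real_of_int (poly (synthetic_div f x0) x)\<bar>"
        using Suc.prems(6)[of x x0] x x0 by (intro mult_right_mono) auto
      also have "\<dots> = \<bar>real_of_int (poly f x - poly f x0)\<bar>"
        unfolding sd(3) by (simp only: abs_mult of_int_abs of_int_mult)
      also have "\<dots> \<le> 2 * Y"
        using Suc.prems(5)[of x] Suc.prems(5)[of x0] x x0 by auto
      finally show "\<bar>real_of_int (poly (synthetic_div f x0) x)\<bar> \<le> 2 * Y / E"
        using Suc.prems(4) by (simp add: pos_le_divide_eq mult.commute)
    next
      show "2 ^ d * (2 * Y / E) < E ^ d" using Suc.prems(4,7) by (simp add: pos_divide_less_eq mult_ac)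
    qed (use Suc.prems in auto)
    then show ?thesis using x0 Suc.prems(3) by (simp add: card_Diff_singleton)
  qed simp
qed

lemma obtain_representatives:
  obtains S where "S \<subseteq> A" "inj_on h S" "h ` S = h ` A"
  using subset_image_inj[of "h ` A" h A] by auto

text \<open>Solutions in distinct classes modulo \<open>p ^ Suc k\<close> satisfy the hypotheses of
  \<open>card_roots_prime_power\<close>, so at most \<open>d\<close> classes occur; each meets the
  interval in at most \<open>X div p ^ Suc k + 1\<close> points.\<close>

lemma count_prime_power_dvd:
  fixes f :: "int poly"
  assumes p: "prime (p::nat)" and f: "lead_coeff f = 1" "degree f = d"
  shows "card {x\<in>{0..<int X}. int p ^ (d * k + 1) dvd poly f x} \<le> d * (X div p ^ Suc k + 1)"
proof -
  define A where "A = {x\<in>{0..<int X}. int p ^ (d * k + 1) dvd poly f x}"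
  define q where "q = int p ^ Suc k"
  have q0: "q > 0" unfolding q_def using p by (simp add: prime_gt_0_nat)
  have finA: "finite A" unfolding A_def by (rule finite_subset[of _ "{0..<int X}"]) auto
  obtain S where S: "S \<subseteq> A" "inj_on (\<lambda>x. x mod q) S" "(\<lambda>x. x mod q) ` S = (\<lambda>x. x mod q) ` A"
    using obtain_representatives by blast
  have "card S \<le> d"
  proof (rule card_roots_prime_power[of "int p", OF _ f])
    fix x y assume xy: "x \<in> S" "y \<in> S" "x \<noteq> y"
    then have "x mod q \<noteq> y mod q" using S(2) by (auto simp: inj_on_def)
    then show "\<not> int p ^ Suc k dvd x - y" unfolding q_def[symmetric] by (metis mod_eq_dvd_iff)
  qed (use p S(1) finA finite_subset in \<open>auto simp: A_def\<close>)
  then have I: "card ((\<lambda>x. x mod q) ` A) \<le> d" using S(2,3) by (metis card_image)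
  have "card A \<le> card ((\<lambda>x. x mod q) ` A \<times> {0..int X div q})"
  proof (rule card_inj_on_le[of "\<lambda>x. (x mod q, x div q)"])
    show "inj_on (\<lambda>x. (x mod q, x div q)) A"
      by (rule inj_onI) (metis div_mult_mod_eq prod.inject)
    show "(\<lambda>x. (x mod q, x div q)) ` A \<subseteq> (\<lambda>x. x mod q) ` A \<times> {0..int X div q}"
      using q0 by (auto simp: A_def pos_imp_zdiv_nonneg_iff less_imp_le intro!: zdiv_mono1)
  qed (use finA in simp)
  also have "\<dots> = card ((\<lambda>x. x mod q) ` A) * (X div p ^ Suc k + 1)"
    by (simp add: card_cartesian_product q_def nat_add_distrib flip: semiring_1_class.of_nat_power of_nat_mult of_nat_div)
  also have "\<dots> \<le> d * (X div p ^ Suc k + 1)" using I by (rule mult_right_mono) simp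
  finally show ?thesis unfolding A_def .
qed

text \<open>The line is cut into blocks of length \<open>E\<close>. Points in distinct blocks of the
  same parity are at least \<open>E\<close> apart, so at most \<open>d\<close> blocks of each parity
  contain a solution.\<close>

lemma count_small_values:
  fixes f :: "int poly"
  assumes f: "lead_coeff f = 1" "degree f = d" and E: "E > 0" and Y: "2 ^ d * Y < real E ^ d"
  shows "card {x\<in>{0..<int X}. \<bar>real_of_int (poly f x)\<bar> \<le> Y} \<le> 2 * d * E"
proof -
  define A where "A = {x\<in>{0..<int X}. \<bar>real_of_int (poly f x)\<bar> \<le> Y}"
  have finA: "finite A" unfolding A_def by (rule finite_subset[of _ "{0..<int X}"]) auto
  define q where "q = int E"
  have q0: "q > 0" unfolding q_def using E by simp
  have part: "card ((\<lambda>x. x div q) ` {x\<in>A. x div q mod 2 = c}) \<le> d" for c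
  proof -
    obtain S where S: "S \<subseteq> {x\<in>A. x div q mod 2 = c}" "inj_on (\<lambda>x. x div q) S"
       "(\<lambda>x. x div q) ` S = (\<lambda>x. x div q) ` {x\<in>A. x div q mod 2 = c}"
      using obtain_representatives by blast
    have "card S \<le> d"
    proof (rule card_small_values[OF f])
      fix x y assume xy: "x \<in> S" "y \<in> S" "x \<noteq> y"
      then have ne: "x div q \<noteq> y div q" using S(2) by (auto simp: inj_on_def)
      have par: "x div q mod 2 = y div q mod 2" using xy S(1) by auto
      have *: "q \<le> \<bar>x - y\<bar>" if lt: "x div q < y div q" and par: "x div q mod 2 = y div q mod 2" for x y
      proof -
        have "u + 2 \<le> v" if "u < v" "u mod 2 = v mod 2" for u v :: int using that by presburger
        then have "x div q + 2 \<le> y div q" using lt par by blast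
        then have "q * (x div q + 2) \<le> q * (y div q)" using q0 by (intro mult_left_mono) auto
        then have "q * (x div q) + 2 * q \<le> q * (y div q)" by (simp add: distrib_left)
        moreover have "x mod q = x - q * (x div q)" "y mod q = y - q * (y div q)"
          by (simp_all add: minus_mult_div_eq_mod)
        moreover have "x mod q < q" "0 \<le> y mod q" using q0 by simp_all
        ultimately show ?thesis by linarith
      qed
      have "q \<le> \<bar>x - y\<bar>"
      proof (cases "x div q < y div q")
        case True then show ?thesis using * par by blast
      next
        case False
        then have "q \<le> \<bar>y - x\<bar>" using *[of y x] par ne by simp
        then show ?thesis by (simp add: abs_minus_commute)
      qed
      then show "real E \<le> real_of_int \<bar>x - y\<bar>" unfolding q_def by linarith
    next
      show "finite S" using S(1) finA by (auto intro: finite_subset)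
    qed (use S(1) E Y in \<open>auto simp: A_def\<close>)
    then show ?thesis using S(2,3) by (metis card_image)
  qed
  have "u mod 2 = 0 \<or> u mod 2 = 1" for u :: int by presburger
  then have "(\<lambda>x. x div q) ` A \<subseteq> (\<lambda>x. x div q) ` {x\<in>A. x div q mod 2 = 0} \<union> (\<lambda>x. x div q) ` {x\<in>A. x div q mod 2 = 1}"
    by blast
  then have "card ((\<lambda>x. x div q) ` A) \<le> card ((\<lambda>x. x div q) ` {x\<in>A. x div q mod 2 = 0} \<union> (\<lambda>x. x div q) ` {x\<in>A. x div q mod 2 = 1})"
    by (rule card_mono[rotated]) (use finA in auto)
  also have "\<dots> \<le> d + d" by (rule order.trans[OF card_Un_le add_mono[OF part part]])
  finally have I: "card ((\<lambda>x. x div q) ` A) \<le> 2 * d" by simp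
  have "card A \<le> card ((\<lambda>x. x div q) ` A \<times> {0..<q})"
  proof (rule card_inj_on_le[of "\<lambda>x. (x div q, x mod q)"])
    show "inj_on (\<lambda>x. (x div q, x mod q)) A"
      by (rule inj_onI) (metis div_mult_mod_eq prod.inject)
    show "(\<lambda>x. (x div q, x mod q)) ` A \<subseteq> (\<lambda>x. x div q) ` A \<times> {0..<q}" using q0 by auto
  qed (use finA in simp)
  also have "\<dots> = card ((\<lambda>x. x div q) ` A) * E" by (simp add: card_cartesian_product q_def)
  also have "\<dots> \<le> 2 * d * E" using I by (rule mult_right_mono) simp
  finally show ?thesis unfolding A_def .
qed

section \<open>Determinants of integer matrices\<close>

lemma det_cong_mod:
  fixes A B :: "int mat"
  assumes "A \<in> carrier_mat n n" "B \<in> carrier_mat n n"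
    "\<And>i j. i < n \<Longrightarrow> j < n \<Longrightarrow> [A $$ (i, j) = B $$ (i, j)] (mod m)"
  shows "[det A = det B] (mod m)"
  unfolding det_def'[OF assms(1)] det_def'[OF assms(2)]
proof (rule cong_sum)
  fix \<pi> assume "\<pi> \<in> {\<pi>. \<pi> permutes {0..<n}}"
  then have "\<pi> i < n" if "i < n" for i using that permutes_in_image[of \<pi> "{0..<n}" i] by auto
  then show "[signof \<pi> * (\<Prod>i = 0..<n. A $$ (i, \<pi> i)) = signof \<pi> * (\<Prod>i = 0..<n. B $$ (i, \<pi> i))] (mod m)"
    using assms(3) by (intro cong_mult cong_prod cong_refl) auto
qed

lemma det_abs_le:
  fixes A :: "int mat"
  assumes "A \<in> carrier_mat n n" "\<And>i j. i < n \<Longrightarrow> j < n \<Longrightarrow> \<bar>A $$ (i, j)\<bar> \<le> B"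
  shows "\<bar>det A\<bar> \<le> fact n * B ^ n"
proof -
  have "\<bar>det A\<bar> \<le> (\<Sum>\<pi>\<in>{\<pi>. \<pi> permutes {0..<n}}. \<bar>signof \<pi> * (\<Prod>i = 0..<n. A $$ (i, \<pi> i))\<bar>)"
    unfolding det_def'[OF assms(1)] by (rule sum_abs)
  also have "\<dots> \<le> (\<Sum>\<pi>\<in>{\<pi>. \<pi> permutes {0..<n}}. B ^ n)"
  proof (rule sum_mono)
    fix \<pi> assume "\<pi> \<in> {\<pi>. \<pi> permutes {0..<n}}"
    then have lt: "\<pi> i < n" if "i < n" for i using that permutes_in_image[of \<pi> "{0..<n}" i] by auto
    have "\<bar>signof \<pi> * (\<Prod>i = 0..<n. A $$ (i, \<pi> i))\<bar> = (\<Prod>i = 0..<n. \<bar>A $$ (i, \<pi> i)\<bar>)"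
      by (auto simp: abs_mult abs_prod sign_def)
    also have "\<dots> \<le> (\<Prod>i = 0..<n. B)" by (rule prod_mono) (use assms(2) lt in auto)
    finally show "\<bar>signof \<pi> * (\<Prod>i = 0..<n. A $$ (i, \<pi> i))\<bar> \<le> B ^ n" by simp
  qed
  also have "\<dots> = int (card {\<pi>. \<pi> permutes {0..<n}}) * B ^ n" by simp
  also have "card {\<pi>. \<pi> permutes {0..<n}} = fact n" by (rule card_permutations) auto
  finally show ?thesis by simp
qed

context number_order begin

text \<open>Row \<open>i\<close> holds the coordinates of \<gamma>\<open>^i\<close> times the
  element given by \<open>f\<close>. The determinant is therefore the norm from the field of
  \<gamma> to the rationals.\<close>

definition mult_matrix :: "int poly \<Rightarrow> int mat" where
  "mult_matrix f = mat g g (\<lambda>(i, j). coeff (red (monom 1 i * f)) j)"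

definition norm_form :: "int poly \<Rightarrow> int" where "norm_form f = det (mult_matrix f)"

lemma mult_matrix_carrier [simp]: "mult_matrix f \<in> carrier_mat g g" by (simp add: mult_matrix_def)

lemma mult_matrix_index: "i < g \<Longrightarrow> j < g \<Longrightarrow> mult_matrix f $$ (i, j) = coeff (red (monom 1 i * f)) j"
  by (simp add: mult_matrix_def)

lemma mult_matrix_cong: "R dvd f - h \<Longrightarrow> mult_matrix f = mult_matrix h"
proof -
  assume d: "R dvd f - h"
  have "red (monom 1 i * f) = red (monom 1 i * h)" for i
    by (rule red_cong) (use dvd_mult[OF d, of "monom 1 i"] in \<open>simp add: right_diff_distrib\<close>)
  then show ?thesis by (simp add: mult_matrix_def)
qed

lemma mult_matrix_mult: "mult_matrix f * mult_matrix h = mult_matrix (f * h)"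
proof (rule eq_matI)
  fix i j assume "i < dim_row (mult_matrix (f * h))" "j < dim_col (mult_matrix (f * h))"
  then have ij: "i < g" "j < g" by (simp_all add: mult_matrix_def)
  define u where "u = red (monom 1 i * f)"
  have "u = (\<Sum>k<g. smult (coeff u k) (monom 1 k))"
    by (intro poly_eqI) (auto simp: coeff_sum coeff_red_ge u_def if_distrib cong: if_cong)
  then have "u * h = (\<Sum>k<g. smult (coeff u k) (monom 1 k * h))"
    by (metis (no_types, lifting) mult_smult_left sum.cong sum_distrib_right)
  then have "red (u * h) = (\<Sum>k<g. smult (coeff u k) (red (monom 1 k * h)))"
    by (simp add: red_sum red_smult)
  moreover have "red (u * h) = red (monom 1 i * (f * h))" by (simp add: u_def red_mult_red mult.assoc)
  ultimately have "coeff (red (monom 1 i * (f * h))) j = (\<Sum>k<g. coeff u k * coeff (red (monom 1 k * h)) j)"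
    by (simp add: coeff_sum)
  then show "(mult_matrix f * mult_matrix h) $$ (i, j) = mult_matrix (f * h) $$ (i, j)"
    using ij by (simp add: mult_matrix_def scalar_prod_def u_def lessThan_atLeast0)
qed (simp_all add: mult_matrix_def)

lemma red_monom: "i < g \<Longrightarrow> red (monom c i) = monom c i"
  by (rule red_small) (metis degree_monom_le le_less_trans)

text \<open>Changing the constant coefficient adds a scalar matrix. The norm is thus a
  characteristic polynomial in \<open>x\<close>, monic of degree \<open>g\<close>, to which the
  counts of values of monic polynomials apply.\<close>

lemma norm_form_pCons: "norm_form (pCons x b) = poly (char_poly (- mult_matrix (pCons 0 b))) x"
proof -
  have "pCons x b = [:x:] + pCons 0 b" by simp
  then have "coeff (red (monom 1 i * pCons x b)) j = x * (if i = j then 1 else 0) + coeff (red (monom 1 i * pCons 0 b)) j"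
    if "i < g" for i j
    using that red_monom[of i x] by (simp add: distrib_left red_add smult_monom)
  then have "poly (char_poly (- mult_matrix (pCons 0 b))) x = det (mult_matrix (pCons x b))"
    unfolding char_poly_def by (intro poly_det_cong[of _ g]) (auto simp: char_poly_matrix_def mult_matrix_def)
  then show ?thesis by (simp add: norm_form_def)
qed

lemma norm_form_poly_monic:
  "lead_coeff (char_poly (- mult_matrix b)) = 1" "degree (char_poly (- mult_matrix b)) = g"
  using degree_monic_char_poly[of "- mult_matrix b" g] by auto

lemma norm_form_abs_le:
  assumes "a \<in> ibox g X"
  shows "\<bar>norm_form a\<bar> \<le> fact g * (int \<kappa> * int X) ^ g"
  unfolding norm_form_def
proof (rule det_abs_le[OF mult_matrix_carrier])
  fix i j assume ij: "i < g" "j < g"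
  have "\<bar>coeff (red (monom 1 i * a)) j\<bar> \<le> int \<kappa> * int X"
  proof (rule coeff_red_bound)
    have "degree (monom 1 i * a) \<le> degree (monom (1::int) i) + degree a" by (rule degree_mult_le)
    then show "degree (monom 1 i * a) < 2 * g"
      using ij ibox_degree[OF assms] by (simp add: degree_monom_eq)
    show "\<bar>coeff (monom 1 i * a) l\<bar> \<le> int X" for l
      using ibox_abs_le[OF assms] by (simp add: coeff_monom_mult)
  qed
  then show "\<bar>mult_matrix a $$ (i, j)\<bar> \<le> int \<kappa> * int X" using ij by (simp add: mult_matrix_index)
qed

text \<open>Here \<open>u\<close> inverts \<open>a\<close> modulo \<open>m\<close>; the two norms
  multiply to a determinant congruent to 1.\<close>

lemma not_dvd_norm_form:
  assumes "R dvd u * a - (1 + smult m w)" "m > 1"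
  shows "\<not> m dvd norm_form a"
proof -
  have "det (mult_matrix u) * norm_form a = det (mult_matrix (1 + smult m w))"
    unfolding norm_form_def using mult_matrix_cong[OF assms(1)] by (metis mult_matrix_carrier mult_matrix_mult det_mult)
  moreover have "[det (mult_matrix (1 + smult m w)) = det (1\<^sub>m g :: int mat)] (mod m)"
  proof (rule det_cong_mod[of _ g])
    fix i j assume ij: "i < g" "j < g"
    have "coeff (red (monom 1 i * (1 + smult m w))) j = (if i = j then 1 else 0) + m * coeff (red (monom 1 i * w)) j"
      using ij red_monom[of i 1] by (simp add: distrib_left red_add red_smult)
    then show "[mult_matrix (1 + smult m w) $$ (i, j) = 1\<^sub>m g $$ (i, j)] (mod m)"
      using ij by (simp add: mult_matrix_index cong_iff_dvd_diff)
  qed auto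
  ultimately have "[det (mult_matrix u) * norm_form a = 1] (mod m)" by simp
  then have "m dvd det (mult_matrix u) * norm_form a \<longleftrightarrow> m dvd 1" by (intro cong_dvd_iff)
  moreover have "\<not> m dvd 1" using assms(2) zdvd_not_zless by auto
  ultimately show ?thesis by auto
qed

end

section \<open>Maximal ideals over a prime\<close>

context number_order begin

definition p_ideals :: "nat \<Rightarrow> int poly set set" where
  "p_ideals p = {J. poly_ideal J \<and> R \<in> J \<and> [:int p:] \<in> J \<and> 1 \<notin> J}"

definition max_p_ideals :: "nat \<Rightarrow> int poly set set" where
  "max_p_ideals p = {J\<in>p_ideals p. \<forall>J'\<in>p_ideals p. J \<subseteq> J' \<longrightarrow> J' = J}"

lemma p_idealsD:
  assumes "J \<in> p_ideals p"
  shows "poly_ideal J" "R \<in> J" "[:int p:] \<in> J" "1 \<notin> J"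
  using assms by (auto simp: p_ideals_def)

lemma smult_in_p_ideal: "J \<in> p_ideals p \<Longrightarrow> smult (int p) f \<in> J"
  using poly_idealD(4)[OF p_idealsD(1,3), of J p p f] by simp

lemma reduce_mod_p:
  assumes "p > 0"
  shows "\<exists>f'\<in>ibox g p. \<exists>w. R dvd f - f' - smult (int p) w"
proof
  let ?f' = "map_poly (\<lambda>x. x mod int p) (red f)"
  let ?w = "map_poly (\<lambda>x. x div int p) (red f)"
  show "?f' \<in> ibox g p" using assms by (auto simp: ibox_def coeff_map_poly coeff_red_ge)
  have "red f = ?f' + smult (int p) ?w"
    by (intro poly_eqI) (simp add: coeff_map_poly)
  then have "f - ?f' - smult (int p) ?w = f - red f" by simp
  then show "\<exists>w. R dvd f - ?f' - smult (int p) w" using R_dvd_diff_red by metis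
qed

text \<open>An ideal over \<open>p\<close> is determined by the elements of the finite box
  \<open>ibox g p\<close> that it contains. Finiteness then supplies maximal ideals.\<close>

lemma finite_p_ideals:
  assumes "p > 0" shows "finite (p_ideals p)"
proof -
  have mem: "f \<in> J \<longleftrightarrow> f' \<in> J" if J: "J \<in> p_ideals p" and d: "R dvd f - f' - smult (int p) w" for J f f' w
  proof -
    note I = p_idealsD(1)[OF J]
    have "f - f' - smult (int p) w \<in> J" using d p_idealsD[OF J] poly_ideal_dvd by blast
    then have ff: "f - f' \<in> J" using poly_idealD(2)[OF I _ smult_in_p_ideal[OF J, of w]] by force
    show ?thesis
    proof
      assume "f \<in> J" then show "f' \<in> J" using poly_ideal_diff[OF I _ ff] by force
    next
      assume "f' \<in> J" then show "f \<in> J" using poly_idealD(2)[OF I _ ff] by force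
    qed
  qed
  have "inj_on (\<lambda>J. J \<inter> ibox g p) (p_ideals p)"
  proof (rule inj_onI)
    fix J J' assume J: "J \<in> p_ideals p" "J' \<in> p_ideals p" "J \<inter> ibox g p = J' \<inter> ibox g p"
    show "J = J'"
    proof (rule Set.set_eqI)
      fix f
      obtain f' w where "f' \<in> ibox g p" "R dvd f - f' - smult (int p) w" using reduce_mod_p[OF assms] by blast
      then show "f \<in> J \<longleftrightarrow> f \<in> J'" using mem J by blast
    qed
  qed
  moreover have "finite ((\<lambda>J. J \<inter> ibox g p) ` p_ideals p)"
    by (rule finite_subset[of _ "Pow (ibox g p)"]) auto
  ultimately show ?thesis using finite_imageD by blast
qed

lemma exists_max_p_ideal:
  assumes "p > 0" "I \<in> p_ideals p"
  obtains J where "J \<in> max_p_ideals p" "I \<subseteq> J"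
  using finite_has_maximal2[OF finite_p_ideals[OF assms(1)] assms(2)]
  unfolding max_p_ideals_def by blast

lemma const_in_p_ideal:
  assumes J: "J \<in> p_ideals p" and p: "prime p" and c: "[:c:] \<in> J"
  shows "int p dvd c"
proof (rule ccontr)
  assume "\<not> int p dvd c"
  then have "coprime c (int p)" using p by (rule coprime_int_if_not_dvd[rotated])
  then obtain u where u: "[c * u = 1] (mod int p)" using cong_solve_coprime_int by blast
  then obtain k where "c * u - 1 = int p * k" by (auto simp: cong_iff_dvd_diff elim: dvdE)
  then have "c * u = 1 + int p * k" by simp
  then have "[:1:] = [:u:] * [:c:] - smult (int p) [:k:]" by (simp add: mult.commute)
  then have "1 = [:u:] * [:c:] - smult (int p) [:k:]" by (simp only: one_pCons)
  moreover have "[:u:] * [:c:] - smult (int p) [:k:] \<in> J"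
    by (rule poly_ideal_diff[OF p_idealsD(1)[OF J] poly_idealD(3)[OF p_idealsD(1)[OF J] c] smult_in_p_ideal[OF J]])
  ultimately show False using p_idealsD(4)[OF J] by metis
qed

text \<open>Hence every proper ideal over \<open>p\<close> has index at least
  \<open>p\<close>.\<close>

lemma incongruent_constants:
  assumes J: "J \<in> p_ideals p" and p: "prime p"
  shows "incongruent J ((\<lambda>c. [:c:]) ` {0..<int p})" "card ((\<lambda>c. [:c:]) ` {0..<int p}) = p"
proof -
  have "c = d" if "c \<in> {0..<int p}" "d \<in> {0..<int p}" "[:c:] - [:d:] \<in> J" for c d
  proof -
    have "int p dvd c - d" using const_in_p_ideal[OF J p, of "c - d"] that by simp
    then have "[c = d] (mod int p)" by (simp add: cong_iff_dvd_diff)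
    then show ?thesis using that by (simp add: cong_def)
  qed
  then show "incongruent J ((\<lambda>c. [:c:]) ` {0..<int p})" unfolding incongruent_def by blast
  show "card ((\<lambda>c. [:c:]) ` {0..<int p}) = p" by (simp add: card_image inj_on_def)
qed

text \<open>If \<open>c + d T\<close> with \<open>p\<close> not dividing \<open>d\<close> lies in a proper ideal over \<open>p\<close>, then \<open>T\<close> is congruent
  to a constant \<open>r\<close>, and \<open>r\<close> is a root of \<open>R\<close> modulo \<open>p\<close>.\<close>

lemma incongruent_linear:
  assumes J: "J \<in> p_ideals p" and p: "prime p" and nr: "roots_mod R p = {}"
  shows "incongruent J ((\<lambda>(c, d). [:c, d:]) ` ({0..<int p} \<times> {0..<int p}))"
    "card ((\<lambda>(c, d). [:c, d:]) ` ({0..<int p} \<times> {0..<int p})) = p ^ 2"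
proof -
  note I = p_idealsD(1)[OF J]
  have lin: "int p dvd d" if cd: "[:c, d:] \<in> J" for c d
  proof (rule ccontr)
    assume "\<not> int p dvd d"
    then have "coprime d (int p)" using p by (rule coprime_int_if_not_dvd[rotated])
    then obtain u where u: "[d * u = 1] (mod int p)" using cong_solve_coprime_int by blast
    then obtain k where k: "d * u - 1 = int p * k" by (auto simp: cong_iff_dvd_diff elim: dvdE)
    define r where "r = (- (c * u)) mod int p"
    obtain l where l: "- (c * u) = r + int p * l" unfolding r_def by (metis mult_div_mod_eq add.commute)
    have cu: "c * u = - r - int p * l" using l by simp
    have du: "d * u = 1 + int p * k" using k by simp
    have "[:- r, 1:] = [:u:] * [:c, d:] - smult (int p) [:- l, k:]"
      using cu du by (simp add: mult.commute)
    then have T: "[:- r, 1:] \<in> J"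
      using poly_ideal_diff[OF I poly_idealD(3)[OF I cd, of "[:u:]"] smult_in_p_ideal[OF J]] by metis
    have "[:poly R r:] = R - [:- r, 1:] * synthetic_div R r"
      using synthetic_div_correct'[of r R] by (metis add_diff_cancel_left')
    moreover have "R - [:- r, 1:] * synthetic_div R r \<in> J"
      by (rule poly_ideal_diff[OF I p_idealsD(2)[OF J] poly_idealD(4)[OF I T]])
    ultimately have "int p dvd poly R r" using const_in_p_ideal[OF J p] by metis
    then have "r \<in> roots_mod R p" using p by (auto simp: roots_mod_def r_def prime_gt_0_nat)
    then show False using nr by simp
  qed
  have "(c, d) = (c', d')" if "c \<in> {0..<int p}" "d \<in> {0..<int p}" "c' \<in> {0..<int p}" "d' \<in> {0..<int p}" and m: "[:c, d:] - [:c', d':] \<in> J" for c d c' d'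
  proof -
    have "int p dvd d - d'" using lin[of "c - c'" "d - d'"] m by simp
    then have "[d = d'] (mod int p)" by (simp add: cong_iff_dvd_diff)
    then have d: "d = d'" using that by (simp add: cong_def)
    then have "int p dvd c - c'" using const_in_p_ideal[OF J p, of "c - c'"] m by simp
    then have "[c = c'] (mod int p)" by (simp add: cong_iff_dvd_diff)
    then show ?thesis using that d by (simp add: cong_def)
  qed
  then show "incongruent J ((\<lambda>(c, d). [:c, d:]) ` ({0..<int p} \<times> {0..<int p}))"
    unfolding incongruent_def by (auto simp del: diff_pCons)
  have "inj_on (\<lambda>(c, d). [:c, d:]) ({0..<int p} \<times> {0..<int p})" by (auto simp: inj_on_def)
  then show "card ((\<lambda>(c, d). [:c, d:]) ` ({0..<int p} \<times> {0..<int p})) = p ^ 2"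
    by (simp add: card_image card_cartesian_product power2_eq_square)
qed

text \<open>The sum of two distinct maximal ideals contains both, so it cannot be proper.\<close>

lemma max_p_ideals_coprime:
  assumes J: "J \<in> max_p_ideals p" "J' \<in> max_p_ideals p" "J \<noteq> J'"
  obtains x where "x \<in> J'" "x - 1 \<in> J"
proof -
  have Jp: "J \<in> p_ideals p" "J' \<in> p_ideals p" using J by (auto simp: max_p_ideals_def)
  note I = p_idealsD(1)[OF Jp(1)] and I' = p_idealsD(1)[OF Jp(2)]
  define K where "K = {f. \<exists>a\<in>J. \<exists>b\<in>J'. f = a + b}"
  have K: "poly_ideal K"
    unfolding poly_ideal_def
  proof (intro conjI ballI allI)
    show "0 \<in> K" unfolding K_def using poly_idealD(1)[OF I] poly_idealD(1)[OF I'] by force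
  next
    fix f h assume "f \<in> K" "h \<in> K"
    then obtain a b a' b' where *: "a \<in> J" "b \<in> J'" "f = a + b" "a' \<in> J" "b' \<in> J'" "h = a' + b'"
      unfolding K_def by blast
    then have "f + h = (a + a') + (b + b')" by simp
    then show "f + h \<in> K" unfolding K_def using * poly_idealD(2)[OF I] poly_idealD(2)[OF I'] by blast
  next
    fix f h assume "f \<in> K"
    then obtain a b where *: "a \<in> J" "b \<in> J'" "f = a + b" unfolding K_def by blast
    then have "h * f = h * a + h * b" by (simp add: algebra_simps)
    then show "h * f \<in> K" unfolding K_def using * poly_idealD(3)[OF I] poly_idealD(3)[OF I'] by blast
  qed
  have sub: "J \<subseteq> K" "J' \<subseteq> K"
    unfolding K_def using poly_idealD(1)[OF I] poly_idealD(1)[OF I'] by force+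
  have "1 \<in> K"
  proof (rule ccontr)
    assume "1 \<notin> K"
    then have "K \<in> p_ideals p" using K sub p_idealsD[OF Jp(1)] by (auto simp: p_ideals_def)
    then have "K = J" "K = J'" using J sub unfolding max_p_ideals_def by blast+
    then show False using J by simp
  qed
  then obtain a b where ab: "a \<in> J" "b \<in> J'" "1 = a + b" unfolding K_def by blast
  have "b - 1 = - a" using ab(3) by simp
  then have "b - 1 \<in> J" using poly_ideal_uminus[OF I ab(1)] by simp
  then show ?thesis using ab that by blast
qed

text \<open>By the Chinese remainder theorem, \<open>k\<close> maximal ideals over \<open>p\<close> yield \<open>p^k\<close> classes modulo \<open>p\<close>.\<close>

lemma card_max_p_ideals_le:
  assumes p: "prime p"
  shows "card (max_p_ideals p) \<le> g"
proof -
  let ?M = "max_p_ideals p"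
  have p0: "p > 0" using p by (rule prime_gt_0_nat)
  have fin: "finite ?M" using finite_p_ideals[OF p0] by (simp add: max_p_ideals_def)
  have MJ: "J \<in> p_ideals p" if "J \<in> ?M" for J using that by (simp add: max_p_ideals_def)
  have "\<forall>J\<in>?M. \<exists>e. e - 1 \<in> J \<and> (\<forall>J'\<in>?M - {J}. e \<in> J')"
  proof
    fix J assume J: "J \<in> ?M"
    note I = p_idealsD(1)[OF MJ[OF J]]
    have "\<forall>J'\<in>?M - {J}. \<exists>x. x \<in> J' \<and> x - 1 \<in> J"
      using max_p_ideals_coprime[OF J] by (metis DiffE insertI1)
    then obtain x where x: "\<And>J'. J' \<in> ?M - {J} \<Longrightarrow> x J' \<in> J' \<and> x J' - 1 \<in> J" by metis
    have "(\<Prod>J'\<in>A. x J') - 1 \<in> J" if "finite A" "A \<subseteq> ?M - {J}" for A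
      using that
    proof (induction A rule: finite_induct)
      case empty
      then show ?case using poly_idealD(1)[OF I] by simp
    next
      case (insert J' A)
      have "x J' * ((\<Prod>J'\<in>A. x J') - 1) + (x J' - 1) \<in> J"
        using insert x[of J'] by (intro poly_idealD(2)[OF I] poly_idealD(3)[OF I]) auto
      then show ?case using insert by (simp add: algebra_simps)
    qed
    then have "(\<Prod>J'\<in>?M - {J}. x J') - 1 \<in> J" using fin by auto
    moreover have "(\<Prod>J'\<in>?M - {J}. x J') \<in> J'" if J': "J' \<in> ?M - {J}" for J'
    proof (rule poly_ideal_dvd)
      show "poly_ideal J'" using MJ[of J'] J' p_idealsD(1) by blast
      show "x J' \<in> J'" using x[OF J'] by simp
      show "x J' dvd (\<Prod>J'\<in>?M - {J}. x J')" using fin J' by (intro dvd_prodI) auto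
    qed
    ultimately show "\<exists>e. e - 1 \<in> J \<and> (\<forall>J'\<in>?M - {J}. e \<in> J')" by blast
  qed
  then obtain e where e: "\<And>J. J \<in> ?M \<Longrightarrow> e J - 1 \<in> J" "\<And>J J'. J \<in> ?M \<Longrightarrow> J' \<in> ?M - {J} \<Longrightarrow> e J \<in> J'"
    by metis
  define F where "F c = (\<Sum>J\<in>?M. [:c J:] * e J)" for c
  define P where "P = PiE ?M (\<lambda>_. {0..<int p})"
  have val: "F c - [:c J:] \<in> J" if J: "J \<in> ?M" for c J
  proof -
    note I = p_idealsD(1)[OF MJ[OF J]]
    have "F c - [:c J:] = [:c J:] * (e J - 1) + (\<Sum>J'\<in>?M - {J}. [:c J':] * e J')"
      unfolding F_def sum.remove[OF fin J] by (simp add: algebra_simps smult_diff_right)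
    moreover have "\<dots> \<in> J"
      by (rule poly_idealD(2)[OF I poly_idealD(3)[OF I e(1)[OF J]]],
          rule poly_ideal_sum[OF I], rule poly_idealD(3)[OF I], rule e(2)) (use J in auto)
    ultimately show ?thesis by simp
  qed
  \<comment> \<open>Representatives modulo \<open>p\<close> and \<open>R\<close> confine the
    \<open>p ^ card ?M\<close> interpolated elements to a box of \<open>p ^ g\<close>
    elements.\<close>
  obtain rp where rp: "\<And>f. rp f \<in> ibox g p" "\<And>f. \<exists>w. R dvd f - rp f - smult (int p) w"
    using reduce_mod_p[OF p0] by metis
  have inj: "inj_on (\<lambda>c. rp (F c)) P"
  proof (rule inj_onI)
    fix c c' assume c: "c \<in> P" "c' \<in> P" and eq: "rp (F c) = rp (F c')"
    show "c = c'"
    proof (rule PiE_ext[OF c[unfolded P_def]])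
      fix J assume J: "J \<in> ?M"
      note I = p_idealsD(1)[OF MJ[OF J]]
      have "F c - rp (F c) \<in> J" for c
      proof -
        obtain w where "R dvd F c - rp (F c) - smult (int p) w" using rp by blast
        then have "F c - rp (F c) - smult (int p) w \<in> J"
          by (rule poly_ideal_dvd[OF I p_idealsD(2)[OF MJ[OF J]]])
        then show ?thesis using poly_idealD(2)[OF I _ smult_in_p_ideal[OF MJ[OF J], of w]] by force
      qed
      from poly_ideal_diff[OF I this[of c] this[of c']] have "F c - F c' \<in> J" using eq by simp
      from poly_ideal_diff[OF I this poly_ideal_diff[OF I val[OF J, of c] val[OF J, of c']]]
      have "[:c J - c' J:] \<in> J" by (simp add: algebra_simps)
      then have "int p dvd c J - c' J" by (rule const_in_p_ideal[OF MJ[OF J] p])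
      then have "[c J = c' J] (mod int p)" by (simp add: cong_iff_dvd_diff)
      moreover have "c J \<in> {0..<int p}" "c' J \<in> {0..<int p}" using c J by (auto simp: P_def PiE_iff)
      ultimately show "c J = c' J" by (simp add: cong_def)
    qed
  qed
  have "card P \<le> card (ibox g p)"
    by (rule card_inj_on_le[OF inj]) (use rp in auto)
  then have "p ^ card ?M \<le> p ^ g" using fin by (simp add: P_def card_PiE card_ibox)
  then show ?thesis using prime_gt_1_nat[OF p] by (simp add: power_increasing_iff)
qed

text \<open>If \<open>a\<close>, \<open>R\<close> and \<open>p\<close> generated the unit ideal,
  \<open>a\<close> would be invertible modulo \<open>p\<close> and its norm prime to
  \<open>p\<close>.\<close>

lemma prime_dvd_norm_form:
  assumes p: "prime p" and d: "int p dvd norm_form a"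
  obtains J where "J \<in> max_p_ideals p" "a \<in> J"
proof -
  define I where "I = {f. \<exists>u v w. f = u * a + v * R + smult (int p) w}"
  have I: "poly_ideal I"
    unfolding poly_ideal_def I_def
  proof (intro conjI ballI allI; clarify)
    show "\<exists>u v w. 0 = u * a + v * R + smult (int p) w" by (rule exI[of _ 0])+ simp
    fix u v w u' v' w'
    show "\<exists>x y z. u * a + v * R + smult (int p) w + (u' * a + v' * R + smult (int p) w') = x * a + y * R + smult (int p) z"
      by (rule exI[of _ "u + u'"], rule exI[of _ "v + v'"], rule exI[of _ "w + w'"]) (simp add: algebra_simps smult_add_right)
  next
    fix f u v w show "\<exists>x y z. f * (u * a + v * R + smult (int p) w) = x * a + y * R + smult (int p) z"
      by (rule exI[of _ "f * u"], rule exI[of _ "f * v"], rule exI[of _ "f * w"]) (simp add: algebra_simps)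
  qed
  have aI: "a \<in> I" unfolding I_def mem_Collect_eq
    by (rule exI[of _ 1], rule exI[of _ 0], rule exI[of _ 0]) simp
  have "R \<in> I" unfolding I_def mem_Collect_eq
    by (rule exI[of _ 0], rule exI[of _ 1], rule exI[of _ 0]) simp
  moreover have "[:int p:] \<in> I" unfolding I_def mem_Collect_eq
    by (rule exI[of _ 0], rule exI[of _ 0], rule exI[of _ 1]) (simp only: mult_zero_left add_0 one_pCons smult_pCons smult_0_right mult_1_right)
  moreover have "1 \<notin> I"
  proof
    assume "1 \<in> I"
    then obtain u v w where "1 = u * a + v * R + smult (int p) w" by (auto simp: I_def)
    then have "u * a - (1 + smult (int p) (- w)) = - (v * R)" by (simp add: algebra_simps)
    then have "R dvd u * a - (1 + smult (int p) (- w))" by simp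
    then show False using not_dvd_norm_form[of u a "int p" "- w"] d prime_gt_1_nat[OF p] by simp
  qed
  ultimately have "I \<in> p_ideals p" using I by (simp add: p_ideals_def)
  then show ?thesis using exists_max_p_ideal[of p I] prime_gt_0_nat[OF p] aI that by blast
qed

text \<open>\<open>m\<close> is a common lower bound for the index of the proper ideals over
  \<open>p\<close>: it will be \<open>p\<close> in general and \<open>p ^ 2\<close> when
  \<open>R\<close> has no root modulo \<open>p\<close>. The factor \<open>g\<close> on the right
  counts the maximal ideals.\<close>

lemma card_prime_dvd_norm_form_le:
  assumes p: "prime p" and X: "X \<ge> 1"
    and V: "\<And>J. J \<in> p_ideals p \<Longrightarrow> \<exists>V. finite V \<and> incongruent J V \<and> card V = m"
  shows "m * card {a\<in>ibox g X. a \<noteq> 0 \<and> int p dvd norm_form a} \<le> g * ((cov + 2) * X) ^ g"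
proof -
  let ?M = "max_p_ideals p"
  have fin: "finite ?M" using finite_p_ideals[OF prime_gt_0_nat[OF p]] by (simp add: max_p_ideals_def)
  have "{a\<in>ibox g X. a \<noteq> 0 \<and> int p dvd norm_form a} \<subseteq> (\<Union>J\<in>?M. J \<inter> ibox g X - {0})"
    using prime_dvd_norm_form[OF p] by blast
  then have "card {a\<in>ibox g X. a \<noteq> 0 \<and> int p dvd norm_form a} \<le> card (\<Union>J\<in>?M. J \<inter> ibox g X - {0})"
    by (rule card_mono[rotated]) (use fin in auto)
  also have "\<dots> \<le> (\<Sum>J\<in>?M. card (J \<inter> ibox g X - {0}))" by (rule card_UN_le[OF fin])
  finally have "m * card {a\<in>ibox g X. a \<noteq> 0 \<and> int p dvd norm_form a} \<le> m * (\<Sum>J\<in>?M. card (J \<inter> ibox g X - {0}))"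
    by (rule mult_left_mono) simp
  also have "\<dots> = (\<Sum>J\<in>?M. m * card (J \<inter> ibox g X - {0}))" by (simp add: sum_distrib_left)
  also have "\<dots> \<le> (\<Sum>J\<in>?M. ((cov + 2) * X) ^ g)"
  proof (rule sum_mono)
    fix J assume "J \<in> ?M"
    then have J: "J \<in> p_ideals p" by (simp add: max_p_ideals_def)
    show "m * card (J \<inter> ibox g X - {0}) \<le> ((cov + 2) * X) ^ g"
    proof (cases "J \<inter> ibox g X - {0} = {}")
      case True then show ?thesis by (simp only: card.empty)
    next
      case False
      then obtain a where a: "a \<in> J" "a \<noteq> 0" "a \<in> ibox g X" by blast
      obtain V where V: "finite V" "incongruent J V" "card V = m" using V[OF J] by blast
      have "card (J \<inter> ibox g X - {0}) \<le> card (J \<inter> ibox g X)" by (rule card_mono) auto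
      then have "m * card (J \<inter> ibox g X - {0}) \<le> card V * card (J \<inter> ibox g X)" using V by simp
      also have "\<dots> \<le> ((cov + 2) * X) ^ g"
        by (rule card_ideal_box_le[OF p_idealsD(1,2)[OF J] V(2,1) X a])
      finally show ?thesis .
    qed
  qed
  also have "\<dots> \<le> g * ((cov + 2) * X) ^ g" using card_max_p_ideals_le[OF p] by simp
  finally show ?thesis .
qed

lemma card_prime_dvd_norm_form_le1:
  assumes "prime p" "X \<ge> 1"
  shows "p * card {a\<in>ibox g X. a \<noteq> 0 \<and> int p dvd norm_form a} \<le> g * ((cov + 2) * X) ^ g"
proof (rule card_prime_dvd_norm_form_le[OF assms])
  fix J assume "J \<in> p_ideals p"
  from incongruent_constants[OF this assms(1)]
  show "\<exists>V. finite V \<and> incongruent J V \<and> card V = p" by (meson finite_atLeastLessThan_int finite_imageI)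
qed

lemma card_prime_dvd_norm_form_le2:
  assumes "prime p" "X \<ge> 1" "roots_mod R p = {}"
  shows "p ^ 2 * card {a\<in>ibox g X. a \<noteq> 0 \<and> int p dvd norm_form a} \<le> g * ((cov + 2) * X) ^ g"
proof (rule card_prime_dvd_norm_form_le[OF assms(1,2)])
  fix J assume "J \<in> p_ideals p"
  from incongruent_linear[OF this assms(1,3)]
  show "\<exists>V. finite V \<and> incongruent J V \<and> card V = p ^ 2"
    by (intro exI[of _ "(\<lambda>(c, d). [:c, d:]) ` ({0..<int p} \<times> {0..<int p})"]) simp
qed

end

section \<open>Many primes have a root\<close>

lemma sum_inverse_squares_tail:
  assumes "K \<ge> (1::nat)" "finite F" "\<And>p. p \<in> F \<Longrightarrow> p > K"
  shows "(\<Sum>p\<in>F. 1 / (real p)\<^sup>2) \<le> 1 / real K"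
proof -
  have *: "(\<Sum>m=K+1..K+n. 1 / (real m)\<^sup>2) \<le> 1 / real K - 1 / real (K + n)" for n
  proof (induction n)
    case (Suc n)
    have x: "real (K + n) > 0" using assms by simp
    have "1 / (real (K + n) + 1)\<^sup>2 \<le> 1 / ((real (K + n) + 1) * real (K + n))"
      using x by (intro divide_left_mono) (auto simp: power2_eq_square)
    also have "\<dots> = 1 / real (K + n) - 1 / (real (K + n) + 1)" using x by (simp add: field_simps)
    finally show ?case using Suc by (simp add: add.commute)
  qed simp
  define n where "n = Max (insert 0 F)"
  have "F \<subseteq> {K+1..K+n}"
  proof
    fix p assume p: "p \<in> F"
    then have "p \<le> n" unfolding n_def using assms(2) by auto
    then show "p \<in> {K+1..K+n}" using assms(3)[OF p] by simp
  qed
  then have "(\<Sum>p\<in>F. 1 / (real p)\<^sup>2) \<le> (\<Sum>m=K+1..K+n. 1 / (real m)\<^sup>2)"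
    by (intro sum_mono2) auto
  also have "\<dots> \<le> 1 / real K - 1 / real (K + n)" by (rule *)
  also have "\<dots> \<le> 1 / real K" by simp
  finally show ?thesis .
qed

text \<open>What matters is the decay in \<open>k\<close>: it makes the contribution of high powers
  of small primes as small as desired.\<close>

lemma sum_inverse_prime_powers:
  assumes "k \<ge> 1"
  shows "(\<Sum>p\<in>primes_le s. 1 / real p ^ Suc k) \<le> 2 / 2 ^ k"
proof -
  have "(\<Sum>p\<in>primes_le s. 1 / real p ^ Suc k) \<le> (\<Sum>p\<in>primes_le s. 2 / 2 ^ k * (1 / (real p)\<^sup>2))"
  proof (rule sum_mono)
    fix p assume "p \<in> primes_le s"
    then have p: "real p \<ge> 2" by (auto dest: primes_le_D)
    obtain j where j: "k = Suc j" using assms by (cases k) auto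
    have "2 ^ j * (real p)\<^sup>2 \<le> real p ^ j * (real p)\<^sup>2" using p by (intro mult_right_mono power_mono) auto
    then have "1 / (real p ^ j * (real p)\<^sup>2) \<le> 1 / (2 ^ j * (real p)\<^sup>2)" using p by (intro divide_left_mono) auto
    then show "1 / real p ^ Suc k \<le> 2 / 2 ^ k * (1 / (real p)\<^sup>2)" by (simp add: j power2_eq_square mult_ac)
  qed
  also have "\<dots> = 2 / 2 ^ k * (\<Sum>p\<in>primes_le s. 1 / (real p)\<^sup>2)" by (simp add: sum_distrib_left)
  also have "\<dots> \<le> 2 / 2 ^ k * (\<Sum>m=2..s. 1 / (real m)\<^sup>2)"
    by (intro mult_left_mono sum_mono2) (auto dest: primes_le_D)
  also have "\<dots> \<le> 2 / 2 ^ k * 1" by (intro mult_left_mono sum_inverse_squares_le) simp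
  finally show ?thesis by simp
qed

context number_order begin

section \<open>Prime factorisation of the norms in a box\<close>

lemma norm_form_0: "norm_form 0 = 0"
proof -
  have "mult_matrix 0 = 0 \<cdot>\<^sub>m 1\<^sub>m g" by (rule eq_matI) (auto simp: mult_matrix_def)
  then show ?thesis using gpos by (simp add: norm_form_def)
qed

text \<open>By \<open>norm_form_abs_le\<close>, norms on a box of side \<open>X\<close> are at most
  \<beta> times \<open>X ^ g\<close>.\<close>

definition \<beta> :: nat where "\<beta> = fact g * \<kappa> ^ g"

lemma beta_pos: "\<beta> \<ge> 1" using kappa_pos by (simp add: \<beta>_def)

text \<open>\<open>count_prime_power_dvd\<close> on each fibre. The exponent
  \<open>g * k + 1\<close> allows for the loss of \<open>k\<close> factors in each of the
  \<open>g\<close> descent steps.\<close>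

lemma count_prime_power_norm_form:
  assumes p: "prime p" and X: "X \<ge> 1"
  shows "real (card {a\<in>ibox g X. int p ^ (g * k + 1) dvd norm_form a}) \<le> real g * real X ^ g * (1 / real p ^ Suc k + 1 / real X)"
proof -
  obtain h where h: "g = Suc h" using gpos by (cases g) auto
  have p0: "real p > 0" using p by (simp add: prime_gt_0_nat)
  have "real (card {a\<in>ibox (Suc h) X. int p ^ (g * k + 1) dvd norm_form a}) \<le> (real g * (real X / real p ^ Suc k + 1)) * real X ^ h"
  proof (rule card_ibox_fibres)
    fix b
    have "card {x\<in>{0..<int X}. int p ^ (g * k + 1) dvd norm_form (pCons x b)} \<le> g * (X div p ^ Suc k + 1)"
      unfolding norm_form_pCons by (rule count_prime_power_dvd[OF p]) (rule norm_form_poly_monic)+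
    then have "real (card {x\<in>{0..<int X}. int p ^ (g * k + 1) dvd norm_form (pCons x b)}) \<le> real (g * (X div p ^ Suc k + 1))"
      by (simp only: of_nat_le_iff)
    also have "\<dots> = real g * (real (X div p ^ Suc k) + 1)" by (simp only: of_nat_mult of_nat_add of_nat_1)
    also have "\<dots> \<le> real g * (real X / real (p ^ Suc k) + 1)"
      by (intro mult_left_mono add_right_mono of_nat_div_le_of_nat) simp
    finally show "real (card {x\<in>{0..<int X}. int p ^ (g * k + 1) dvd norm_form (pCons x b)}) \<le> real g * (real X / real p ^ Suc k + 1)"
      by simp
  qed
  also have "\<dots> = real g * real X ^ g * (1 / real p ^ Suc k + 1 / real X)"
    using X p0 by (simp add: h field_simps)
  finally show ?thesis by (simp add: h)
qed

text \<open>\<open>count_small_values\<close> with blocks of length \<open>s\<close>: the threshold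
  is chosen so that \<open>2 ^ g\<close> times it is half of \<open>s ^ g\<close>. Since the side is
  \<open>s^2\<close>, only a proportion of order \<open>1 / s\<close> is lost.\<close>

lemma count_small_norm_form:
  assumes s: "s \<ge> 1"
  shows "real (card {a\<in>ibox g (s\<^sup>2). \<bar>real_of_int (norm_form a)\<bar> \<le> real s ^ g / 2 ^ Suc g}) \<le> 2 * real g / real s * real (s\<^sup>2) ^ g"
proof -
  obtain h where h: "g = Suc h" using gpos by (cases g) auto
  have "real (card {a\<in>ibox (Suc h) (s\<^sup>2). \<bar>real_of_int (norm_form a)\<bar> \<le> real s ^ g / 2 ^ Suc g}) \<le> real (2 * g * s) * real (s\<^sup>2) ^ h"
  proof (rule card_ibox_fibres)
    fix b
    have "card {x\<in>{0..<int (s\<^sup>2)}. \<bar>real_of_int (norm_form (pCons x b))\<bar> \<le> real s ^ g / 2 ^ Suc g} \<le> 2 * g * s"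
      unfolding norm_form_pCons by (rule count_small_values[OF norm_form_poly_monic]) (use s in simp_all)
    then show "real (card {x\<in>{0..<int (s\<^sup>2)}. \<bar>real_of_int (norm_form (pCons x b))\<bar> \<le> real s ^ g / 2 ^ Suc g}) \<le> real (2 * g * s)"
      by (simp only: of_nat_le_iff)
  qed
  also have "\<dots> = 2 * real g / real s * real (s\<^sup>2) ^ g"
    using s by (simp add: h field_simps power2_eq_square)
  finally show ?thesis by (simp only: h)
qed

definition root_primes :: "nat \<Rightarrow> nat set" where
  "root_primes n = {p\<in>primes_le n. roots_mod R p \<noteq> {}}"

text \<open>\<open>s\<close> also separates small from large primes. The side is its square so that
  at most \<open>s\<close> small primes, each with the relative error \<open>1 / X\<close> of
  \<open>count_prime_power_norm_form\<close>, cost only \<open>1 / s\<close> together.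
  \<open>B\<close> bounds the norms on the box, and \<open>G\<close> leaves out the elements of
  small norm.\<close>

context
  fixes s X B k K :: nat and \<Lambda> C1 :: real and G :: "int poly set"
  assumes s2: "s \<ge> 2" and k1: "k \<ge> 1" and K1: "K \<ge> 1"
  defines "X \<equiv> s\<^sup>2" and "B \<equiv> \<beta> * s ^ (2 * g)" and "\<Lambda> \<equiv> ln (real B)"
    and "C1 \<equiv> real g * real (cov + 2) ^ g"
    and "G \<equiv> {a\<in>ibox g X. \<not> \<bar>real_of_int (norm_form a)\<bar> \<le> real s ^ g / 2 ^ Suc g}"
begin

lemma X1: "X \<ge> 1" using s2 by (simp add: X_def)

lemma C1_nonneg: "C1 \<ge> 0" by (simp add: C1_def)

lemma B1: "B \<ge> 1" using beta_pos s2 by (simp add: B_def)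

lemma Lambda_nonneg: "\<Lambda> \<ge> 0" unfolding \<Lambda>_def using B1 by simp

lemma G_facts:
  assumes "a \<in> G"
  shows "a \<in> ibox g X" "norm_form a \<noteq> 0" "a \<noteq> 0" "nat \<bar>norm_form a\<bar> \<ge> 1" "nat \<bar>norm_form a\<bar> \<le> B"
proof -
  show aX: "a \<in> ibox g X" using assms by (simp add: G_def)
  show N0: "norm_form a \<noteq> 0" using assms by (auto simp: G_def)
  then show "a \<noteq> 0" using norm_form_0 by auto
  show "nat \<bar>norm_form a\<bar> \<ge> 1" using N0 by linarith
  have "\<bar>norm_form a\<bar> \<le> int B"
    using norm_form_abs_le[OF aX] by (simp add: B_def \<beta>_def X_def power_mult_distrib mult.assoc flip: power_mult)
  then show "nat \<bar>norm_form a\<bar> \<le> B" by linarith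
qed

definition mlt :: "nat \<Rightarrow> int poly \<Rightarrow> nat" where "mlt p a = multiplicity p (nat \<bar>norm_form a\<bar>)"

lemma mlt_power_dvd: "int p ^ mlt p a dvd norm_form a"
proof -
  have "int (p ^ mlt p a) dvd int (nat \<bar>norm_form a\<bar>)" unfolding int_dvd_int_iff mlt_def by (rule multiplicity_dvd)
  then show ?thesis by simp
qed

lemma mlt_ln_le:
  assumes a: "a \<in> G" and p: "prime p"
  shows "real (mlt p a) * ln (real p) \<le> \<Lambda>"
proof -
  have "p ^ mlt p a \<le> nat \<bar>norm_form a\<bar>" unfolding mlt_def using G_facts(4)[OF a] by (intro dvd_imp_le multiplicity_dvd) simp
  then have "p ^ mlt p a \<le> B" using G_facts(5)[OF a] by linarith
  then have "ln (real (p ^ mlt p a)) \<le> ln (real B)" using p by (intro ln_of_nat_mono) (auto simp: prime_gt_0_nat)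
  then show ?thesis using p by (simp add: \<Lambda>_def ln_realpow prime_gt_0_nat)
qed

lemma not_dvd_mlt: "a \<in> G \<Longrightarrow> \<not> int p dvd norm_form a \<Longrightarrow> mlt p a = 0"
  unfolding mlt_def by (intro not_dvd_imp_multiplicity_0) (simp add: int_dvd_int_iff[symmetric] del: int_dvd_int_iff)

text \<open>\<open>M\<close> bounds the typical contribution of an element whose norm is divisible
  by \<open>p\<close>; \<open>M'\<close> is the surplus allowed on the exceptional set given by
  \<open>P\<close>.\<close>

lemma sum_mlt_le:
  assumes p: "prime p" and M: "\<And>a. a \<in> G \<Longrightarrow> int p dvd norm_form a \<Longrightarrow> real (mlt p a) * ln (real p) \<le> M + (if P a then M' else 0)"
    and M0: "M \<ge> 0" "M' \<ge> 0"
  shows "(\<Sum>a\<in>G. real (mlt p a) * ln (real p))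
     \<le> M * real (card {a\<in>ibox g X. a \<noteq> 0 \<and> int p dvd norm_form a}) + M' * real (card {a\<in>ibox g X. P a})"
proof -
  have "(\<Sum>a\<in>G. real (mlt p a) * ln (real p)) \<le> (\<Sum>a\<in>G. (if a \<noteq> 0 \<and> int p dvd norm_form a then M else 0) + (if P a then M' else 0))"
  proof (rule sum_mono)
    fix a assume a: "a \<in> G"
    show "real (mlt p a) * ln (real p) \<le> (if a \<noteq> 0 \<and> int p dvd norm_form a then M else 0) + (if P a then M' else 0)"
      using M[OF a] not_dvd_mlt[OF a, of p] G_facts(3)[OF a] M0 by auto
  qed
  also have "\<dots> \<le> (\<Sum>a\<in>ibox g X. (if a \<noteq> 0 \<and> int p dvd norm_form a then M else 0) + (if P a then M' else 0))"
    by (rule sum_mono2) (use M0 G_facts(1) in auto)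
  also have "\<dots> = M * real (card {a\<in>ibox g X. a \<noteq> 0 \<and> int p dvd norm_form a}) + M' * real (card {a\<in>ibox g X. P a})"
    by (simp add: sum.distrib mult.commute flip: sum.inter_filter)
  finally show ?thesis .
qed

lemma count1: "prime p \<Longrightarrow> real (card {a\<in>ibox g X. a \<noteq> 0 \<and> int p dvd norm_form a}) \<le> C1 * real X ^ g / real p"
proof -
  assume p: "prime p"
  have "real (p * card {a\<in>ibox g X. a \<noteq> 0 \<and> int p dvd norm_form a}) \<le> real (g * ((cov + 2) * X) ^ g)"
    using card_prime_dvd_norm_form_le1[OF p X1] by (simp only: of_nat_le_iff)
  then have "real p * real (card {a\<in>ibox g X. a \<noteq> 0 \<and> int p dvd norm_form a}) \<le> C1 * real X ^ g"
    unfolding C1_def by (simp only: of_nat_mult semiring_1_class.of_nat_power power_mult_distrib mult.assoc)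
  then show ?thesis using p by (simp add: pos_le_divide_eq prime_gt_0_nat mult.commute)
qed

lemma count2:
  assumes p: "prime p" "roots_mod R p = {}"
  shows "real (card {a\<in>ibox g X. a \<noteq> 0 \<and> int p dvd norm_form a}) \<le> C1 * real X ^ g / (real p)\<^sup>2"
proof -
  have "real (p ^ 2 * card {a\<in>ibox g X. a \<noteq> 0 \<and> int p dvd norm_form a}) \<le> real (g * ((cov + 2) * X) ^ g)"
    using card_prime_dvd_norm_form_le2[OF p(1) X1 p(2)] by (simp only: of_nat_le_iff)
  then have "(real p)\<^sup>2 * real (card {a\<in>ibox g X. a \<noteq> 0 \<and> int p dvd norm_form a}) \<le> C1 * real X ^ g"
    unfolding C1_def by (simp only: of_nat_mult semiring_1_class.of_nat_power power_mult_distrib mult.assoc)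
  then show ?thesis using p by (simp add: pos_le_divide_eq prime_gt_0_nat mult.commute)
qed

text \<open>The crude bound by \<Lambda> is affordable because the index \<open>p ^ 2\<close> makes
  the sum over these primes converge.\<close>

lemma sum_mlt_no_root:
  assumes p: "prime p" "roots_mod R p = {}"
  shows "(\<Sum>a\<in>G. real (mlt p a) * ln (real p)) \<le> real X ^ g * (\<Lambda> * C1 * (1 / (real p)\<^sup>2))"
proof -
  have "(\<Sum>a\<in>G. real (mlt p a) * ln (real p)) \<le> \<Lambda> * real (card {a\<in>ibox g X. a \<noteq> 0 \<and> int p dvd norm_form a}) + 0 * real (card {a\<in>ibox g X. False})"
    by (rule sum_mlt_le[OF p(1)]) (use mlt_ln_le p Lambda_nonneg in auto)
  also have "\<dots> \<le> \<Lambda> * (C1 * real X ^ g / (real p)\<^sup>2)"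
    using mult_left_mono[OF count2[OF p] Lambda_nonneg] by simp
  finally show ?thesis by (simp add: mult_ac)
qed

text \<open>For \<open>p > s\<close> the exponent is at most \<open>\<Lambda> / ln s\<close>, which
  stays bounded since \<Lambda> has the order of \<open>ln s\<close>.\<close>

lemma sum_mlt_large:
  assumes p: "prime p" "p > s"
  shows "(\<Sum>a\<in>G. real (mlt p a) * ln (real p)) \<le> real X ^ g * (\<Lambda> / ln (real s) * C1 * (ln (real p) / real p))"
proof -
  have lns: "ln (real s) > 0" using s2 by simp
  have lnp: "ln (real p) \<ge> ln (real s)" using s2 p by (intro ln_of_nat_mono) auto
  have "(\<Sum>a\<in>G. real (mlt p a) * ln (real p)) \<le> (\<Lambda> / ln (real s) * ln (real p)) * real (card {a\<in>ibox g X. a \<noteq> 0 \<and> int p dvd norm_form a}) + 0 * real (card {a\<in>ibox g X. False})"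
  proof (rule sum_mlt_le[OF p(1)])
    fix a assume a: "a \<in> G"
    have "real (mlt p a) * ln (real s) \<le> real (mlt p a) * ln (real p)" using lnp by (rule mult_left_mono) simp
    also have "\<dots> \<le> \<Lambda>" by (rule mlt_ln_le[OF a p(1)])
    finally have "real (mlt p a) \<le> \<Lambda> / ln (real s)" using lns by (simp add: pos_le_divide_eq)
    then show "real (mlt p a) * ln (real p) \<le> \<Lambda> / ln (real s) * ln (real p) + (if False then 0 else 0)"
      using mult_right_mono[of _ _ "ln (real p)"] lns lnp by fastforce
  qed (use lns lnp Lambda_nonneg in auto)
  also have "\<dots> \<le> (\<Lambda> / ln (real s) * ln (real p)) * (C1 * real X ^ g / real p)"
    using mult_left_mono[OF count1[OF p(1)], of "\<Lambda> / ln (real s) * ln (real p)"] lns lnp Lambda_nonneg by simp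
  finally show ?thesis by (simp add: mult_ac)
qed

text \<open>Exponents up to \<open>g * k\<close> are charged in full; larger ones occur only on a
  rare set, where \<Lambda> is the bound.\<close>

lemma sum_mlt_small:
  assumes p: "prime p"
  shows "(\<Sum>a\<in>G. real (mlt p a) * ln (real p))
    \<le> real X ^ g * (real (g * k) * C1 * (ln (real p) / real p) + \<Lambda> * real g * (1 / real p ^ Suc k + 1 / real X))"
proof -
  have lnp: "ln (real p) \<ge> 0" using p prime_ge_2_nat[OF p] by simp
  have "(\<Sum>a\<in>G. real (mlt p a) * ln (real p)) \<le> (real (g * k) * ln (real p)) * real (card {a\<in>ibox g X. a \<noteq> 0 \<and> int p dvd norm_form a})
      + \<Lambda> * real (card {a\<in>ibox g X. int p ^ (g * k + 1) dvd norm_form a})"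
  proof (rule sum_mlt_le[OF p])
    fix a assume a: "a \<in> G"
    show "real (mlt p a) * ln (real p) \<le> real (g * k) * ln (real p) + (if int p ^ (g * k + 1) dvd norm_form a then \<Lambda> else 0)"
    proof (cases "mlt p a \<le> g * k")
      case True
      then have "real (mlt p a) * ln (real p) \<le> real (g * k) * ln (real p)" using lnp by (intro mult_right_mono) (simp_all only: of_nat_le_iff)
      then show ?thesis using Lambda_nonneg by simp
    next
      case False
      then have "int p ^ (g * k + 1) dvd int p ^ mlt p a" by (intro le_imp_power_dvd) simp
      then have "int p ^ (g * k + 1) dvd norm_form a" using mlt_power_dvd dvd_trans by blast
      moreover have "0 \<le> real (g * k) * ln (real p)" using lnp by simp
      ultimately show ?thesis using mlt_ln_le[OF a p] by simp
    qed
  qed (use lnp Lambda_nonneg in auto)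
  also have "\<dots> \<le> (real (g * k) * ln (real p)) * (C1 * real X ^ g / real p)
      + \<Lambda> * (real g * real X ^ g * (1 / real p ^ Suc k + 1 / real X))"
    using count1[OF p] count_prime_power_norm_form[OF p X1] lnp Lambda_nonneg by (intro add_mono mult_left_mono) auto
  finally show ?thesis by (simp add: algebra_simps)
qed

text \<open>The primes dividing the norms fall into three groups. Primes above \<open>K\<close> without root contribute little
  since the ideals over them have index at least \<open>p^2\<close>. For the remaining primes up to \<open>s\<close> high powers
  are rare, and for those above \<open>s\<close> the exponent is bounded; both are controlled by the sum
  of \<open>log p / p\<close> over the primes with a root.\<close>

lemma sum_ln_norm_form_upper:
  "(\<Sum>a\<in>G. ln \<bar>real_of_int (norm_form a)\<bar>) \<le> real X ^ g * (\<Lambda> * (C1 / real K + real g * (2 / 2 ^ k) + real g / real s)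
     + (real (g * k) * C1 + \<Lambda> / ln (real s) * C1) * (\<Sum>p\<in>root_primes B \<union> primes_le K. ln (real p) / real p))"
proof -
  define A where "A = {p\<in>primes_le B. roots_mod R p = {} \<and> p > K}"
  define A1 where "A1 = {p\<in>primes_le B - A. p \<le> s}"
  define A2 where "A2 = {p\<in>primes_le B - A. p > s}"
  have fin: "finite A" "finite A1" "finite A2" unfolding A_def A1_def A2_def by simp_all
  have pr: "prime p" if "p \<in> A \<or> p \<in> A1 \<or> p \<in> A2" for p
    using that by (auto simp: A_def A1_def A2_def dest: primes_le_D)
  let ?S = "\<lambda>p. \<Sum>a\<in>G. real (mlt p a) * ln (real p)"
  let ?X = "real X ^ g"
  let ?w = "\<lambda>p. ln (real p) / real p"
  \<comment> \<open>The primes up to \<open>K\<close> without a root are treated like those with a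
    root; they add only a constant to the sum.\<close>
  define W where "W = (\<Sum>p\<in>root_primes B \<union> primes_le K. ?w p)"
  have wpos: "?w p \<ge> 0" if "prime p" for p using prime_ge_2_nat[OF that] by simp
  have finrp: "finite (root_primes B \<union> primes_le K)" by (simp add: root_primes_def)
  have sub: "A1 \<subseteq> root_primes B \<union> primes_le K" "A2 \<subseteq> root_primes B \<union> primes_le K"
    unfolding A1_def A2_def A_def root_primes_def by (auto simp: primes_le_def)
  have W: "(\<Sum>p\<in>A1. ?w p) \<le> W" "(\<Sum>p\<in>A2. ?w p) \<le> W"
    unfolding W_def using sub finrp wpos by (auto intro!: sum_mono2 simp: root_primes_def primes_le_def)
  have "(\<Sum>a\<in>G. ln \<bar>real_of_int (norm_form a)\<bar>) = (\<Sum>a\<in>G. \<Sum>p\<in>primes_le B. real (mlt p a) * ln (real p))"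
  proof (rule sum.cong[OF refl])
    fix a assume a: "a \<in> G"
    have "\<bar>real_of_int (norm_form a)\<bar> = real (nat \<bar>norm_form a\<bar>)" by simp
    also have "ln \<dots> = (\<Sum>p\<in>primes_le B. real (multiplicity p (nat \<bar>norm_form a\<bar>)) * ln (real p))"
    proof (rule ln_eq_sum_multiplicity)
      show "prime_factors (nat \<bar>norm_form a\<bar>) \<subseteq> primes_le B"
        using G_facts(4,5)[OF a] by (auto simp: primes_le_def in_prime_factors_iff intro: order.trans[OF dvd_imp_le])
    qed (use G_facts(4)[OF a] in \<open>auto simp: primes_le_def\<close>)
    finally show "ln \<bar>real_of_int (norm_form a)\<bar> = (\<Sum>p\<in>primes_le B. real (mlt p a) * ln (real p))" by (simp add: mlt_def)
  qed
  also have "\<dots> = (\<Sum>p\<in>primes_le B. ?S p)" by (rule sum.swap)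
  also have "\<dots> = (\<Sum>p\<in>A \<union> (A1 \<union> A2). ?S p)" by (rule sum.cong) (auto simp: A_def A1_def A2_def)
  also have "\<dots> = (\<Sum>p\<in>A. ?S p) + ((\<Sum>p\<in>A1. ?S p) + (\<Sum>p\<in>A2. ?S p))"
    using fin by (subst sum.union_disjoint, simp_all, fastforce simp: A1_def A2_def A_def)
      (subst sum.union_disjoint, auto simp: A1_def A2_def)
  also have "(\<Sum>p\<in>A. ?S p) \<le> (\<Sum>p\<in>A. ?X * (\<Lambda> * C1 * (1 / (real p)\<^sup>2)))"
    by (intro sum_mono sum_mlt_no_root) (auto simp: A_def dest: primes_le_D)
  also have "\<dots> = ?X * (\<Lambda> * C1 * (\<Sum>p\<in>A. 1 / (real p)\<^sup>2))" by (simp only: sum_distrib_left)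
  also have "\<dots> \<le> ?X * (\<Lambda> * C1 * (1 / real K))"
    using Lambda_nonneg C1_nonneg fin by (intro mult_left_mono sum_inverse_squares_tail K1) (auto simp: A_def)
  also have "(\<Sum>p\<in>A1. ?S p) \<le> (\<Sum>p\<in>A1. ?X * (real (g * k) * C1 * ?w p + \<Lambda> * real g * (1 / real p ^ Suc k + 1 / real X)))"
    by (intro sum_mono sum_mlt_small) (use pr in auto)
  also have "\<dots> = ?X * (real (g * k) * C1 * (\<Sum>p\<in>A1. ?w p) + \<Lambda> * real g * ((\<Sum>p\<in>A1. 1 / real p ^ Suc k) + real (card A1) / real X))"
    by (simp only: sum_distrib_left sum.distrib distrib_left) (simp add: sum_distrib_left)
  also have "\<dots> \<le> ?X * (real (g * k) * C1 * W + \<Lambda> * real g * (2 / 2 ^ k + 1 / real s))"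
  proof (intro mult_left_mono add_mono)
    have "(\<Sum>p\<in>A1. 1 / real p ^ Suc k) \<le> (\<Sum>p\<in>primes_le s. 1 / real p ^ Suc k)"
      by (rule sum_mono2) (auto simp: A1_def primes_le_def)
    then show "(\<Sum>p\<in>A1. 1 / real p ^ Suc k) \<le> 2 / 2 ^ k" using sum_inverse_prime_powers[OF k1, of s] by linarith
    have "A1 \<subseteq> {1..s}" by (auto simp: A1_def primes_le_def dest: prime_ge_1_nat)
    then have "card A1 \<le> s" using card_mono[of "{1..s}" A1] by simp
    then show "real (card A1) / real X \<le> 1 / real s"
      using s2 by (simp add: X_def power2_eq_square field_simps)
  qed (use W C1_nonneg Lambda_nonneg in auto)
  also have "(\<Sum>p\<in>A2. ?S p) \<le> (\<Sum>p\<in>A2. ?X * (\<Lambda> / ln (real s) * C1 * ?w p))"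
    by (intro sum_mono sum_mlt_large) (use pr in \<open>auto simp: A2_def\<close>)
  also have "\<dots> = ?X * (\<Lambda> / ln (real s) * C1 * (\<Sum>p\<in>A2. ?w p))" by (simp only: sum_distrib_left)
  also have "\<dots> \<le> ?X * (\<Lambda> / ln (real s) * C1 * W)"
    using W C1_nonneg Lambda_nonneg s2 by (intro mult_left_mono) auto
  finally show ?thesis unfolding W_def[symmetric] by (simp add: algebra_simps)
qed

text \<open>The first condition makes the elements of small norm at most half of the box. The second
  makes the bound for each single term non-negative, so that \<open>card G\<close> may be replaced
  by half the size of the box.\<close>

lemma sum_ln_norm_form_lower:
  assumes "real s \<ge> 4 * real g" "ln (real s) * real g \<ge> real (Suc g) * ln 2"
  shows "(\<Sum>a\<in>G. ln \<bar>real_of_int (norm_form a)\<bar>) \<ge> real X ^ g * (real g / 2 * ln (real s) - real (Suc g) * ln 2)"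
proof -
  let ?Y = "real s ^ g / 2 ^ Suc g"
  have lnY: "ln ?Y = real g * ln (real s) - real (Suc g) * ln 2"
    using s2 by (simp add: ln_div ln_realpow ln_mult algebra_simps)
  have "real g * ln (real s) - real (Suc g) * ln 2 \<le> ln \<bar>real_of_int (norm_form a)\<bar>" if "a \<in> G" for a
  proof -
    have "?Y \<le> \<bar>real_of_int (norm_form a)\<bar>" using that by (simp add: G_def)
    moreover have "?Y > 0" using s2 by simp
    ultimately show ?thesis unfolding lnY[symmetric] by (subst ln_le_cancel_iff) auto
  qed
  then have "real (card G) * (real g * ln (real s) - real (Suc g) * ln 2) \<le> (\<Sum>a\<in>G. ln \<bar>real_of_int (norm_form a)\<bar>)"
    using sum_bounded_below[of G "real g * ln (real s) - real (Suc g) * ln 2"] by simp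
  moreover have "real (card G) \<ge> real X ^ g / 2"
  proof -
    let ?Bad = "{a\<in>ibox g X. \<bar>real_of_int (norm_form a)\<bar> \<le> ?Y}"
    have "ibox g X = ?Bad \<union> G" by (auto simp: G_def)
    then have "card (ibox g X) \<le> card ?Bad + card G" using card_Un_le by metis
    then have "real X ^ g \<le> real (card ?Bad) + real (card G)"
      unfolding card_ibox by (simp only: of_nat_le_iff flip: of_nat_add semiring_1_class.of_nat_power)
    moreover have "real (card ?Bad) \<le> 2 * real g / real s * real X ^ g"
      unfolding X_def by (rule count_small_norm_form) (use s2 in simp)
    moreover have "2 * real g / real s * real X ^ g \<le> 1 / 2 * real X ^ g"
      using assms(1) s2 by (intro mult_right_mono) (auto simp: field_simps)
    ultimately show ?thesis by linarith
  qed
  then have "real X ^ g / 2 * (real g * ln (real s) - real (Suc g) * ln 2) \<le> real (card G) * (real g * ln (real s) - real (Suc g) * ln 2)"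
    using assms(2) by (intro mult_right_mono) (auto simp: mult.commute)
  moreover have "real X ^ g * (real g / 2 * ln (real s) - real (Suc g) * ln 2) \<le> real X ^ g / 2 * (real g * ln (real s) - real (Suc g) * ln 2)"
  proof -
    have "real X ^ g * (real (Suc g) * ln 2) \<ge> 0" by simp
    then show ?thesis by (simp add: algebra_simps)
  qed
  ultimately show ?thesis by linarith
qed

end

text \<open>The logarithms of the norms add up to at least \<open>g / 2 * ln s\<close> per element
  of the box, up to a constant. The primes without root and the high powers can explain only part of
  this, so the primes with a root must supply the rest.\<close>

lemma sum_root_primes_lower:
  obtains c C where "c > 0" "\<And>n. n \<ge> 1 \<Longrightarrow> (\<Sum>p\<in>root_primes n. ln (real p) / real p) \<ge> c * ln (real n) - C"
proof -
  define C1 where "C1 = real g * real (cov + 2) ^ g"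
  \<comment> \<open>\<open>K\<close>, \<open>k\<close> and \<open>s0\<close> make the error terms
    \<open>C1 / K\<close>, \<open>2 * g / 2 ^ k\<close> and \<open>g / s\<close> at most 1/48 each.
    As \<open>ln B\<close> is at most \<open>3 * g * ln s\<close>, they cost
    \<open>3 / 16 * g * ln s\<close> of the available \<open>g / 2 * ln s\<close>; the claim retains
    \<open>g / 4 * ln s\<close>.\<close>
  define K where "K = nat \<lceil>48 * C1\<rceil> + 1"
  have C10: "C1 \<ge> 0" by (simp add: C1_def)
  have K: "real K \<ge> 48 * C1" "K \<ge> 1" unfolding K_def by linarith+
  obtain k where k: "(2::real) ^ k \<ge> 96 * real g" "k \<ge> 1"
  proof -
    obtain k where "96 * real g < 2 ^ k" using real_arch_pow[of 2 "96 * real g"] by auto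
    moreover have "(2::real) ^ k \<le> 2 ^ Suc k" by simp
    ultimately show ?thesis using that[of "Suc k"] by linarith
  qed
  define W0 where "W0 = (\<Sum>p\<in>primes_le K. ln (real p) / real p)"
  define C2 where "C2 = real (g * k) * C1 + 3 * real g * C1 + 1"
  have C20: "C2 > 0" using C10 by (simp add: C2_def add_nonneg_pos)
  have g0: "real g \<ge> 1" using gpos by simp
  have "filterlim (\<lambda>s. ln (real s)) at_top sequentially"
    by (rule filterlim_compose[OF ln_at_top filterlim_real_sequentially])
  then have "eventually (\<lambda>s. ln (real s) \<ge> ln (real \<beta>) + 2 * ln 2) sequentially"
    by (auto simp: filterlim_at_top)
  then obtain s1 where s1: "\<And>s. s \<ge> s1 \<Longrightarrow> ln (real s) \<ge> ln (real \<beta>) + 2 * ln 2"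
    by (auto simp: eventually_sequentially)
  define s0 where "s0 = Max {s1, 48 * g, 2}"
  have step: "(\<Sum>p\<in>root_primes (\<beta> * s ^ (2 * g)). ln (real p) / real p)
      \<ge> (real g / 4 * ln (real s) - real (Suc g) * ln 2) / C2 - W0" if s: "s \<ge> s0" for s
  proof -
    have s': "s \<ge> s1" "s \<ge> 48 * g" "s \<ge> 2" using s by (auto simp: s0_def)
    have lb: "ln (real \<beta>) \<ge> 0" using beta_pos by simp
    have lns: "ln (real s) \<ge> ln (real \<beta>) + 2 * ln 2" by (rule s1[OF s'(1)])
    have lns0: "ln (real s) > 0" using s' by simp
    let ?X = "real (s\<^sup>2) ^ g"
    let ?B = "\<beta> * s ^ (2 * g)"
    let ?L = "ln (real ?B)"
    let ?W = "\<Sum>p\<in>root_primes ?B \<union> primes_le K. ln (real p) / real p"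
    have X0: "?X > 0" using s' by simp
    have L: "?L = ln (real \<beta>) + 2 * real g * ln (real s)"
      using beta_pos s' by (simp add: ln_mult ln_realpow)
    have "1 * ln (real s) \<le> real g * ln (real s)" using g0 lns0 by (intro mult_right_mono) auto
    moreover have "ln (2::real) \<ge> 0" by simp
    ultimately have L3: "?L \<le> 3 * real g * ln (real s)" using L lns by linarith
    have L0: "?L \<ge> 0" using L lb lns0 by simp
    have W0: "?W \<ge> 0" by (intro sum_nonneg) (auto simp: root_primes_def primes_le_def dest: prime_ge_2_nat)
    have "ln 2 \<le> (1::real)" using ln_le_minus_one[of 2] by simp
    have "real (Suc g) * ln 2 \<le> real g * (2 * ln 2)" using g0 by (simp add: algebra_simps)
    also have "\<dots> \<le> real g * ln (real s)" using lns lb by (intro mult_left_mono) auto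
    finally have cond: "ln (real s) * real g \<ge> real (Suc g) * ln 2" by (simp add: mult.commute)
    have "?X * (real g / 2 * ln (real s) - real (Suc g) * ln 2) \<le> ?X * (?L * (C1 / real K + real g * (2 / 2 ^ k) + real g / real s)
       + (real (g * k) * C1 + ?L / ln (real s) * C1) * ?W)"
    proof -
      have "real s \<ge> 4 * real g" using s'(2) by simp
      from order.trans[OF sum_ln_norm_form_lower[OF s'(3) k(2) K(2) this cond] sum_ln_norm_form_upper[OF s'(3) k(2) K(2)]]
      show ?thesis by (simp only: C1_def)
    qed
    then have "real g / 2 * ln (real s) - real (Suc g) * ln 2 \<le> ?L * (C1 / real K + real g * (2 / 2 ^ k) + real g / real s)
       + (real (g * k) * C1 + ?L / ln (real s) * C1) * ?W"
      using X0 by (simp only: mult_le_cancel_left_pos)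
    also have "\<dots> \<le> (3 * real g * ln (real s)) * (1 / 48 + 1 / 48 + 1 / 48) + C2 * ?W"
    proof (intro add_mono mult_mono mult_right_mono)
      show "C1 / real K \<le> 1 / 48" using K by (simp add: field_simps)
      show "real g * (2 / 2 ^ k) \<le> 1 / 48" using k by (simp add: field_simps)
      show "real g / real s \<le> 1 / 48" using s'(2,3) by (simp add: field_simps)
      have "?L / ln (real s) * C1 \<le> (3 * real g) * C1"
        using L3 lns0 C10 by (intro mult_right_mono) (auto simp: pos_divide_le_eq)
      then show "real (g * k) * C1 + ?L / ln (real s) * C1 \<le> C2" by (simp add: C2_def)
    qed (use L3 L0 lns0 C10 C20 W0 in auto)
    also have "(3 * real g * ln (real s)) * (1 / 48 + 1 / 48 + 1 / 48) = 3 * (real g * ln (real s)) / 16" by simp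
    finally have "real g / 4 * ln (real s) - real (Suc g) * ln 2 \<le> C2 * ?W"
    proof -
      have "real g * ln (real s) \<ge> 0" using lns0 by simp
      moreover assume "real g / 2 * ln (real s) - real (Suc g) * ln 2 \<le> 3 * (real g * ln (real s)) / 16 + C2 * ?W"
      moreover have "real g / 2 * ln (real s) = (real g * ln (real s)) / 2" "real g / 4 * ln (real s) = (real g * ln (real s)) / 4" by simp_all
      ultimately show ?thesis by linarith
    qed
    then have "(real g / 4 * ln (real s) - real (Suc g) * ln 2) / C2 \<le> ?W"
      using C20 by (simp add: pos_divide_le_eq mult.commute)
    also have "?W \<le> (\<Sum>p\<in>root_primes ?B. ln (real p) / real p) + W0"
    proof -
      have "?W = (\<Sum>p\<in>root_primes ?B. ln (real p) / real p) + (\<Sum>p\<in>primes_le K. ln (real p) / real p)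
         - (\<Sum>p\<in>root_primes ?B \<inter> primes_le K. ln (real p) / real p)"
        by (rule sum_Un) (auto simp: root_primes_def)
      moreover have "(\<Sum>p\<in>root_primes ?B \<inter> primes_le K. ln (real p) / real p) \<ge> 0"
        by (intro sum_nonneg) (auto simp: primes_le_def dest: prime_ge_2_nat)
      ultimately show ?thesis unfolding W0_def by linarith
    qed
    finally show ?thesis by linarith
  qed
  have s0: "s0 \<ge> 2" by (simp add: s0_def)
  \<comment> \<open>For the largest admissible \<open>s\<close>, \<open>n\<close> is at most a
    constant times \<open>s ^ (2 * g)\<close>; so the coefficient \<open>g / 4 / C2\<close> of
    \<open>ln s\<close> becomes \<open>1 / (8 * C2)\<close> for \<open>ln n\<close>.\<close>
  define c where "c = 1 / (8 * C2)"
  define C where "C = c * ln (real (\<beta> * s0 ^ (2 * g))) + c * ln (real (\<beta> * 2 ^ (2 * g))) + real (Suc g) * ln 2 / C2 + W0"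
  have W00: "W0 \<ge> 0" unfolding W0_def by (intro sum_nonneg) (auto simp: primes_le_def dest: prime_ge_2_nat)
  have c0: "c > 0" using C20 by (simp add: c_def)
  have nn: "c * ln (real (\<beta> * s0 ^ (2 * g))) \<ge> 0" "c * ln (real (\<beta> * 2 ^ (2 * g))) \<ge> 0" "real (Suc g) * ln 2 / C2 \<ge> 0"
  proof -
    have lnn: "ln (real n) \<ge> 0" if "n \<ge> 1" for n :: nat using that by simp
    have "\<beta> * s0 ^ (2 * g) \<ge> 1" "\<beta> * 2 ^ (2 * g) \<ge> 1" using beta_pos s0 by simp_all
    then have "ln (real (\<beta> * s0 ^ (2 * g))) \<ge> 0" "ln (real (\<beta> * 2 ^ (2 * g))) \<ge> 0"
      by (blast intro: lnn)+
    then show "c * ln (real (\<beta> * s0 ^ (2 * g))) \<ge> 0" "c * ln (real (\<beta> * 2 ^ (2 * g))) \<ge> 0" using c0 by simp_all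
    show "real (Suc g) * ln 2 / C2 \<ge> 0" using C20 by simp
  qed
  show ?thesis
  proof (rule that[OF c0, of C])
    fix n :: nat assume n: "n \<ge> 1"
    show "(\<Sum>p\<in>root_primes n. ln (real p) / real p) \<ge> c * ln (real n) - C"
    proof (cases "n \<ge> \<beta> * s0 ^ (2 * g)")
      case False
      have "ln (real n) \<le> ln (real (\<beta> * s0 ^ (2 * g)))" using False n by (intro ln_of_nat_mono) auto
      then have "c * ln (real n) \<le> c * ln (real (\<beta> * s0 ^ (2 * g)))" using c0 by simp
      moreover have "(\<Sum>p\<in>root_primes n. ln (real p) / real p) \<ge> 0"
        by (intro sum_nonneg) (auto simp: root_primes_def primes_le_def dest: prime_ge_2_nat)
      ultimately show ?thesis using nn W00 unfolding C_def by linarith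
    next
      case True
      define s where "s = Max {s. \<beta> * s ^ (2 * g) \<le> n}"
      have "s \<le> n" if "\<beta> * s ^ (2 * g) \<le> n" for s
      proof -
        have "s \<le> s ^ (2 * g)" using gpos by (cases "s = 0") (auto intro: self_le_power)
        also have "\<dots> \<le> \<beta> * s ^ (2 * g)" using beta_pos by simp
        finally show ?thesis using that by simp
      qed
      then have "{s. \<beta> * s ^ (2 * g) \<le> n} \<subseteq> {..n}" by blast
      then have fin: "finite {s. \<beta> * s ^ (2 * g) \<le> n}" by (rule finite_subset) simp
      have "s \<in> {s. \<beta> * s ^ (2 * g) \<le> n}" unfolding s_def using fin True by (intro Max_in) auto
      then have sn: "\<beta> * s ^ (2 * g) \<le> n" by simp
      have ss0: "s \<ge> s0" unfolding s_def using fin True by (intro Max_ge) auto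
      have "\<not> \<beta> * Suc s ^ (2 * g) \<le> n" using Max_ge[OF fin, of "Suc s"] unfolding s_def by auto
      moreover have "Suc s ^ (2 * g) \<le> (2 * s) ^ (2 * g)" using ss0 s0 by (intro power_mono) auto
      then have "\<beta> * Suc s ^ (2 * g) \<le> \<beta> * 2 ^ (2 * g) * s ^ (2 * g)"
        by (simp add: power_mult_distrib mult.assoc)
      ultimately have "n \<le> \<beta> * 2 ^ (2 * g) * s ^ (2 * g)" by linarith
      then have "ln (real n) \<le> ln (real (\<beta> * 2 ^ (2 * g) * s ^ (2 * g)))" using n by (intro ln_of_nat_mono) auto
      also have "\<dots> = ln (real (\<beta> * 2 ^ (2 * g))) + 2 * real g * ln (real s)"
        using beta_pos ss0 s0 by (subst ln_of_nat_mult) (auto simp: ln_realpow)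
      finally have "c * ln (real n) \<le> c * ln (real (\<beta> * 2 ^ (2 * g))) + (real g / 4 * ln (real s)) / C2"
        using mult_left_mono[of "ln (real n)" _ c] c0 by (simp add: c_def field_simps)
      moreover have "(\<Sum>p\<in>root_primes n. ln (real p) / real p) \<ge> (\<Sum>p\<in>root_primes (\<beta> * s ^ (2 * g)). ln (real p) / real p)"
        by (rule sum_mono2) (use sn in \<open>auto simp: root_primes_def primes_le_def dest: prime_ge_2_nat\<close>)
      ultimately show ?thesis using step[OF ss0] nn unfolding C_def diff_divide_distrib by linarith
    qed
  qed
qed

end

section \<open>Fields generated by a root\<close>

context number_order begin

text \<open>The field generated by \<gamma>, with integer denominators only;
  \<open>inverse_exists\<close> is what makes it closed under inversion.\<close>

definition Fld :: "complex set" where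
  "Fld = {z. \<exists>a m. m \<noteq> (0::int) \<and> of_int m * z = ev a}"

lemma FldI: "m \<noteq> 0 \<Longrightarrow> of_int m * z = ev a \<Longrightarrow> z \<in> Fld"
  unfolding Fld_def by blast

lemma ev_in_Fld: "ev a \<in> Fld" by (rule FldI[of 1]) auto

lemma Fld_of_int: "of_int c \<in> Fld" using ev_in_Fld[of "[:c:]"] by simp

lemma Fld_0: "0 \<in> Fld" using Fld_of_int[of 0] by simp

lemma Fld_add: assumes "x \<in> Fld" "y \<in> Fld" shows "x + y \<in> Fld"
proof -
  obtain a m b k where *: "m \<noteq> 0" "of_int m * x = ev a" "k \<noteq> 0" "of_int k * y = ev b"
    using assms unfolding Fld_def by blast
  have "of_int (m * k) * (x + y) = of_int k * (of_int m * x) + of_int m * (of_int k * y)"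
    by (simp add: algebra_simps)
  also have "\<dots> = ev (smult k a + smult m b)" using * by simp
  finally show ?thesis by (rule FldI[rotated]) (use * in simp)
qed

lemma Fld_mult: assumes "x \<in> Fld" "y \<in> Fld" shows "x * y \<in> Fld"
proof -
  obtain a m b k where *: "m \<noteq> 0" "of_int m * x = ev a" "k \<noteq> 0" "of_int k * y = ev b"
    using assms unfolding Fld_def by blast
  have "of_int (m * k) * (x * y) = (of_int m * x) * (of_int k * y)" by simp
  also have "\<dots> = ev (a * b)" using * by simp
  finally show ?thesis by (rule FldI[rotated]) (use * in simp)
qed

lemma Fld_uminus: "x \<in> Fld \<Longrightarrow> - x \<in> Fld"
  using Fld_mult[OF Fld_of_int[of "-1"], of x] by simp

lemma Fld_diff: "x \<in> Fld \<Longrightarrow> y \<in> Fld \<Longrightarrow> x - y \<in> Fld"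
  using Fld_add[OF _ Fld_uminus, of x y] by simp

lemma Fld_sum: "(\<And>i. i \<in> A \<Longrightarrow> f i \<in> Fld) \<Longrightarrow> sum f A \<in> Fld"
  by (induction A rule: infinite_finite_induct) (auto intro: Fld_0 Fld_add)

lemma Fld_inverse: assumes "x \<in> Fld" shows "inverse x \<in> Fld"
proof (cases "x = 0")
  case False
  obtain a m where *: "m \<noteq> 0" "of_int m * x = ev a" using assms unfolding Fld_def by blast
  then have "ev a \<noteq> 0" using False by auto
  then obtain b k where bk: "k > 0" "R dvd a * b - [:k:]" using inverse_exists by blast
  then have "ev (a * b - [:k:]) = 0" using ev_eq_0_iff by blast
  then have "of_int k = of_int m * x * ev b" using * by simp
  then have "of_int k * inverse x = ev (smult m b)" using False by (simp add: field_simps)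
  then show ?thesis by (rule FldI[rotated]) (use bk in simp)
qed (simp add: Fld_0)

section \<open>Polynomials over the field\<close>

definition Fld_polys :: "complex poly set" where "Fld_polys = {f. \<forall>i. coeff f i \<in> Fld}"

lemma Fld_poly_const: "c \<in> Fld \<Longrightarrow> [:c:] \<in> Fld_polys"
  by (auto simp: Fld_polys_def coeff_pCons Fld_0 split: nat.splits)

lemma Fld_poly_add: "f \<in> Fld_polys \<Longrightarrow> h \<in> Fld_polys \<Longrightarrow> f + h \<in> Fld_polys" by (simp add: Fld_polys_def Fld_add)
lemma Fld_poly_diff: "f \<in> Fld_polys \<Longrightarrow> h \<in> Fld_polys \<Longrightarrow> f - h \<in> Fld_polys" by (simp add: Fld_polys_def Fld_diff)
lemma Fld_poly_mult: "f \<in> Fld_polys \<Longrightarrow> h \<in> Fld_polys \<Longrightarrow> f * h \<in> Fld_polys" by (simp add: Fld_polys_def coeff_mult Fld_sum Fld_mult)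
lemma Fld_poly_cpoly: "cpoly f \<in> Fld_polys" by (simp add: Fld_polys_def coeff_map_poly Fld_of_int)

lemma Fld_poly_pcompose: "f \<in> Fld_polys \<Longrightarrow> h \<in> Fld_polys \<Longrightarrow> pcompose f h \<in> Fld_polys"
proof (induction f)
  case (pCons a f)
  have all: "coeff (pCons a f) i \<in> Fld" for i using pCons.prems(1) by (simp only: Fld_polys_def mem_Collect_eq)
  have "a \<in> Fld" using all[of 0] by simp
  moreover have "coeff f i \<in> Fld" for i using all[of "Suc i"] by simp
  then have "f \<in> Fld_polys" by (simp add: Fld_polys_def)
  ultimately show ?case using pCons by (auto simp: pcompose_pCons intro!: Fld_poly_add Fld_poly_mult Fld_poly_const)
qed (simp add: Fld_polys_def Fld_0)

lemma Fld_poly_division: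
  assumes "f \<in> Fld_polys" "d \<in> Fld_polys" "d \<noteq> 0"
  shows "\<exists>q\<in>Fld_polys. \<exists>r\<in>Fld_polys. f = q * d + r \<and> (r = 0 \<or> degree r < degree d)"
  using assms(1)
proof (induction "degree f" arbitrary: f rule: less_induct)
  case less
  show ?case
  proof (cases "f = 0 \<or> degree f < degree d")
    case True
    then show ?thesis using less.prems by (intro bexI[of _ 0] bexI[of _ f]) (auto simp: Fld_polys_def Fld_0)
  next
    case False
    define c where "c = lead_coeff f * inverse (lead_coeff d)"
    define h where "h = monom c (degree f - degree d)"
    have cF: "c \<in> Fld" using less.prems assms(2) unfolding c_def Fld_polys_def by (auto intro: Fld_mult Fld_inverse)
    then have hF: "h \<in> Fld_polys" by (simp add: h_def Fld_polys_def Fld_0)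
    have c0: "c \<noteq> 0" using False assms(3) by (simp add: c_def)
    have dh: "degree (h * d) = degree f" using False c0 assms(3) by (simp add: h_def degree_mult_eq degree_monom_eq)
    have lh: "lead_coeff (h * d) = lead_coeff f"
      using assms(3) c0 by (simp add: lead_coeff_mult h_def degree_monom_eq c_def)
    have eq: "coeff (f - h * d) (degree f) = 0" using dh lh by simp
    show ?thesis
    proof (cases "degree f = 0")
      case True
      then have "f = h * d" using eq dh by (metis add_diff_cancel_right' coeff_diff degree_0_id diff_zero eq_iff_diff_eq_0)
      then show ?thesis using hF by (intro bexI[of _ h] bexI[of _ 0]) (auto simp: Fld_polys_def Fld_0)
    next
      case False
      then have "degree (f - h * d) < degree f"
        using dh eq by (intro degree_lessI) (auto simp: coeff_eq_0 le_less)
      moreover have "f - h * d \<in> Fld_polys" using less.prems hF assms(2) by (intro Fld_poly_diff Fld_poly_mult)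
      ultimately obtain q r where "q \<in> Fld_polys" "r \<in> Fld_polys" "f - h * d = q * d + r" "r = 0 \<or> degree r < degree d"
        using less.hyps by blast
      then show ?thesis using hF
        by (intro bexI[of _ "q + h"] bexI[of _ r]) (auto simp: algebra_simps Fld_poly_add)
    qed
  qed
qed

text \<open>A polynomial \<open>d\<close> of least degree over the field vanishing at \<theta>
  divides \<open>f1\<close> and \<open>f2\<close>. Its roots are common roots, hence all equal to
  \<theta>, and a double root is impossible since \<theta> is simple for \<open>f1\<close>. So
  \<open>d\<close> is linear and \<theta> is a quotient of its coefficients.\<close>

lemma common_root_in_Fld:
  assumes f: "f1 \<in> Fld_polys" "f2 \<in> Fld_polys" "f1 \<noteq> 0" "poly f1 \<theta> = 0" "poly f2 \<theta> = 0"
    and simple: "poly (pderiv f1) \<theta> \<noteq> 0"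
    and only: "\<And>\<rho>. poly f1 \<rho> = 0 \<Longrightarrow> poly f2 \<rho> = 0 \<Longrightarrow> \<rho> = \<theta>"
  shows "\<theta> \<in> Fld"
proof -
  obtain d where d: "d \<in> Fld_polys" "d \<noteq> 0" "poly d \<theta> = 0"
    and min: "\<And>h. h \<in> Fld_polys \<Longrightarrow> h \<noteq> 0 \<Longrightarrow> poly h \<theta> = 0 \<Longrightarrow> degree d \<le> degree h"
    using ex_has_least_nat[of "\<lambda>h. h \<in> Fld_polys \<and> h \<noteq> 0 \<and> poly h \<theta> = 0" f1 degree] f by blast
  have dvd: "d dvd h" if h: "h \<in> Fld_polys" "poly h \<theta> = 0" for h
  proof -
    obtain q r where qr: "q \<in> Fld_polys" "r \<in> Fld_polys" "h = q * d + r" "r = 0 \<or> degree r < degree d"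
      using Fld_poly_division[OF h(1) d(1,2)] by blast
    then have "poly r \<theta> = 0" using h d by simp
    then have "r = 0" using min[OF qr(2)] qr(4) by fastforce
    then show ?thesis using qr by simp
  qed
  obtain e where e: "d = [:- \<theta>, 1:] * e" using d(3) by (auto simp: poly_eq_0_iff_dvd)
  have "degree e = 0"
  proof (rule ccontr)
    assume "degree e \<noteq> 0"
    then obtain \<rho> where \<rho>: "poly e \<rho> = 0" using fundamental_theorem_of_algebra[of e] by (auto simp: constant_degree)
    then have "poly d \<rho> = 0" by (simp add: e)
    then have "poly f1 \<rho> = 0" "poly f2 \<rho> = 0" using dvd[OF f(1,4)] dvd[OF f(2,5)] by (auto elim!: dvdE)
    then have "\<rho> = \<theta>" by (rule only)
    then obtain e' where e': "e = [:- \<theta>, 1:] * e'" using \<rho> by (auto simp: poly_eq_0_iff_dvd)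
    obtain q where "f1 = d * q" using dvd f by blast
    then have "f1 = [:- \<theta>, 1:] * ([:- \<theta>, 1:] * (e' * q))" by (simp only: e e' mult.assoc)
    then have "poly (pderiv f1) \<theta> = 0" by (simp only: pderiv_mult) simp
    then show False using simple by simp
  qed
  then obtain c where c: "e = [:c:]" by (auto elim: degree_eq_zeroE)
  have "c \<noteq> 0" using d(2) e c by auto
  have "coeff d 1 = c" "coeff d 0 = - \<theta> * c" by (simp_all add: e c)
  then have "c \<in> Fld" "- \<theta> * c \<in> Fld" using d(1) by (auto simp: Fld_polys_def) metis+
  then have "- (- \<theta> * c * inverse c) \<in> Fld" by (intro Fld_uminus[OF Fld_mult[OF _ Fld_inverse]])
  then show ?thesis using \<open>c \<noteq> 0\<close> by (simp add: field_simps)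
qed

lemma ev_sum: "ev (sum f A) = (\<Sum>x\<in>A. ev (f x))"
  by (induction A rule: infinite_finite_induct) auto

lemma ev_power: "ev (f ^ k) = ev f ^ k"
  by (induction k) auto

text \<open>A root of \<open>R\<close> modulo \<open>p\<close> gives a ring homomorphism from the order to the integers modulo \<open>p\<close>;
  it sends distinct roots of \<open>P\<close> to distinct roots modulo \<open>p\<close>, up to finitely many \<open>p\<close>.\<close>

lemma two_roots_mod:
  assumes \<theta>: "poly (cpoly P) \<theta>1 = 0" "poly (cpoly P) \<theta>2 = 0" "\<theta>1 \<noteq> \<theta>2" "\<theta>1 \<in> Fld" "\<theta>2 \<in> Fld"
  obtains M where "M \<noteq> (0::int)"
    "\<And>p. prime p \<Longrightarrow> \<not> int p dvd M \<Longrightarrow> roots_mod R p \<noteq> {} \<Longrightarrow> card (roots_mod P p) \<ge> 2"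
proof -
  obtain a1 m1 a2 m2 where am: "m1 \<noteq> 0" "of_int m1 * \<theta>1 = ev a1" "m2 \<noteq> 0" "of_int m2 * \<theta>2 = ev a2"
    using \<theta>(4,5) unfolding Fld_def by blast
  define m where "m = m1 * m2"
  define A1 where "A1 = smult m2 a1"
  define A2 where "A2 = smult m1 a2"
  have m0: "m \<noteq> 0" using am by (simp add: m_def)
  have A: "ev A1 = of_int m * \<theta>1" "ev A2 = of_int m * \<theta>2" using am by (simp_all add: A1_def A2_def m_def)
  have "ev (A1 - A2) = of_int m * (\<theta>1 - \<theta>2)" using A by (simp add: algebra_simps)
  then have "ev (A1 - A2) \<noteq> 0" using m0 \<theta>(3) by simp
  then obtain b e where be: "e > 0" "R dvd (A1 - A2) * b - [:e:]" using inverse_exists by blast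
  let ?N = "degree P"
  \<comment> \<open>\<open>m ^ ?N * P(A / m)\<close> with denominators cleared. It vanishes at
    \<gamma> if \<open>A\<close> represents \<open>m\<close> times a root of \<open>P\<close>, and
    is then divisible by \<open>R\<close>.\<close>
  define H where "H A = (\<Sum>i\<le>?N. smult (coeff P i * m ^ (?N - i)) (A ^ i))" for A
  have HR: "R dvd H A" if "ev A = of_int m * \<theta>" "poly (cpoly P) \<theta> = 0" for A \<theta>
  proof -
    have "ev (H A) = (\<Sum>i\<le>?N. of_int m ^ ?N * (of_int (coeff P i) * \<theta> ^ i))"
      unfolding H_def ev_sum
    proof (rule sum.cong[OF refl])
      fix i assume "i \<in> {..?N}"
      then have "of_int m ^ ?N = (of_int m ^ (?N - i) * of_int m ^ i :: complex)" by (simp flip: power_add)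
      then show "ev (smult (coeff P i * m ^ (?N - i)) (A ^ i)) = of_int m ^ ?N * (of_int (coeff P i) * \<theta> ^ i)"
        using that by (simp add: ev_power power_mult_distrib)
    qed
    also have "\<dots> = of_int m ^ ?N * poly (cpoly P) \<theta>"
      by (simp add: poly_altdef sum_distrib_left)
    finally show ?thesis using that ev_eq_0_iff by simp
  qed
  have root: "int p dvd poly P s" if p: "prime p" "\<not> int p dvd m" "r \<in> roots_mod R p"
      and H: "R dvd H A" and s: "[m * s = poly A r] (mod int p)" for p r A s
  proof -
    have "poly R r dvd poly (H A) r" using H by (auto elim!: dvdE)
    then have "int p dvd poly (H A) r" using p by (auto simp: roots_mod_def intro: dvd_trans)
    moreover have "poly (H A) r = (\<Sum>i\<le>?N. coeff P i * m ^ (?N - i) * poly A r ^ i)"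
      by (simp add: H_def poly_sum)
    moreover have "[(\<Sum>i\<le>?N. coeff P i * m ^ (?N - i) * poly A r ^ i) = (\<Sum>i\<le>?N. coeff P i * m ^ (?N - i) * (m * s) ^ i)] (mod int p)"
      using s by (intro cong_sum cong_mult cong_pow cong_refl) (simp add: cong_sym)
    moreover have "(\<Sum>i\<le>?N. coeff P i * m ^ (?N - i) * (m * s) ^ i) = m ^ ?N * poly P s"
      unfolding poly_altdef sum_distrib_left
    proof (rule sum.cong[OF refl])
      fix i assume "i \<in> {..?N}"
      then have "m ^ ?N = m ^ (?N - i) * m ^ i" by (simp flip: power_add)
      then show "coeff P i * m ^ (?N - i) * (m * s) ^ i = m ^ ?N * (coeff P i * s ^ i)"
        by (simp add: power_mult_distrib)
    qed
    ultimately have "int p dvd m ^ ?N * poly P s" using cong_dvd_iff by metis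
    moreover have "prime (int p)" using p by simp
    ultimately show ?thesis using p(2) prime_dvd_mult_iff prime_dvd_power by blast
  qed
  \<comment> \<open>If \<open>p\<close> does not divide \<open>m\<close>, one can divide by
    \<open>m\<close> and obtain roots of \<open>P\<close> modulo \<open>p\<close>; if it does not
    divide \<open>e\<close>, a multiple of \<open>A1 - A2\<close>, the two roots remain
    distinct.\<close>
  show ?thesis
  proof (rule that[of "m * e"])
    show "m * e \<noteq> 0" using m0 be by simp
    fix p assume p: "prime p" "\<not> int p dvd m * e" and ne: "roots_mod R p \<noteq> {}"
    obtain r where r: "r \<in> roots_mod R p" using ne by blast
    have pm: "\<not> int p dvd m" "\<not> int p dvd e" using p(2) by auto
    have "coprime m (int p)" using p(1) pm(1) by (rule coprime_int_if_not_dvd)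
    then obtain u where u: "[m * u = 1] (mod int p)" using cong_solve_coprime_int by blast
    define s where "s A = (u * poly A r) mod int p" for A
    have s: "[m * s A = poly A r] (mod int p)" for A
    proof -
      have "[m * s A = m * (u * poly A r)] (mod int p)" by (simp add: s_def cong_def mod_mult_right_eq)
      also have "m * (u * poly A r) = (m * u) * poly A r" by simp
      also have "[(m * u) * poly A r = 1 * poly A r] (mod int p)" using u by (intro cong_mult) auto
      finally show ?thesis by simp
    qed
    have p0: "int p > 0" using p by (simp add: prime_gt_0_nat)
    have mem: "s A1 \<in> roots_mod P p" "s A2 \<in> roots_mod P p"
      using root[OF p(1) pm(1) r HR[OF A(1) \<theta>(1)] s] root[OF p(1) pm(1) r HR[OF A(2) \<theta>(2)] s] p0
      by (auto simp: roots_mod_def s_def)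
    have "s A1 \<noteq> s A2"
    proof
      assume eq: "s A1 = s A2"
      have "[poly A1 r = poly A2 r] (mod int p)" using s[of A1] s[of A2] eq by (metis cong_sym cong_trans)
      then have "int p dvd poly (A1 - A2) r" by (simp add: cong_iff_dvd_diff)
      then have 1: "int p dvd poly ((A1 - A2) * b) r" by simp
      have "poly R r dvd poly ((A1 - A2) * b - [:e:]) r" using be(2) by (auto elim!: dvdE simp del: poly_diff)
      then have 2: "int p dvd poly ((A1 - A2) * b - [:e:]) r" using r by (auto simp: roots_mod_def intro: dvd_trans)
      have "int p dvd poly ((A1 - A2) * b) r - poly ((A1 - A2) * b - [:e:]) r" using 1 2 by (rule dvd_diff)
      then show False using pm(2) by simp
    qed
    then have "card {s A1, s A2} = 2" by simp
    moreover have "card {s A1, s A2} \<le> card (roots_mod P p)" using mem by (intro card_mono) auto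
    ultimately show "card (roots_mod P p) \<ge> 2" by simp
  qed
qed

end

text \<open>With \<open>b\<close> the leading coefficient of \<open>P\<close>, the polynomial \<open>R(T) = b^(g - 1) P(T / b)\<close> is monic.\<close>

lemma scale_to_number_order:
  fixes P :: "int poly"
  assumes P: "degree P = g" "g > 0" "poly (cpoly P) z = 0"
    and min: "\<And>f. f \<noteq> 0 \<Longrightarrow> poly (cpoly f) z = 0 \<Longrightarrow> g \<le> degree f"
  obtains R where "number_order (of_int (lead_coeff P) * z) R g"
    "\<And>x. poly R (lead_coeff P * x) = lead_coeff P ^ (g - 1) * poly P x"
proof -
  define b where "b = lead_coeff P"
  have b0: "b \<noteq> 0" using P by (auto simp: b_def)
  \<comment> \<open>The leading term is written separately: at \<open>i = g\<close> the natural
    subtraction \<open>g - 1 - i\<close> would give 0 instead of -1.\<close>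
  define R where "R = (\<Sum>i<g. monom (coeff P i * b ^ (g - 1 - i)) i) + monom 1 g"
  have cR: "coeff R i = (if i < g then coeff P i * b ^ (g - 1 - i) else if i = g then 1 else 0)" for i
    by (auto simp: R_def coeff_sum)
  have bc: "b ^ i * coeff R i = b ^ (g - 1) * coeff P i" for i
  proof -
    consider "i < g" | "i = g" | "i > g" by linarith
    then show ?thesis
    proof cases
      case 1
      then have "b ^ i * b ^ (g - 1 - i) = b ^ (g - 1)" by (simp flip: power_add)
      then show ?thesis using 1 by (simp add: cR mult.left_commute)
    next
      case 2
      then have "b ^ i = b ^ (g - 1) * b" using P(2) by (metis Suc_diff_1 power_Suc2)
      then show ?thesis using 2 P(1) by (simp add: cR b_def)
    next
      case 3
      then show ?thesis using P(1) by (simp add: cR coeff_eq_0)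
    qed
  qed
  have dR: "degree R = g"
    by (rule antisym[OF degree_le le_degree]) (auto simp: cR)
  have eq: "pcompose R [:0, b:] = smult (b ^ (g - 1)) P"
    by (rule poly_eqI) (simp add: coeff_pcompose_linear bc)
  have ceq: "pcompose (cpoly f) [:0, of_int b:] = cpoly (pcompose f [:0, b:])" for f
    by (rule poly_eqI) (simp add: coeff_pcompose_linear coeff_map_poly)
  have ev: "poly (cpoly f) (of_int b * z) = poly (cpoly (pcompose f [:0, b:])) z" for f
    by (simp add: ceq[symmetric] poly_pcompose mult.commute)
  have "number_order (of_int b * z) R g"
  proof
    show "lead_coeff R = 1" "degree R = g" "0 < g" using dR P(2) by (simp_all add: cR)
    show "poly (cpoly R) (of_int b * z) = 0"
      unfolding ev eq using P(3) by (simp add: hom_distribs)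
    fix f assume f: "f \<noteq> 0" "poly (cpoly f) (of_int b * z) = 0"
    have "pcompose f [:0, b:] \<noteq> 0" using f(1) b0 by (simp add: pcompose_eq_0_iff)
    then have "g \<le> degree (pcompose f [:0, b:])" using f(2) unfolding ev by (intro min)
    then show "g \<le> degree f" using b0 by (simp add: degree_pcompose)
  qed
  moreover have "poly R (b * x) = b ^ (g - 1) * poly P x" for x
  proof -
    have "poly R (b * x) = poly (pcompose R [:0, b:]) x" by (simp add: poly_pcompose mult.commute)
    then show ?thesis by (simp add: eq)
  qed
  ultimately show ?thesis using that unfolding b_def by blast
qed

section \<open>Primes without a root\<close>

text \<open>For positive \<open>N\<close> this is irreducibility over the rationals, phrased as the
  minimality that \<open>number_order\<close> requires; the content of \<open>P\<close> is not
  restricted.\<close>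

definition irreducible_of_degree :: "nat \<Rightarrow> int poly \<Rightarrow> bool" where
  "irreducible_of_degree N P \<longleftrightarrow> degree P = N \<and>
     (\<forall>z f. poly (cpoly P) z = 0 \<longrightarrow> f \<noteq> 0 \<longrightarrow> poly (cpoly f) z = 0 \<longrightarrow> N \<le> degree f)"

text \<open>The rational span of the products \<theta>1\<open>^i\<close> \<theta>2\<open>^j\<close>
  with \<open>i, j < N\<close> is finite-dimensional and stable under multiplication by both roots.
  It contains all powers of the combination, which must therefore be dependent.\<close>

lemma algebraic_combination:
  fixes P :: "int poly" and \<theta>1 \<theta>2 :: complex
  assumes P: "degree P > 0" "poly (cpoly P) \<theta>1 = 0" "poly (cpoly P) \<theta>2 = 0"
  shows "algebraic (\<theta>1 + of_nat k * \<theta>2)"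
proof -
  interpret V: vector_space "\<lambda>(q::rat) (z::complex). of_rat q * z"
    by unfold_locales (auto simp: algebra_simps of_rat_add of_rat_mult)
  define N where "N = degree P"
  define b where "b = lead_coeff P"
  have b0: "b \<noteq> 0" using P by (auto simp: b_def)
  define B where "B = (\<lambda>(i, j). \<theta>1 ^ i * \<theta>2 ^ j) ` ({..<N} \<times> {..<N})"
  have finB: "finite B" by (simp add: B_def)
  have base: "\<theta>1 ^ i * \<theta>2 ^ j \<in> V.span B" if "i < N" "j < N" for i j
    by (rule V.span_base) (use that in \<open>auto simp: B_def\<close>)
  have red: "\<theta> ^ N = (\<Sum>l<N. of_rat (- of_int (coeff P l) / of_int b) * \<theta> ^ l)" if "poly (cpoly P) \<theta> = 0" for \<theta>
  proof -
    have "0 = (\<Sum>l\<le>N. of_int (coeff P l) * \<theta> ^ l)" using that by (simp add: poly_altdef N_def)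
    also have "\<dots> = (\<Sum>l<N. of_int (coeff P l) * \<theta> ^ l) + of_int b * \<theta> ^ N"
      by (simp add: b_def N_def lessThan_Suc_atMost[symmetric])
    finally have "of_int b * \<theta> ^ N = - (\<Sum>l<N. of_int (coeff P l) * \<theta> ^ l)" by (simp add: eq_neg_iff_add_eq_0 add.commute)
    then have "\<theta> ^ N = - (\<Sum>l<N. of_int (coeff P l) * \<theta> ^ l) / of_int b" using b0 by (simp add: field_simps)
    also have "\<dots> = (\<Sum>l<N. of_rat (- of_int (coeff P l) / of_int b) * \<theta> ^ l)"
      by (simp add: sum_divide_distrib sum_negf[symmetric] of_rat_divide of_rat_minus)
    finally show ?thesis .
  qed
  have mult1: "\<theta>1 * z \<in> V.span B" if "z \<in> V.span B" for z
    using that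
  proof (induction rule: V.span_induct_alt)
    case base then show ?case by (simp add: V.span_zero)
  next
    case (step c x y)
    obtain i j where ij: "x = \<theta>1 ^ i * \<theta>2 ^ j" "i < N" "j < N" using step.hyps by (auto simp: B_def)
    have "\<theta>1 * x \<in> V.span B"
    proof (cases "Suc i < N")
      case True
      then have "\<theta>1 ^ Suc i * \<theta>2 ^ j \<in> V.span B" using ij base by blast
      then show ?thesis by (simp add: ij mult.assoc)
    next
      case False
      then have "Suc i = N" using ij by simp
      then have "\<theta>1 * x = \<theta>1 ^ N * \<theta>2 ^ j" using ij by (metis mult.assoc power_Suc)
      also have "\<dots> = (\<Sum>l<N. of_rat (- of_int (coeff P l) / of_int b) * (\<theta>1 ^ l * \<theta>2 ^ j))"
        unfolding red[OF P(2)] by (simp add: sum_distrib_right mult.assoc)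
      also have "\<dots> \<in> V.span B" by (intro V.span_sum V.span_scale base) (use ij in auto)
      finally show ?thesis .
    qed
    then have "of_rat c * (\<theta>1 * x) + \<theta>1 * y \<in> V.span B" using step.IH by (intro V.span_add V.span_scale)
    then show ?case by (simp add: algebra_simps)
  qed
  have mult2: "\<theta>2 * z \<in> V.span B" if "z \<in> V.span B" for z
    using that
  proof (induction rule: V.span_induct_alt)
    case base then show ?case by (simp add: V.span_zero)
  next
    case (step c x y)
    obtain i j where ij: "x = \<theta>1 ^ i * \<theta>2 ^ j" "i < N" "j < N" using step.hyps by (auto simp: B_def)
    have "\<theta>2 * x \<in> V.span B"
    proof (cases "Suc j < N")
      case True
      then have "\<theta>1 ^ i * \<theta>2 ^ Suc j \<in> V.span B" using ij base by blast
      then show ?thesis by (simp add: ij mult_ac)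
    next
      case False
      then have "Suc j = N" using ij by simp
      then have "\<theta>2 * x = \<theta>1 ^ i * \<theta>2 ^ N" using ij by (metis mult.left_commute power_Suc)
      also have "\<dots> = (\<Sum>l<N. of_rat (- of_int (coeff P l) / of_int b) * (\<theta>1 ^ i * \<theta>2 ^ l))"
        unfolding red[OF P(3)] by (simp add: sum_distrib_left mult_ac)
      also have "\<dots> \<in> V.span B" by (intro V.span_sum V.span_scale base) (use ij in auto)
      finally show ?thesis .
    qed
    then have "of_rat c * (\<theta>2 * x) + \<theta>2 * y \<in> V.span B" using step.IH by (intro V.span_add V.span_scale)
    then show ?case by (simp add: algebra_simps)
  qed
  define \<gamma> where "\<gamma> = \<theta>1 + of_nat k * \<theta>2"
  have pow: "\<gamma> ^ l \<in> V.span B" for l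
  proof (induction l)
    case 0
    show ?case using base[of 0 0] P(1) by (simp add: N_def)
  next
    case (Suc l)
    have "\<theta>1 * \<gamma> ^ l + of_rat (of_nat k) * (\<theta>2 * \<gamma> ^ l) \<in> V.span B"
      using Suc by (intro V.span_add V.span_scale mult1 mult2)
    then show ?case by (simp add: \<gamma>_def algebra_simps)
  qed
  show ?thesis
  \<comment> \<open>Linear dependence concerns a set of vectors, so the case of coinciding powers is
    treated first; it gives an equation of its own.\<close>
  proof (cases "inj_on (\<lambda>l. \<gamma> ^ l) {..card B}")
    case False
    then obtain i j where ij: "i \<noteq> j" "\<gamma> ^ i = \<gamma> ^ j" unfolding inj_on_def by blast
    have "monom 1 i - monom (1::complex) j \<noteq> 0"
      using ij(1) by (metis coeff_diff coeff_monom diff_0_right coeff_0 zero_neq_one)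
    moreover have "poly (monom 1 i - monom (1::complex) j) \<gamma> = 0" using ij(2) by (simp add: poly_monom)
    ultimately show ?thesis unfolding \<gamma>_def[symmetric] by (intro algebraicI'[of "monom 1 i - monom 1 j"]) auto
  next
    case True
    let ?S = "(\<lambda>l. \<gamma> ^ l) ` {..card B}"
    have "card ?S = Suc (card B)" using True by (simp add: card_image)
    then have "V.dependent ?S" using V.independent_span_bound[OF finB, of ?S] pow by fastforce
    then obtain u where u: "\<exists>v\<in>?S. u v \<noteq> 0" "(\<Sum>v\<in>?S. of_rat (u v) * v) = 0"
      using V.dependent_finite[of ?S] by auto
    define f where "f = (\<Sum>l\<le>card B. monom (of_rat (u (\<gamma> ^ l))) l :: complex poly)"
    have cf: "coeff f l = (if l \<le> card B then of_rat (u (\<gamma> ^ l)) else 0)" for l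
      by (simp add: f_def coeff_sum)
    have "f \<noteq> 0"
    proof -
      obtain l where "l \<le> card B" "u (\<gamma> ^ l) \<noteq> 0" using u(1) by auto
      then have "coeff f l \<noteq> 0" by (simp add: cf)
      then show ?thesis by auto
    qed
    moreover have "poly f \<gamma> = 0"
      using u(2) True by (simp add: f_def poly_sum poly_monom sum.reindex)
    moreover have "coeff f l \<in> \<rat>" for l by (simp add: cf)
    ultimately show ?thesis unfolding \<gamma>_def[symmetric] by (intro algebraicI'[of f])
  qed
qed

lemma irreducible_simple_root:
  assumes "irreducible_of_degree N P" "N > 0" "poly (cpoly P) z = 0"
  shows "poly (pderiv (cpoly P)) z \<noteq> 0"
proof
  assume 0: "poly (pderiv (cpoly P)) z = 0"
  have "pderiv (cpoly P) = cpoly (pderiv P)"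
    by (rule poly_eqI) (simp add: coeff_pderiv coeff_map_poly)
  moreover have "pderiv P \<noteq> 0" using assms by (auto simp: pderiv_eq_0_iff irreducible_of_degree_def)
  ultimately have "N \<le> degree (pderiv P)" using assms 0 unfolding irreducible_of_degree_def by metis
  then show False using assms by (simp add: degree_pderiv irreducible_of_degree_def)
qed

text \<open>For suitable \<open>k\<close> the element \<gamma> = \<theta>1 + \<open>k\<close>
  \<theta>2 generates a field containing both roots: \<theta>2 is the only common root of
  \<open>P(T)\<close> and \<open>P(\<gamma> - k * T)\<close>, and \<theta>1 is then a
  difference.\<close>

lemma primitive_element:
  assumes P: "irreducible_of_degree N P" "N \<ge> 2"
  obtains \<delta> R g \<theta>1 \<theta>2 where "number_order \<delta> R g" "poly (cpoly P) \<theta>1 = 0" "poly (cpoly P) \<theta>2 = 0"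
    "\<theta>1 \<noteq> \<theta>2" "\<theta>1 \<in> number_order.Fld \<delta>" "\<theta>2 \<in> number_order.Fld \<delta>"
proof -
  have dP: "degree P = N" using P by (simp add: irreducible_of_degree_def)
  have dcP: "degree (cpoly P) = N" using dP by simp
  have P0: "cpoly P \<noteq> 0" using dcP P(2) by auto
  obtain \<theta>1 where t1: "poly (cpoly P) \<theta>1 = 0"
    using fundamental_theorem_of_algebra[of "cpoly P"] dcP P(2) by (auto simp: constant_degree)
  then obtain e where e: "cpoly P = [:- \<theta>1, 1:] * e" by (auto simp: poly_eq_0_iff_dvd)
  have e0: "e \<noteq> 0" using e P0 by auto
  have "degree (cpoly P) = 1 + degree e" unfolding e using e0 by (subst degree_mult_eq) auto
  then have "degree e \<noteq> 0" using dcP P(2) by simp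
  then obtain \<theta>2 where t2: "poly e \<theta>2 = 0"
    using fundamental_theorem_of_algebra[of e] by (auto simp: constant_degree)
  then have t2': "poly (cpoly P) \<theta>2 = 0" by (simp add: e)
  have ne: "\<theta>1 \<noteq> \<theta>2"
  proof
    assume "\<theta>1 = \<theta>2"
    then have "poly e \<theta>1 = 0" using t2 by simp
    then have "poly (pderiv (cpoly P)) \<theta>1 = 0" unfolding e pderiv_mult by (simp add: pderiv_pCons)
    then show False using irreducible_simple_root[OF P(1) _ t1] P(2) by simp
  qed
  \<comment> \<open>The \<open>k\<close> for which some other root \<rho> of \<open>P\<close> would
    satisfy \<gamma> - \<open>k\<close> \<rho> = \<tau> with \<tau> a root. Division by zero at
    \<rho> = \<theta>2 yields 0 and merely excludes \<open>k = 0\<close>.\<close>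
  define bad where "bad = (\<lambda>(\<tau>, \<rho>). (\<tau> - \<theta>1) / (\<theta>2 - \<rho>)) ` ({x. poly (cpoly P) x = 0} \<times> {x. poly (cpoly P) x = 0})"
  have "finite bad" unfolding bad_def using poly_roots_finite[OF P0] by simp
  moreover have "infinite (range (of_nat :: nat \<Rightarrow> complex))" by (simp add: range_inj_infinite inj_of_nat)
  ultimately obtain k :: nat where k: "of_nat k \<notin> bad" by (metis finite_subset image_subsetI)
  define \<gamma> where "\<gamma> = \<theta>1 + of_nat k * \<theta>2"
  have "algebraic \<gamma>" unfolding \<gamma>_def using dP P(2) t1 t2' by (intro algebraic_combination[of P]) auto
  then obtain f0 :: "int poly" where f0: "f0 \<noteq> 0" "poly (cpoly f0) \<gamma> = 0"
    by (auto elim: algebraicE')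
  obtain f where f: "f \<noteq> 0" "poly (cpoly f) \<gamma> = 0"
    and fmin: "\<And>h. h \<noteq> 0 \<Longrightarrow> poly (cpoly h) \<gamma> = 0 \<Longrightarrow> degree f \<le> degree h"
    using ex_has_least_nat[of "\<lambda>h. h \<noteq> 0 \<and> poly (cpoly h) \<gamma> = 0" f0 degree] f0 by blast
  have fpos: "degree f > 0"
  proof (rule ccontr)
    assume "\<not> degree f > 0"
    then obtain c where "f = [:c:]" by (auto elim: degree_eq_zeroE)
    then show False using f by (simp add: map_poly_pCons)
  qed
  define b where "b = lead_coeff f"
  have b0: "b \<noteq> 0" using f by (simp add: b_def)
  obtain R where R: "number_order (of_int b * \<gamma>) R (degree f)"
    using scale_to_number_order[OF refl fpos f(2) fmin] unfolding b_def by blast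
  interpret K: number_order "of_int b * \<gamma>" R "degree f" by (rule R)
  have \<gamma>F: "\<gamma> \<in> K.Fld" by (rule K.FldI[OF b0, of _ "[:0, 1:]"]) simp
  have kF: "of_nat k \<in> K.Fld" using K.Fld_of_int[of "int k"] by simp
  have t2F: "\<theta>2 \<in> K.Fld"
  proof (rule K.common_root_in_Fld[of "cpoly P" "pcompose (cpoly P) [:\<gamma>, - of_nat k:]"])
    show "cpoly P \<in> K.Fld_polys" by (rule K.Fld_poly_cpoly)
    show "pcompose (cpoly P) [:\<gamma>, - of_nat k:] \<in> K.Fld_polys"
      using \<gamma>F K.Fld_uminus[OF kF]
      by (intro K.Fld_poly_pcompose K.Fld_poly_cpoly) (auto simp: K.Fld_polys_def coeff_pCons K.Fld_0 split: nat.splits)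
    show "poly (pcompose (cpoly P) [:\<gamma>, - of_nat k:]) \<theta>2 = 0"
      using t1 by (simp add: poly_pcompose \<gamma>_def mult.commute)
    show "poly (pderiv (cpoly P)) \<theta>2 \<noteq> 0" using irreducible_simple_root[OF P(1) _ t2'] P(2) by simp
    fix \<rho> assume \<rho>: "poly (cpoly P) \<rho> = 0" "poly (pcompose (cpoly P) [:\<gamma>, - of_nat k:]) \<rho> = 0"
    define \<tau> where "\<tau> = \<gamma> - of_nat k * \<rho>"
    have \<tau>: "poly (cpoly P) \<tau> = 0" using \<rho>(2) by (simp add: poly_pcompose \<tau>_def mult.commute)
    show "\<rho> = \<theta>2"
    proof (rule ccontr)
      assume "\<rho> \<noteq> \<theta>2"
      then have "of_nat k = (\<tau> - \<theta>1) / (\<theta>2 - \<rho>)" by (simp add: \<tau>_def \<gamma>_def field_simps)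
      then have "of_nat k \<in> bad" unfolding bad_def using \<tau> \<rho>(1) by force
      then show False using k by simp
    qed
  qed (use P0 t2' in auto)
  have "\<theta>1 = \<gamma> - of_nat k * \<theta>2" by (simp add: \<gamma>_def)
  then have "\<theta>1 \<in> K.Fld" using K.Fld_diff[OF \<gamma>F K.Fld_mult[OF kF t2F]] by simp
  then show ?thesis using that[OF R t1 t2' ne] t2F by blast
qed

lemma sum_subset_primes_dividing_le:
  assumes M: "M \<noteq> (0::int)"
  obtains C where "C \<ge> 0" "\<And>n. (\<Sum>p\<in>{p\<in>primes_le n. int p dvd M}. ln (real p) / real p) \<le> C"
proof
  let ?F = "{p. prime p \<and> int p dvd M}"
  have pos: "ln (real p) / real p \<ge> 0" for p by (cases "p = 0") auto
  have "?F \<subseteq> {..nat \<bar>M\<bar>}" using M by (auto dest: dvd_imp_le_int)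
  then have fin: "finite ?F" by (rule finite_subset) simp
  show "(\<Sum>p\<in>?F. ln (real p) / real p) \<ge> 0" by (intro sum_nonneg pos)
  fix n
  show "(\<Sum>p\<in>{p\<in>primes_le n. int p dvd M}. ln (real p) / real p) \<le> (\<Sum>p\<in>?F. ln (real p) / real p)"
    by (rule sum_mono2[OF fin]) (auto intro: pos dest: primes_le_D)
qed

text \<open>The condition on the leading coefficient excludes a zero at infinity modulo
  \<open>p\<close>.\<close>

definition rootless_primes :: "int poly \<Rightarrow> nat set" where
  "rootless_primes P = {p. prime p \<and> \<not> int p dvd lead_coeff P \<and> roots_mod P p = {}}"

text \<open>The number of roots of \<open>P\<close> modulo \<open>p\<close> is at most \<open>1\<close> on average, but at least \<open>2\<close> for a positive proportion
  of the primes; so it must vanish for a positive proportion of the primes.\<close>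

lemma rootless_primes_dense:
  assumes P: "irreducible_of_degree N P" "N \<ge> 2"
  obtains c C where "0 < c" "c < 1"
    "\<And>n. n \<ge> 1 \<Longrightarrow> (\<Sum>p\<in>{p\<in>rootless_primes P. p \<le> n}. ln (real p) / real p) \<ge> c * ln (real n) - C"
proof -
  let ?w = "\<lambda>p. ln (real p) / real p"
  have wpos: "?w p \<ge> 0" for p by (cases "p = 0") auto
  obtain \<delta> R g \<theta>1 \<theta>2 where K: "number_order \<delta> R g" "poly (cpoly P) \<theta>1 = 0" "poly (cpoly P) \<theta>2 = 0"
    "\<theta>1 \<noteq> \<theta>2" "\<theta>1 \<in> number_order.Fld \<delta>" "\<theta>2 \<in> number_order.Fld \<delta>"
    using primitive_element[OF P] by blast
  obtain M where M: "M \<noteq> 0" "\<And>p. prime p \<Longrightarrow> \<not> int p dvd M \<Longrightarrow> roots_mod R p \<noteq> {} \<Longrightarrow> card (roots_mod P p) \<ge> 2"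
    using number_order.two_roots_mod[OF K] by blast
  obtain c C1 where c: "c > 0" "\<And>n. n \<ge> 1 \<Longrightarrow> (\<Sum>p\<in>number_order.root_primes R n. ?w p) \<ge> c * ln (real n) - C1"
    using number_order.sum_root_primes_lower[OF K(1)] by blast
  have dP: "degree P = N" using P by (simp add: irreducible_of_degree_def)
  define b where "b = lead_coeff P"
  have b0: "b \<noteq> 0" using dP P(2) by (auto simp: b_def)
  have min: "\<And>f. f \<noteq> 0 \<Longrightarrow> poly (cpoly f) \<theta>1 = 0 \<Longrightarrow> N \<le> degree f"
    using P(1) K(2) unfolding irreducible_of_degree_def by blast
  have N0: "N > 0" using P(2) by simp
  obtain R' where R': "number_order (of_int b * \<theta>1) R' N" "\<And>x. poly R' (b * x) = b ^ (N - 1) * poly P x"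
    using scale_to_number_order[OF dP N0 K(2) min] unfolding b_def by blast
  \<comment> \<open>At most half of \<open>c\<close>, so that \<open>c - \<eta> \<ge> \<eta>\<close>
    in the final balance; the 1/2 keeps it below 1.\<close>
  define \<eta> where "\<eta> = min (c / 2) (1 / 2)"
  have \<eta>: "\<eta> > 0" "\<eta> \<le> c / 2" "\<eta> < 1" using c by (auto simp: \<eta>_def)
  obtain C2 where C2: "\<And>n. n \<ge> 1 \<Longrightarrow> (\<Sum>p\<in>primes_le n. real (card (roots_mod R' p)) * ?w p) \<le> (1 + \<eta>) * ln (real n) + C2"
    using number_order.sum_roots_mod_upper[OF R'(1) \<eta>(1)] by blast
  obtain C3 where C3: "\<And>n. n \<ge> 1 \<Longrightarrow> (\<Sum>p\<in>primes_le n. ?w p) \<ge> ln (real n) - C3"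
    using mertens_lower by blast
  obtain C4 where C4: "C4 \<ge> 0" "\<And>n. (\<Sum>p\<in>{p\<in>primes_le n. int p dvd b * M}. ?w p) \<le> C4"
    using sum_subset_primes_dividing_le[of "b * M"] b0 M(1) by auto
  \<comment> \<open>Multiplication by \<open>b\<close> maps roots of \<open>P\<close> to roots of
    the monic \<open>R'\<close> and is injective modulo \<open>p\<close>. This transfers the average
    for \<open>R'\<close> to \<open>P\<close>.\<close>
  have cardle: "card (roots_mod P p) \<le> card (roots_mod R' p)" if p: "prime p" "\<not> int p dvd b" for p
  proof (rule card_inj_on_le[of "\<lambda>r. (b * r) mod int p"])
    have pr: "prime (int p)" and p0: "int p > 0" using p by (auto simp: prime_gt_0_nat)
    show "inj_on (\<lambda>r. (b * r) mod int p) (roots_mod P p)"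
    proof (rule inj_onI)
      fix r s assume rs: "r \<in> roots_mod P p" "s \<in> roots_mod P p" "(b * r) mod int p = (b * s) mod int p"
      then have "int p dvd b * r - b * s" by (simp add: mod_eq_dvd_iff)
      then have "int p dvd b * (r - s)" by (simp add: algebra_simps)
      then have "int p dvd r - s" using pr p(2) by (simp add: prime_dvd_mult_iff)
      then have "r mod int p = s mod int p" by (simp add: mod_eq_dvd_iff)
      then show "r = s" using rs by (auto simp: roots_mod_def)
    qed
    show "(\<lambda>r. (b * r) mod int p) ` roots_mod P p \<subseteq> roots_mod R' p"
    proof clarify
      fix r assume r: "r \<in> roots_mod P p"
      have "[b * r mod int p = b * r] (mod int p)" by (simp add: cong_def)
      then have "[poly R' (b * r mod int p) = poly R' (b * r)] (mod int p)" by (simp add: poly_altdef cong_sum cong_mult cong_pow)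
      moreover have "int p dvd poly R' (b * r)" unfolding R'(2) using r by (simp add: roots_mod_def)
      ultimately have "int p dvd poly R' (b * r mod int p)" using cong_dvd_iff by blast
      then show "b * r mod int p \<in> roots_mod R' p" using p0 by (simp add: roots_mod_def)
    qed
  qed simp
  show ?thesis
  proof (rule that[of \<eta> "C1 + C2 + C3 + 2 * C4"])
    fix n :: nat assume n: "n \<ge> 1"
    \<comment> \<open>Omitting the finitely many primes that divide \<open>b * M\<close> changes
      each sum by at most \<open>C4\<close>.\<close>
    define E where "E = {p\<in>primes_le n. \<not> int p dvd b * M}"
    have finE: "finite E" by (simp add: E_def)
    have Ed: "prime p" "\<not> int p dvd b" "\<not> int p dvd M" "p \<le> n" if "p \<in> E" for p
      using that by (auto simp: E_def dest: primes_le_D)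
    let ?N = "\<lambda>p. real (card (roots_mod P p))"
    have upper: "(\<Sum>p\<in>E. ?N p * ?w p) \<le> (1 + \<eta>) * ln (real n) + C2"
    proof -
      have "(\<Sum>p\<in>E. ?N p * ?w p) \<le> (\<Sum>p\<in>E. real (card (roots_mod R' p)) * ?w p)"
        using cardle Ed wpos by (intro sum_mono mult_right_mono) (auto simp del: of_nat_mult)
      also have "\<dots> \<le> (\<Sum>p\<in>primes_le n. real (card (roots_mod R' p)) * ?w p)"
      proof (rule sum_mono2)
        show "0 \<le> real (card (roots_mod R' p)) * ?w p" for p by (rule mult_nonneg_nonneg[OF _ wpos]) simp
      qed (auto simp: E_def)
      also have "\<dots> \<le> (1 + \<eta>) * ln (real n) + C2" by (rule C2[OF n])
      finally show ?thesis .
    qed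
    have split: "(\<Sum>p\<in>F. ?w p) \<le> (\<Sum>p\<in>F \<inter> E. ?w p) + C4" if F: "F \<subseteq> primes_le n" for F
    proof -
      have "F = (F \<inter> E) \<union> (F - E)" by auto
      then have "(\<Sum>p\<in>F. ?w p) = (\<Sum>p\<in>F \<inter> E. ?w p) + (\<Sum>p\<in>F - E. ?w p)"
        using F finite_subset[OF F] sum.union_disjoint[of "F \<inter> E" "F - E" ?w] by auto
      moreover have "(\<Sum>p\<in>F - E. ?w p) \<le> (\<Sum>p\<in>{p\<in>primes_le n. int p dvd b * M}. ?w p)"
        using F by (intro sum_mono2) (auto simp: E_def intro: wpos)
      ultimately show ?thesis using C4(2)[of n] by linarith
    qed
    have lower: "(\<Sum>p\<in>E. ?w p) \<ge> ln (real n) - C3 - C4"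
      using split[of "primes_le n"] C3[OF n] by (simp add: E_def Int_def cong: conj_cong)
    define E2 where "E2 = number_order.root_primes R n \<inter> E"
    have rp: "number_order.root_primes R n \<subseteq> primes_le n"
      by (auto simp: number_order.root_primes_def[OF K(1)])
    have E2: "(\<Sum>p\<in>E2. ?w p) \<ge> c * ln (real n) - C1 - C4"
      using split[OF rp] c(2)[OF n] by (simp add: E2_def)
    have E2N: "?N p \<ge> 2" if "p \<in> E2" for p
    proof -
      have "roots_mod R p \<noteq> {}" using that by (auto simp: E2_def number_order.root_primes_def[OF K(1)])
      then have "card (roots_mod P p) \<ge> 2" using M(2) Ed that by (auto simp: E2_def)
      then show ?thesis by simp
    qed
    let ?Q = "{p\<in>rootless_primes P. p \<le> n}"
    \<comment> \<open>Term by term: the number of roots minus 1 is at least 1 on \<open>E2\<close>,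
      equals -1 at the rootless primes, and is non-negative elsewhere.\<close>
    have "(\<Sum>p\<in>E2. ?w p) - (\<Sum>p\<in>E \<inter> ?Q. ?w p) \<le> (\<Sum>p\<in>E. (?N p - 1) * ?w p)"
    proof -
      have "(\<Sum>p\<in>E2. ?w p) - (\<Sum>p\<in>E \<inter> ?Q. ?w p) = (\<Sum>p\<in>E. (if p \<in> E2 then ?w p else 0) - (if p \<in> ?Q then ?w p else 0))"
      proof -
        have "(\<Sum>p\<in>E. if p \<in> E2 then ?w p else 0) = (\<Sum>p\<in>E2. ?w p)"
          using finE by (subst sum.inter_restrict[symmetric]) (auto simp: E2_def Int_ac)
        moreover have "(\<Sum>p\<in>E. if p \<in> ?Q then ?w p else 0) = (\<Sum>p\<in>E \<inter> ?Q. ?w p)"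
          using finE by (subst sum.inter_restrict[symmetric]) auto
        ultimately show ?thesis by (simp only: sum_subtractf)
      qed
      also have "\<dots> \<le> (\<Sum>p\<in>E. (?N p - 1) * ?w p)"
      proof (rule sum_mono)
        fix p assume p: "p \<in> E"
        consider "p \<in> E2" | "p \<notin> E2" "?N p \<ge> 1" | "?N p = 0" by (cases "card (roots_mod P p)") auto
        then show "(if p \<in> E2 then ?w p else 0) - (if p \<in> ?Q then ?w p else 0) \<le> (?N p - 1) * ?w p"
        proof cases
          case 1
          then have "1 * ?w p \<le> (?N p - 1) * ?w p" using E2N[OF 1] wpos by (intro mult_right_mono) auto
          moreover have "(if p \<in> ?Q then ?w p else 0) \<ge> 0" using wpos by auto
          ultimately show ?thesis using 1 by simp
        next
          case 2
          then have "0 \<le> (?N p - 1) * ?w p" using wpos by (intro mult_nonneg_nonneg) auto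
          moreover have "(if p \<in> ?Q then ?w p else 0) \<ge> 0" using wpos by auto
          ultimately show ?thesis using 2 by simp
        next
          case 3
          then have "roots_mod P p = {}" by simp
          then have "p \<in> ?Q" using Ed[OF p] by (simp add: rootless_primes_def b_def)
          moreover have "p \<notin> E2" using E2N[of p] 3 by auto
          ultimately show ?thesis using 3 by simp
        qed
      qed
      finally show ?thesis .
    qed
    also have "(\<Sum>p\<in>E. (?N p - 1) * ?w p) = (\<Sum>p\<in>E. ?N p * ?w p) - (\<Sum>p\<in>E. ?w p)"
      by (simp only: left_diff_distrib sum_subtractf mult_1)
    also have "\<dots> \<le> \<eta> * ln (real n) + C2 + C3 + C4" using upper lower by (simp add: algebra_simps)
    finally have "(\<Sum>p\<in>E \<inter> ?Q. ?w p) \<ge> (c - \<eta>) * ln (real n) - (C1 + C2 + C3 + 2 * C4)"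
      using E2 by (simp add: algebra_simps)
    moreover have "(c - \<eta>) * ln (real n) \<ge> \<eta> * ln (real n)" using \<eta> n by (intro mult_right_mono) auto
    moreover have "(\<Sum>p\<in>E \<inter> ?Q. ?w p) \<le> (\<Sum>p\<in>?Q. ?w p)"
      by (rule sum_mono2) (auto intro: wpos finite_subset[of _ "{..n}"])
    ultimately show "(\<Sum>p\<in>?Q. ?w p) \<ge> \<eta> * ln (real n) - (C1 + C2 + C3 + 2 * C4)" by linarith
  qed (use \<eta> in auto)
qed

section \<open>Twists with a rational point\<close>

text \<open>Positive squarefree integers suffice. A proportion of at most 1/4 is divisible by 4 and
  at most 1/2 by the square of an odd prime, which leaves about a quarter; 1/16 absorbs the rounding
  and the excluded integer 1.\<close>

lemma card_free_ints_upto_ge: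
  assumes n: "n \<ge> 2" and x: "x \<ge> 16"
  shows "real (card (free_ints_upto n x)) \<ge> x / 16"
proof -
  define X where "X = nat \<lfloor>x\<rfloor>"
  have X: "real X \<le> x" "real X > x - 1" using x unfolding X_def by linarith+
  define Bad where "Bad = (\<Union>p\<in>primes_le X. {m\<in>{1..X}. p ^ 2 dvd m})"
  have "real (card Bad) \<le> (\<Sum>p\<in>primes_le X. real (card {m\<in>{1..X}. p ^ 2 dvd m}))"
    unfolding Bad_def of_nat_sum[symmetric] by (intro of_nat_mono card_UN_le) auto
  also have "\<dots> \<le> (\<Sum>p\<in>primes_le X. real X * (1 / (real p)\<^sup>2))"
  proof (rule sum_mono)
    fix p assume "p \<in> primes_le X"
    then have "p ^ 2 > 0" by (auto dest: primes_le_D(3))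
    then have "real (card {m\<in>{1..X}. p ^ 2 dvd m}) = real (X div p ^ 2)" by (simp only: card_multiples)
    also have "\<dots> \<le> real X / real (p ^ 2)" by (rule of_nat_div_le_of_nat)
    finally show "real (card {m\<in>{1..X}. p ^ 2 dvd m}) \<le> real X * (1 / (real p)\<^sup>2)" by simp
  qed
  also have "\<dots> = real X * (\<Sum>p\<in>primes_le X. 1 / (real p)\<^sup>2)" by (simp add: sum_distrib_left)
  also have "\<dots> \<le> real X * (3 / 4)"
  proof (rule mult_left_mono)
    have "(\<Sum>p\<in>primes_le X. 1 / (real p)\<^sup>2) \<le> (\<Sum>p\<in>insert 2 (primes_le X - {2}). 1 / (real p)\<^sup>2)"
      by (rule sum_mono2) auto
    also have "\<dots> = 1 / 4 + (\<Sum>p\<in>primes_le X - {2}. 1 / (real p)\<^sup>2)" by (subst sum.insert) auto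
    also have "(\<Sum>p\<in>primes_le X - {2}. 1 / (real p)\<^sup>2) \<le> 1 / real 2"
      by (rule sum_inverse_squares_tail) (auto dest: primes_le_D(3) simp: le_less)
    finally show "(\<Sum>p\<in>primes_le X. 1 / (real p)\<^sup>2) \<le> 3 / 4" by simp
  qed simp
  finally have Bad: "real (card Bad) \<le> 3 / 4 * real X" by simp
  have "int ` ({2..X} - Bad) \<subseteq> free_ints_upto n x"
  proof clarify
    fix m assume m: "m \<in> {2..X}" "m \<notin> Bad"
    have "\<not> p ^ n dvd int m" if p: "prime (p::int)" for p
    proof
      assume "p ^ n dvd int m"
      moreover have "p ^ 2 dvd p ^ n" using n by (rule le_imp_power_dvd)
      ultimately have d: "p ^ 2 dvd int m" by (rule dvd_trans[rotated])
      define q where "q = nat p"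
      have pq: "p = int q" using p prime_gt_0_int[of p] by (simp add: q_def)
      have q: "prime q" using p by (simp add: pq)
      have d': "q ^ 2 dvd m" using d unfolding pq by (simp only: semiring_1_class.of_nat_power[symmetric] int_dvd_int_iff)
      then have "q ^ 2 \<le> m" using m by (intro dvd_imp_le) auto
      moreover have "q \<le> q ^ 2" by (simp add: power2_eq_square)
      ultimately have "q \<in> primes_le X" using m q by (auto simp: primes_le_def)
      then show False using m d' unfolding Bad_def by auto
    qed
    then have "int m \<in> free_ints n" using m by (auto simp: free_ints_def)
    then show "int m \<in> free_ints_upto n x" using m X by (simp add: free_ints_upto_def)
  qed
  then have "card (int ` ({2..X} - Bad)) \<le> card (free_ints_upto n x)"
    by (rule card_mono[OF finite_free_ints_upto])
  then have "real (card ({2..X} - Bad)) \<le> real (card (free_ints_upto n x))" by (simp add: card_image)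
  moreover have "card {2..X} - card Bad \<le> card ({2..X} - Bad)"
    by (rule diff_card_le_card_Diff) (auto simp: Bad_def)
  then have "real (X - 1) - real (card Bad) \<le> real (card ({2..X} - Bad))" by simp
  moreover have "real (X - 1) = real X - 1" using X x by (simp add: of_nat_diff)
  ultimately have "real X - 1 - 3 / 4 * real X \<le> real (card (free_ints_upto n x))" using Bad by linarith
  then show ?thesis using X x by linarith
qed

text \<open>If \<open>p\<close> divides \<open>c\<close>, only the leading term survives modulo
  \<open>p\<close> and forces \<open>p\<close> to divide \<open>a\<close> as well. Otherwise
  \<open>a / c\<close> is a root of \<open>P\<close> modulo \<open>p\<close>.\<close>

lemma binary_form_not_dvd:
  fixes P :: "int poly" and a c :: int
  assumes p: "p \<in> rootless_primes P" and co: "coprime a c"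
  shows "\<not> int p dvd (\<Sum>i\<le>degree P. coeff P i * a ^ i * c ^ (degree P - i))"
proof
  let ?N = "degree P"
  let ?F = "\<Sum>i\<le>?N. coeff P i * a ^ i * c ^ (?N - i)"
  assume F: "int p dvd ?F"
  have pr: "prime (int p)" and nl: "\<not> int p dvd lead_coeff P" and nr: "roots_mod P p = {}"
    using p by (auto simp: rootless_primes_def)
  have p0: "int p > 0" using pr by (rule prime_gt_0_int)
  show False
  proof (cases "int p dvd c")
    case True
    have eq: "?F = (\<Sum>i<?N. coeff P i * a ^ i * c ^ (?N - i)) + lead_coeff P * a ^ ?N"
      by (simp add: lessThan_Suc_atMost[symmetric])
    have dA: "int p dvd (\<Sum>i<?N. coeff P i * a ^ i * c ^ (?N - i))"
    proof (rule dvd_sum)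
      fix i assume "i \<in> {..<?N}"
      then have "c dvd c ^ (?N - i)" by (intro dvd_power) auto
      then show "int p dvd coeff P i * a ^ i * c ^ (?N - i)" using True by (meson dvd_mult dvd_trans)
    qed
    have "int p dvd lead_coeff P * a ^ ?N" using F unfolding eq dvd_add_right_iff[OF dA] .
    then have "int p dvd a" using nl pr prime_dvd_mult_iff prime_dvd_power by blast
    then have "is_unit (int p)" using True co by (rule coprime_common_divisor[rotated])
    then show False using prime_gt_1_int[OF pr] by auto
  next
    case False
    then have "coprime c (int p)" using pr by (intro coprime_int_if_not_dvd) simp
    then obtain w where w: "[c * w = 1] (mod int p)" using cong_solve_coprime_int by blast
    define r where "r = (a * w) mod int p"
    have "?F * w ^ ?N = (\<Sum>i\<le>?N. coeff P i * (a * w) ^ i * (c * w) ^ (?N - i))"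
      unfolding sum_distrib_right
    proof (rule sum.cong[OF refl])
      fix i assume "i \<in> {..?N}"
      then have "w ^ ?N = w ^ i * w ^ (?N - i)" by (simp flip: power_add)
      then show "coeff P i * a ^ i * c ^ (?N - i) * w ^ ?N = coeff P i * (a * w) ^ i * (c * w) ^ (?N - i)"
        by (simp add: power_mult_distrib)
    qed
    also have "[\<dots> = (\<Sum>i\<le>?N. coeff P i * r ^ i * 1 ^ (?N - i))] (mod int p)"
      by (intro cong_sum cong_mult cong_pow cong_refl w) (simp add: r_def cong_def)
    finally have "[?F * w ^ ?N = poly P r] (mod int p)" by (simp add: poly_altdef)
    moreover have "int p dvd ?F * w ^ ?N" using F by simp
    ultimately have "int p dvd poly P r" using cong_dvd_iff by blast
    then have "r \<in> roots_mod P p" using p0 by (simp add: roots_mod_def r_def)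
    then show False using nr by simp
  qed
qed

section \<open>Rational points and the prime divisors of the twist\<close>

lemma homogenized_scale:
  "homogenized P (l * of_int a) (l * of_int c)
     = l ^ degree P * of_int (\<Sum>i\<le>degree P. coeff P i * a ^ i * c ^ (degree P - i))"
proof -
  have "homogenized P (l * of_int a) (l * of_int c)
      = (\<Sum>i\<le>degree P. l ^ degree P * of_int (coeff P i * a ^ i * c ^ (degree P - i)))"
    unfolding homogenized_def
  proof (rule sum.cong[OF refl])
    fix i assume "i \<in> {..degree P}"
    then have "l ^ degree P = l ^ i * l ^ (degree P - i)" by (simp flip: power_add)
    then show "of_int (coeff P i) * (l * of_int a) ^ i * (l * of_int c) ^ (degree P - i)
        = l ^ degree P * of_int (coeff P i * a ^ i * c ^ (degree P - i))"
      by (simp add: power_mult_distrib)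
  qed
  then show ?thesis by (simp add: sum_distrib_left)
qed

lemma primitive_integer_coordinates:
  fixes t z :: rat
  assumes "t \<noteq> 0 \<or> z \<noteq> 0"
  obtains l :: rat and a c :: int where "l \<noteq> 0" "t = l * of_int a" "z = l * of_int c" "coprime a c"
proof -
  obtain t1 t2 where t: "quotient_of t = (t1, t2)" by force
  obtain z1 z2 where z: "quotient_of z = (z1, z2)" by force
  have pos: "t2 > 0" "z2 > 0" using quotient_of_denom_pos t z by blast+
  have tz: "t = of_int t1 / of_int t2" "z = of_int z1 / of_int z2" using quotient_of_div t z by blast+
  let ?g = "gcd (t1 * z2) (z1 * t2)"
  have "t1 * z2 \<noteq> 0 \<or> z1 * t2 \<noteq> 0" using assms tz pos by auto
  then have g0: "?g \<noteq> 0" by simp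
  obtain a where a: "t1 * z2 = ?g * a" by (meson gcd_dvd1 dvdE)
  obtain c where c: "z1 * t2 = ?g * c" by (meson gcd_dvd2 dvdE)
  have "coprime a c"
    using div_gcd_coprime[of "t1 * z2" "z1 * t2"] \<open>t1 * z2 \<noteq> 0 \<or> z1 * t2 \<noteq> 0\<close> a c g0
    by (metis nonzero_mult_div_cancel_left)
  define l :: rat where "l = of_int ?g / of_int (t2 * z2)"
  have "t = of_int (t1 * z2) / of_int (t2 * z2)" using tz pos by simp
  also have "\<dots> = l * of_int a" unfolding l_def by (subst a) simp
  finally have ta: "t = l * of_int a" .
  have "z = of_int (z1 * t2) / of_int (t2 * z2)" using tz pos by simp
  also have "\<dots> = l * of_int c" unfolding l_def by (subst c) simp
  finally have "z = l * of_int c" .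
  then show ?thesis using that[of l a c] ta \<open>coprime a c\<close> g0 pos by (simp add: l_def)
qed

text \<open>At a rational point with coprime coordinates the value of the form is prime to
  \<open>p\<close>, so the exponent of \<open>p\<close> in \<open>d\<close> is divisible by
  \<open>n\<close>. As \<open>d\<close> is \<open>n\<close>-free, this exponent must be 0.\<close>

lemma twist_not_dvd:
  assumes n: "n \<ge> 2" "n dvd N" "N > 0" "degree P = N" and d: "d \<in> twists n P" and p: "p \<in> rootless_primes P"
  shows "\<not> int p dvd d"
proof
  assume pd: "int p dvd d"
  have pr: "prime (int p)" using p by (simp add: rootless_primes_def)
  have free: "d \<noteq> 0" "\<not> int p ^ n dvd d" using d pr by (auto simp: twists_def free_ints_def)
  obtain y t z :: rat where y: "y \<noteq> 0" "y ^ n = of_int d * homogenized P t z"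
    using d by (auto simp: twists_def has_nontrivial_rational_point_def)
  have "t \<noteq> 0 \<or> z \<noteq> 0"
  proof (rule ccontr)
    assume "\<not> (t \<noteq> 0 \<or> z \<noteq> 0)"
    then have "homogenized P t z = 0" unfolding homogenized_def n(4)
      using n(3) by (intro sum.neutral) (auto simp: zero_power power_0_left)
    then show False using y n by simp
  qed
  then obtain l a c where lac: "l \<noteq> 0" "t = l * of_int a" "z = l * of_int c" "coprime a c"
    by (rule primitive_integer_coordinates)
  define F where "F = (\<Sum>i\<le>degree P. coeff P i * a ^ i * c ^ (degree P - i))"
  have pF: "\<not> int p dvd F" unfolding F_def by (rule binary_form_not_dvd[OF p lac(4)])
  obtain e where e: "N = n * e" using n(2) by blast
  \<comment> \<open>The common factor \<open>l ^ N\<close> of the form is the \<open>n\<close>-th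
    power of \<open>l ^ e\<close>, by \<open>n dvd N\<close>, and is absorbed into
    \<open>y\<close>.\<close>
  define y' where "y' = y / l ^ e"
  have "homogenized P t z = l ^ N * of_int F"
    unfolding lac(2,3) homogenized_scale F_def n(4) ..
  moreover have "(l ^ e) ^ n = l ^ N" by (simp add: e mult.commute flip: power_mult)
  ultimately have "y' ^ n = of_int d * of_int F"
    using y(2) lac(1) by (simp add: y'_def power_divide)
  moreover obtain u v where uv: "quotient_of y' = (u, v)" by force
  have v0: "v > 0" and yuv: "y' = of_int u / of_int v" using uv quotient_of_denom_pos quotient_of_div by blast+
  ultimately have "of_int (u ^ n) = (of_int (d * F * v ^ n) :: rat)"
    by (simp add: power_divide field_simps)
  then have eq: "u ^ n = d * F * v ^ n" by (simp only: of_int_eq_iff)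
  have F0: "F \<noteq> 0" using pF by auto
  have "u ^ n \<noteq> 0" unfolding eq using free(1) F0 v0 by simp
  then have u0: "u \<noteq> 0" using n(1) by (auto simp: power_0_left)
  let ?m = "multiplicity (int p)"
  have pe: "prime_elem (int p)" using pr by (rule prime_imp_prime_elem)
  have "n * ?m u = ?m (u ^ n)" using u0 by (simp add: prime_elem_multiplicity_power_distrib[OF pe])
  also have "\<dots> = ?m d + ?m F + n * ?m v"
    unfolding eq using free(1) F0 v0
    by (simp add: prime_elem_multiplicity_mult_distrib[OF pe] prime_elem_multiplicity_power_distrib[OF pe])
  also have "?m F = 0" using pF by (rule not_dvd_imp_multiplicity_0)
  finally have "n dvd ?m d" by (metis add.right_neutral dvd_add_left_iff dvd_triv_left)
  moreover have nu: "\<not> is_unit (int p)" using prime_gt_1_int[OF pr] by auto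
  have "?m d \<ge> 1" using pd free(1) nu by (metis multiplicity_gt_zero_iff Suc_leI One_nat_def)
  moreover have "?m d < n" using free multiplicity_dvd'[of n "int p" d] by (meson not_less)
  ultimately show False by (auto dest: dvd_imp_le)
qed

lemma card_twists_upto_le:
  assumes "n \<ge> 2" "n dvd N" "N > 0" "degree P = N"
  shows "card (twists_upto n P x) \<le> 2 * card (sifted n (rootless_primes P) (nat \<lfloor>x\<rfloor>))"
proof -
  let ?W = "sifted n (rootless_primes P) (nat \<lfloor>x\<rfloor>)"
  have "twists_upto n P x \<subseteq> int ` ?W \<union> (\<lambda>m. - int m) ` ?W"
  proof
    fix d assume d: "d \<in> twists_upto n P x"
    then have dt: "d \<in> twists n P" and df: "d \<in> free_ints n" and dx: "real_of_int \<bar>d\<bar> \<le> x"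
      by (auto simp: twists_upto_def twists_def free_ints_upto_def)
    define m where "m = nat \<bar>d\<bar>"
    have im: "int m = \<bar>d\<bar>" by (simp add: m_def)
    have "m \<ge> 1" using df by (auto simp: m_def free_ints_def)
    moreover have "m \<le> nat \<lfloor>x\<rfloor>" using dx unfolding m_def by linarith
    moreover have "\<not> p ^ n dvd m" if "prime p" for p
    proof
      assume "p ^ n dvd m"
      then have "int (p ^ n) dvd int m" by (simp only: int_dvd_int_iff)
      then have "int p ^ n dvd d" by (simp add: im)
      then show False using df that by (auto simp: free_ints_def)
    qed
    moreover have "\<not> p dvd m" if "p \<in> rootless_primes P" for p
    proof
      assume "p dvd m"
      then have "int p dvd int m" by (simp only: int_dvd_int_iff)
      then have "int p dvd d" by (simp add: im)
      then show False using twist_not_dvd[OF assms dt that] by simp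
    qed
    ultimately have "m \<in> ?W" by (auto simp: sifted_def)
    moreover have "d = int m \<or> d = - int m" using im by linarith
    ultimately show "d \<in> int ` ?W \<union> (\<lambda>m. - int m) ` ?W" by blast
  qed
  then have "card (twists_upto n P x) \<le> card (int ` ?W \<union> (\<lambda>m. - int m) ` ?W)"
    by (rule card_mono[rotated]) simp
  also have "\<dots> \<le> card (int ` ?W) + card ((\<lambda>m. - int m) ` ?W)" by (rule card_Un_le)
  also have "\<dots> \<le> card ?W + card ?W" by (intro add_mono card_image_le) auto
  finally show ?thesis by simp
qed

lemma twists_bound:
  assumes n: "n \<ge> 2" "n dvd N" "N > 0" and P: "irreducible_of_degree N P"
  obtains \<alpha> C where "0 < \<alpha>" "\<alpha> < 1" "C \<ge> 0"
    "\<And>x. x \<ge> 3 \<Longrightarrow> real (card (twists_upto n P x)) \<le> C * (x * ln x powr (- \<alpha>))"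
proof -
  have "n \<le> N" using n by (auto dest: dvd_imp_le)
  \<comment> \<open>A linear polynomial has a root modulo every prime not dividing its leading
    coefficient, so degree at least 2 is essential for rootless primes.\<close>
  then have N2: "N \<ge> 2" using n by simp
  have dP: "degree P = N" using P by (simp add: irreducible_of_degree_def)
  obtain c C where c: "0 < c" "c < 1"
    "\<And>m. m \<ge> 1 \<Longrightarrow> (\<Sum>p\<in>{p\<in>rootless_primes P. p \<le> m}. ln (real p) / real p) \<ge> c * ln (real m) - C"
    using rootless_primes_dense[OF P N2] by blast
  obtain E where E: "\<And>x. x \<ge> 2 \<Longrightarrow> real (card (sifted n (rootless_primes P) x)) \<le> E * real x * ln (real x) powr (- c)"
    using sifted_bound[OF _ c, of n] by (auto simp: rootless_primes_def)
  show ?thesis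
  proof (rule that[OF c(1,2), of "2 * \<bar>E\<bar> * 2 powr c"])
    fix x :: real assume x: "x \<ge> 3"
    define m where "m = nat \<lfloor>x\<rfloor>"
    have m: "real m \<le> x" "real m > x - 1" "m \<ge> 2" using x unfolding m_def by linarith+
    \<comment> \<open>Gives \<open>ln m \<ge> ln x / 2\<close>, so passing from the integer part
      \<open>m\<close> to \<open>x\<close> costs only the factor \<open>2 powr c\<close>.\<close>
    have "sqrt x \<le> real m"
    proof -
      have "3 * x \<le> x * x" using x by (intro mult_right_mono) auto
      moreover have "(x - 1)\<^sup>2 = x * x - 2 * x + 1" by (simp add: power2_eq_square algebra_simps)
      ultimately have "x \<le> (x - 1)\<^sup>2" by linarith
      then have "sqrt x \<le> x - 1" using x by (intro real_le_lsqrt) auto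
      then show ?thesis using m by linarith
    qed
    then have "ln (sqrt x) \<le> ln (real m)" using x m by (subst ln_le_cancel_iff) auto
    then have "ln x / 2 \<le> ln (real m)" using x by (simp add: ln_sqrt)
    then have "ln (real m) powr (- c) \<le> (ln x / 2) powr (- c)"
      using x c by (intro powr_mono2') auto
    also have "\<dots> = 2 powr c * ln x powr (- c)" using x by (simp add: powr_divide powr_minus field_simps)
    finally have lm: "ln (real m) powr (- c) \<le> 2 powr c * ln x powr (- c)" .
    have "real (card (twists_upto n P x)) \<le> real (2 * card (sifted n (rootless_primes P) m))"
      unfolding m_def of_nat_le_iff by (rule card_twists_upto_le[OF n dP])
    also have "\<dots> = 2 * real (card (sifted n (rootless_primes P) m))" by simp
    also have "\<dots> \<le> 2 * (\<bar>E\<bar> * real m * ln (real m) powr (- c))"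
    proof (rule mult_left_mono)
      have "E * real m * ln (real m) powr (- c) \<le> \<bar>E\<bar> * real m * ln (real m) powr (- c)"
        by (intro mult_right_mono) auto
      then show "real (card (sifted n (rootless_primes P) m)) \<le> \<bar>E\<bar> * real m * ln (real m) powr (- c)"
        using E[OF m(3)] by linarith
    qed simp
    also have "\<dots> \<le> 2 * (\<bar>E\<bar> * x * (2 powr c * ln x powr (- c)))"
      using m lm x by (intro mult_left_mono mult_mono) auto
    finally show "real (card (twists_upto n P x)) \<le> 2 * \<bar>E\<bar> * 2 powr c * (x * ln x powr (- c))" by (simp add: mult_ac)
  qed simp
qed

section \<open>Counting reducible polynomials\<close>

text \<open>Gauss's lemma: with \<open>Q\<close> the primitive minimal polynomial of a root of low
  degree, pseudo-division gives \<open>c * P = Q * q\<close>. The content of \<open>q\<close> is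
  divisible by \<open>c\<close>, so \<open>Q\<close> divides \<open>P\<close> over the
  integers.\<close>

lemma not_irreducible_imp_factor:
  assumes P: "degree P = N" "N > 0" "\<not> irreducible_of_degree N P"
  obtains F G where "P = F * G" "0 < degree F" "0 < degree G"
proof -
  obtain z f0 where z: "poly (cpoly P) z = 0" "f0 \<noteq> 0" "poly (cpoly f0) z = 0" "degree f0 < N"
    using P unfolding irreducible_of_degree_def by (auto simp: not_le)
  obtain f where f: "f \<noteq> 0" "poly (cpoly f) z = 0"
    and fmin: "\<And>h. h \<noteq> 0 \<Longrightarrow> poly (cpoly h) z = 0 \<Longrightarrow> degree f \<le> degree h"
    using ex_has_least_nat[of "\<lambda>h. h \<noteq> 0 \<and> poly (cpoly h) z = 0" f0 degree] z by blast
  define Q where "Q = primitive_part f"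
  have fQ: "f = smult (content f) Q" by (simp add: Q_def)
  have cf: "content f \<noteq> 0" using f by simp
  have "poly (cpoly f) z = of_int (content f) * poly (cpoly Q) z"
    by (subst fQ) (simp add: hom_distribs)
  then have Qz: "poly (cpoly Q) z = 0" using f cf by simp
  have Q0: "Q \<noteq> 0" using f fQ by auto
  have dQ: "degree Q = degree f" by (simp add: Q_def)
  obtain c q where cq: "c \<noteq> 0" "smult c P = Q * q + pseudo_mod P Q"
    using pseudo_mod(1)[OF Q0, of P] by blast
  have "cpoly (smult c P) = cpoly Q * cpoly q + cpoly (pseudo_mod P Q)"
    unfolding cq(2) by (simp add: hom_distribs)
  then have "poly (cpoly (smult c P)) z = poly (cpoly Q * cpoly q + cpoly (pseudo_mod P Q)) z" by simp
  then have "poly (cpoly (pseudo_mod P Q)) z = 0" using z(1) Qz by (simp add: hom_distribs)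
  then have "pseudo_mod P Q = 0"
    using fmin[of "pseudo_mod P Q"] pseudo_mod(2)[OF Q0, of P] dQ by fastforce
  then have eq: "smult c P = Q * q" using cq(2) by simp
  have "content (Q * q) = content q" using Q0 f(1) by (simp add: content_mult Q_def)
  then have "content q = \<bar>c\<bar> * content P" unfolding eq[symmetric] by simp
  then have "c dvd content q" by (simp add: dvd_mult2)
  then have "[:c:] dvd q" by (simp add: const_poly_dvd_iff_dvd_content)
  then obtain G where G: "q = [:c:] * G" by blast
  have "smult c P = smult c (Q * G)" unfolding eq G by simp
  then have "smult c (P - Q * G) = 0" by (simp add: smult_diff_right)
  then have PQ: "P = Q * G" using cq(1) by simp
  have P0: "P \<noteq> 0" using P by auto
  then have "degree P = degree Q + degree G" unfolding PQ by (intro degree_mult_eq) auto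
  moreover have "degree Q < N" using fmin[OF z(2,3)] z(4) dQ by linarith
  moreover have "degree Q > 0"
  proof (rule ccontr)
    assume "\<not> degree Q > 0"
    then obtain a where "Q = [:a:]" by (auto elim: degree_eq_zeroE)
    then show False using Qz Q0 by (simp add: map_poly_pCons)
  qed
  ultimately show ?thesis using that[OF PQ] P by linarith
qed

section \<open>Heights and Mahler's measure\<close>

lemma height_ge_coeff: "\<bar>coeff P i\<bar> \<le> height P"
proof (cases "i \<le> degree P")
  case True
  then show ?thesis unfolding height_def by (intro Max_ge) auto
next
  case False
  have "0 \<le> \<bar>coeff P 0\<bar>" by simp
  also have "\<dots> \<le> height P" unfolding height_def by (intro Max_ge) auto
  finally show ?thesis using False by (simp add: coeff_eq_0)
qed

lemma height_attained: obtains i where "\<bar>coeff P i\<bar> = height P"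
proof -
  have "height P \<in> (\<lambda>i. \<bar>coeff P i\<bar>) ` {..degree P}" unfolding height_def by (intro Max_in) auto
  then show ?thesis using that by auto
qed

lemma height_pos: "P \<noteq> 0 \<Longrightarrow> height P \<ge> 1"
  using height_ge_coeff[of P "degree P"] leading_coeff_0_iff[of P] by linarith

lemma mahler_measure_le_height: "mahler_measure P \<le> real (Suc (degree P)) * real_of_int (height P)"
proof -
  have "mahler_measure P \<le> sqrt (\<Sum>a\<leftarrow>coeffs (cpoly P). (cmod a)\<^sup>2)"
    unfolding mahler_measure_def by (rule Landau_inequality)
  also have "(\<Sum>a\<leftarrow>coeffs (cpoly P). (cmod a)\<^sup>2) \<le> (\<Sum>a\<leftarrow>coeffs (cpoly P). (real_of_int (height P))\<^sup>2)"
  proof (rule sum_list_mono)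
    fix a assume "a \<in> set (coeffs (cpoly P))"
    then have "a \<in> range (coeff (cpoly P))" by (simp only: range_coeff insert_iff simp_thms)
    then obtain i where "a = coeff (cpoly P) i" by blast
    then have "cmod a = real_of_int \<bar>coeff P i\<bar>" by (simp add: coeff_map_poly)
    then show "(cmod a)\<^sup>2 \<le> (real_of_int (height P))\<^sup>2"
      using height_ge_coeff[of P i] by (intro power_mono) simp_all
  qed
  also have "\<dots> = real (length (coeffs (cpoly P))) * (real_of_int (height P))\<^sup>2" by (rule sum_list_triv)
  also have "\<dots> \<le> real (Suc (degree P)) * (real_of_int (height P))\<^sup>2"
    by (cases "P = 0") (auto simp: length_coeffs intro!: mult_right_mono)
  also have "\<dots> \<le> (real (Suc (degree P)))\<^sup>2 * (real_of_int (height P))\<^sup>2"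
    by (intro mult_right_mono self_le_power) auto
  also have "sqrt \<dots> = real (Suc (degree P)) * real_of_int (height P)"
  proof -
    have "real_of_int (height P) \<ge> 0" using height_ge_coeff[of P 0] by linarith
    then show ?thesis by (simp add: real_sqrt_mult)
  qed
  finally show ?thesis by simp
qed

lemma height_le_mahler_measure: "real_of_int (height F) \<le> 2 ^ degree F * mahler_measure F"
proof -
  obtain i where i: "\<bar>coeff F i\<bar> = height F" by (rule height_attained)
  have "real_of_int (height F) \<le> real (degree F choose i) * mahler_measure F"
    using Mignotte_bound[of F i] i by simp
  also have "\<dots> \<le> 2 ^ degree F * mahler_measure F"
  proof (rule mult_right_mono[OF _ mahler_measure_ge_0])
    have "degree F choose i \<le> 2 ^ degree F"
    proof (cases "i \<le> degree F")
      case True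
      have "(\<Sum>k\<in>{i}. degree F choose k) \<le> (\<Sum>k\<le>degree F. degree F choose k)"
        by (rule sum_mono2) (use True in auto)
      then show ?thesis by (simp add: choose_row_sum)
    qed (simp add: binomial_eq_0)
    then have "real (degree F choose i) \<le> real (2 ^ degree F)" by (simp only: of_nat_le_iff)
    then show "real (degree F choose i) \<le> 2 ^ degree F" by simp
  qed
  finally show ?thesis .
qed

text \<open>The measure is multiplicative; Mignotte's bound compares it with the heights of the
  factors, and Landau's inequality with the height of the product.\<close>

lemma height_mult_le:
  assumes "P = F * G" "P \<noteq> 0"
  shows "real_of_int (height F * height G) \<le> 2 ^ degree P * real (Suc (degree P)) * real_of_int (height P)"
proof -
  have nz: "F \<noteq> 0" "G \<noteq> 0" using assms by auto
  have M: "mahler_measure P = mahler_measure F * mahler_measure G"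
    unfolding assms(1) mahler_measure_def by (simp add: hom_distribs measure_eq_prod)
  have "real_of_int (height F * height G) \<le> (2 ^ degree F * mahler_measure F) * (2 ^ degree G * mahler_measure G)"
    unfolding of_int_mult
    using height_le_mahler_measure height_pos[OF nz(1)] height_pos[OF nz(2)] mahler_measure_ge_0
    by (intro mult_mono) auto
  also have "\<dots> = 2 ^ degree P * mahler_measure P"
    unfolding M unfolding assms(1) using nz by (simp add: degree_mult_eq power_add)
  also have "\<dots> \<le> 2 ^ degree P * (real (Suc (degree P)) * real_of_int (height P))"
    by (intro mult_left_mono mahler_measure_le_height) simp
  finally show ?thesis by (simp add: mult.assoc)
qed

section \<open>Dyadic count of products\<close>

definition coeff_box :: "nat \<Rightarrow> nat \<Rightarrow> int poly set" where
  "coeff_box m j = {f. (\<forall>i<m. \<bar>coeff f i\<bar> \<le> int j) \<and> (\<forall>i\<ge>m. coeff f i = 0)}"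

lemma card_coeff_box_le: "finite (coeff_box m j)" "card (coeff_box m j) \<le> (2 * j + 1) ^ m"
proof -
  define w where "w = (\<Sum>i<m. monom (int j) i)"
  have w: "coeff w i = (if i < m then int j else 0)" for i by (simp add: w_def coeff_sum)
  have inj: "inj_on (\<lambda>f. f + w) (coeff_box m j)" by (auto simp: inj_on_def)
  have sub: "(\<lambda>f. f + w) ` coeff_box m j \<subseteq> ibox m (2 * j + 1)"
    by (auto simp: coeff_box_def ibox_def w abs_le_iff)
  show "finite (coeff_box m j)" using inj_on_finite[OF inj sub] by simp
  show "card (coeff_box m j) \<le> (2 * j + 1) ^ m"
    using card_inj_on_le[OF inj sub] by (simp add: card_ibox)
qed

lemma in_cbox: "degree F < m \<Longrightarrow> height F \<le> int j \<Longrightarrow> F \<in> coeff_box m j"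
  unfolding coeff_box_def using height_ge_coeff[of F] by (auto simp: coeff_eq_0 intro: order.trans)

definition reducibles :: "nat \<Rightarrow> real \<Rightarrow> int poly set" where
  "reducibles N H = {P. degree P = N \<and> real_of_int (height P) \<le> H \<and> \<not> irreducible_of_degree N P}"

text \<open>A reducible \<open>P = F G\<close> with \<open>deg F \<le> deg G\<close> is counted according to the dyadic size of the height
  of \<open>F\<close>; the product of the heights of \<open>F\<close> and \<open>G\<close> is at most \<open>T\<close>, a constant multiple of \<open>H\<close>.\<close>

lemma reducibles_subset:
  assumes "N > 0" and T: "T = nat \<lfloor>2 ^ N * real (Suc N) * H\<rfloor>"
  shows "reducibles N H \<subseteq> (\<Union>k\<in>{k. 1 \<le> k \<and> 2 * k \<le> N}. \<Union>i\<in>{i. 2 ^ i \<le> T}.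
      (\<lambda>(F, G). F * G) ` (coeff_box (Suc k) (2 ^ Suc i) \<times> coeff_box (Suc (N - k)) (T div 2 ^ i)))"
proof
  fix P assume P: "P \<in> reducibles N H"
  then have dP: "degree P = N" and hP: "real_of_int (height P) \<le> H" and ni: "\<not> irreducible_of_degree N P"
    by (auto simp: reducibles_def)
  have P0: "P \<noteq> 0" using dP assms by auto
  obtain F0 G0 where FG0: "P = F0 * G0" "0 < degree F0" "0 < degree G0"
    using not_irreducible_imp_factor[OF dP assms(1) ni] by blast
  obtain F G where FG: "P = F * G" "0 < degree F" "degree F \<le> degree G"
  proof (cases "degree F0 \<le> degree G0")
    case True then show ?thesis using that FG0 by blast
  next
    case False then show ?thesis using that[of G0 F0] FG0 by (simp add: mult.commute)
  qed
  have nz: "F \<noteq> 0" "G \<noteq> 0" using FG(1) P0 by auto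
  define k where "k = degree F"
  have dG: "degree G = N - k" "k \<le> N" using degree_mult_eq[OF nz] FG(1) dP by (auto simp: k_def)
  have k: "1 \<le> k" "2 * k \<le> N" using FG dG by (auto simp: k_def)
  have hF: "height F \<ge> 1" and hG: "height G \<ge> 1" using nz by (simp_all add: height_pos)
  have "real_of_int (height F * height G) \<le> 2 ^ N * real (Suc N) * real_of_int (height P)"
    using height_mult_le[OF FG(1) P0] dP by simp
  also have "\<dots> \<le> 2 ^ N * real (Suc N) * H" using hP by (intro mult_left_mono) auto
  finally have "height F * height G \<le> \<lfloor>2 ^ N * real (Suc N) * H\<rfloor>" by linarith
  then have hT: "height F * height G \<le> int T" unfolding T by linarith
  \<comment> \<open>Minimality gives \<open>2 ^ i \<le> height F \<le> 2 ^ Suc i\<close>; the case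
    \<open>i = 0\<close> includes height 1.\<close>
  define i where "i = (LEAST i. nat (height F) \<le> 2 ^ Suc i)"
  have ex: "nat (height F) \<le> 2 ^ Suc (nat (height F))"
    by (rule less_imp_le, rule less_le_trans[OF less_exp]) simp
  then have i1: "nat (height F) \<le> 2 ^ Suc i" unfolding i_def by (rule LeastI)
  have i2: "2 ^ i \<le> nat (height F)"
  proof (cases i)
    case 0 then show ?thesis using hF by simp
  next
    case (Suc j)
    then have "\<not> nat (height F) \<le> 2 ^ Suc j" using not_less_Least[of j "\<lambda>i. nat (height F) \<le> 2 ^ Suc i"] by (simp add: i_def)
    then show ?thesis using Suc by simp
  qed
  have "nat (height F) * nat (height G) \<le> T" using hT hF hG by (simp add: nat_mult_distrib[symmetric])
  then have le: "2 ^ i * nat (height G) \<le> T" using i2 mult_right_mono[OF i2, of "nat (height G)"] by linarith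
  then have "nat (height G) \<le> T div 2 ^ i" by (simp add: less_eq_div_iff_mult_less_eq mult.commute)
  then have G: "G \<in> coeff_box (Suc (N - k)) (T div 2 ^ i)" using dG by (intro in_cbox) auto
  have F: "F \<in> coeff_box (Suc k) (2 ^ Suc i)" using i1 by (intro in_cbox) (auto simp: k_def nat_le_iff)
  have "2 ^ i * 1 \<le> 2 ^ i * nat (height G)" using hG by (intro mult_left_mono) auto
  then have "2 ^ i \<le> T" using le by linarith
  then show "P \<in> (\<Union>k\<in>{k. 1 \<le> k \<and> 2 * k \<le> N}. \<Union>i\<in>{i. 2 ^ i \<le> T}.
      (\<lambda>(F, G). F * G) ` (coeff_box (Suc k) (2 ^ Suc i) \<times> coeff_box (Suc (N - k)) (T div 2 ^ i)))"
    using k F G FG(1) by blast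
qed

text \<open>With \<open>y = 2 ^ i\<close> the block has size of order
  \<open>y ^ (k + 1) * (T / y) ^ (N - k + 1)\<close>. The total exponent of \<open>y\<close> is
  \<open>2 * k - N\<close>, which is not positive, and that of \<open>T\<close> is at most
  \<open>N\<close> because \<open>k \<ge> 1\<close>.\<close>

lemma card_dyadic_block_le:
  assumes k: "1 \<le> k" "2 * k \<le> N" and i: "2 ^ i \<le> T"
  shows "real (card ((\<lambda>(F, G). F * G) ` (coeff_box (Suc k) (2 ^ Suc i) \<times> coeff_box (Suc (N - k)) (T div 2 ^ i)))) \<le> 15 ^ (N + 2) * real T ^ N"
proof -
  have "(1::nat) \<le> 2 ^ i" by simp
  then have T1: "real T \<ge> 1" using i by linarith
  let ?y = "2 ^ i :: real"
  have y1: "?y \<ge> 1" by simp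
  have "real (2 ^ i) \<le> real T" using i by (simp only: of_nat_le_iff)
  then have iT: "?y \<le> real T" by simp
  let ?A = "coeff_box (Suc k) (2 ^ Suc i)" and ?B = "coeff_box (Suc (N - k)) (T div 2 ^ i)"
  have "real (card ((\<lambda>(F, G). F * G) ` (?A \<times> ?B))) \<le> real (card (?A \<times> ?B))"
    by (intro of_nat_mono card_image_le finite_cartesian_product card_coeff_box_le)
  also have "\<dots> = real (card ?A) * real (card ?B)" by (simp add: card_cartesian_product)
  also have "\<dots> \<le> (5 * ?y) ^ Suc k * (3 * (real T / ?y)) ^ Suc (N - k)"
  proof (rule mult_mono)
    define q :: nat where "q = 2 * 2 ^ Suc i + 1"
    have "card ?A \<le> q ^ Suc k" unfolding q_def by (rule card_coeff_box_le)
    then have "real (card ?A) \<le> real (q ^ Suc k)" by (simp only: of_nat_le_iff)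
    also have "real (q ^ Suc k) = real q ^ Suc k" by (rule semiring_1_class.of_nat_power)
    also have "real q ^ Suc k \<le> (5 * ?y) ^ Suc k" using y1 by (intro power_mono) (auto simp: q_def)
    finally show "real (card ?A) \<le> (5 * ?y) ^ Suc k" .
    have "real (card ?B) \<le> real ((2 * (T div 2 ^ i) + 1) ^ Suc (N - k))" by (intro of_nat_mono card_coeff_box_le)
    also have "\<dots> = (2 * real (T div 2 ^ i) + 1) ^ Suc (N - k)"
      by (simp only: semiring_1_class.of_nat_power of_nat_add of_nat_mult of_nat_1 of_nat_numeral)
    also have "\<dots> \<le> (3 * (real T / ?y)) ^ Suc (N - k)"
    proof (rule power_mono)
      have "real (T div 2 ^ i) \<le> real T / ?y" using of_nat_div_le_of_nat[of T "2 ^ i", where 'a = real] by simp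
      moreover have "1 \<le> real T / ?y" using iT by (simp add: pos_le_divide_eq)
      ultimately show "2 * real (T div 2 ^ i) + 1 \<le> 3 * (real T / ?y)" by linarith
    qed simp
    finally show "real (card ?B) \<le> (3 * (real T / ?y)) ^ Suc (N - k)" .
  qed auto
  also have "\<dots> = 5 ^ Suc k * 3 ^ Suc (N - k) * (?y ^ Suc k * real T ^ Suc (N - k) / ?y ^ Suc (N - k))"
    by (simp only: power_mult_distrib power_divide) simp
  also have "\<dots> \<le> 15 ^ (N + 2) * real T ^ N"
  proof (rule mult_mono)
    have "(5::real) ^ Suc k * 3 ^ Suc (N - k) \<le> 15 ^ Suc k * 15 ^ Suc (N - k)" by (intro mult_mono power_mono) auto
    also have "\<dots> = 15 ^ (N + 2)" using k by (simp flip: power_add power_Suc)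
    finally show "(5::real) ^ Suc k * 3 ^ Suc (N - k) \<le> 15 ^ (N + 2)" .
    have "?y ^ Suc k * real T ^ Suc (N - k) \<le> ?y ^ Suc (N - k) * real T ^ N"
      using k y1 T1 by (intro mult_mono power_increasing) auto
    then show "?y ^ Suc k * real T ^ Suc (N - k) / ?y ^ Suc (N - k) \<le> real T ^ N"
      by (simp add: pos_divide_le_eq mult.commute)
  qed auto
  finally show ?thesis .
qed

text \<open>Every dyadic block contributes \<open>O(H ^ N)\<close>; the logarithm is the number of
  blocks.\<close>

lemma card_reducibles_le:
  assumes N: "N > 0"
  obtains C where "C \<ge> 0" "\<And>H. H \<ge> 1 \<Longrightarrow> finite (reducibles N H) \<and> real (card (reducibles N H)) \<le> C * H ^ N * (ln H + 1)"
proof -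
  define c where "c = 2 ^ N * real (Suc N)"
  have c1: "c \<ge> 1" unfolding c_def using one_le_power[of "2::real" N] mult_mono[of 1 "2 ^ N" 1 "real (Suc N)"] by simp
  define L where "L = ln c + 1"
  have L1: "L \<ge> 1" using c1 by (simp add: L_def)
  define C where "C = real N * (2 * L + 1) * (15 ^ (N + 2) * c ^ N)"
  show ?thesis
  proof (rule that[of C])
    show "C \<ge> 0" using L1 c1 by (simp add: C_def)
    fix H :: real assume H: "H \<ge> 1"
    define T where "T = nat \<lfloor>2 ^ N * real (Suc N) * H\<rfloor>"
    have cH: "c * H \<ge> 1" using c1 H mult_mono[of 1 c 1 H] by simp
    have T: "real T \<le> c * H" "T \<ge> 1" using cH unfolding T_def c_def[symmetric] by linarith+
    define I where "I = {i::nat. 2 ^ i \<le> T}"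
    have Isub: "I \<subseteq> {..nat \<lfloor>2 * ln (real T)\<rfloor>}"
    proof
      fix i assume "i \<in> I"
      then have "ln (real (2 ^ i)) \<le> ln (real T)" by (intro ln_of_nat_mono) (auto simp: I_def)
      then have "real i * ln 2 \<le> ln (real T)" by (simp add: ln_realpow)
      moreover have "ln 2 \<ge> (1 / 2 :: real)" using ln_le_minus_one[of "1 / 2"] by (simp add: ln_div)
      then have "real i * (1 / 2) \<le> real i * ln 2" by (intro mult_left_mono) auto
      ultimately have "real i \<le> 2 * ln (real T)" by linarith
      then show "i \<in> {..nat \<lfloor>2 * ln (real T)\<rfloor>}" by (simp add: le_nat_floor)
    qed
    have finI: "finite I" using Isub finite_subset by blast
    have "card I \<le> nat \<lfloor>2 * ln (real T)\<rfloor> + 1" using card_mono[OF _ Isub] by simp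
    moreover have lnT: "0 \<le> ln (real T)" "ln (real T) \<le> ln c + ln H"
    proof -
      show "0 \<le> ln (real T)" using T by simp
      have "ln (real T) \<le> ln (c * H)" using T cH by (subst ln_le_cancel_iff) auto
      then show "ln (real T) \<le> ln c + ln H" using c1 H by (simp add: ln_mult)
    qed
    ultimately have "real (card I) \<le> 2 * ln (real T) + 1" by linarith
    also have "\<dots> \<le> 2 * (ln c + ln H) + 1" using lnT by simp
    also have "\<dots> \<le> (2 * L + 1) * (ln H + 1)"
    proof -
      have "0 \<le> ln H" "0 \<le> ln c" using H c1 by simp_all
      then have "0 \<le> ln c * ln H" by simp
      then show ?thesis using \<open>0 \<le> ln H\<close> by (simp add: L_def algebra_simps)
    qed
    finally have cardI: "real (card I) \<le> (2 * L + 1) * (ln H + 1)" .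
    let ?K = "{k. 1 \<le> k \<and> 2 * k \<le> N}"
    let ?blk = "\<lambda>k i. (\<lambda>(F, G). F * G) ` (coeff_box (Suc k) (2 ^ Suc i) \<times> coeff_box (Suc (N - k)) (T div 2 ^ i))"
    have finK: "finite ?K" by (rule finite_subset[of _ "{..N}"]) auto
    have cardK: "card ?K \<le> N"
      using card_mono[of "{1..N}" ?K] by fastforce
    have finblk: "finite (?blk k i)" for k i by (intro finite_imageI finite_cartesian_product card_coeff_box_le)
    have sub: "reducibles N H \<subseteq> (\<Union>k\<in>?K. \<Union>i\<in>I. ?blk k i)"
      unfolding I_def by (rule reducibles_subset[OF N T_def])
    have fin: "finite (\<Union>k\<in>?K. \<Union>i\<in>I. ?blk k i)" using finK finI finblk by blast
    have "real (card (reducibles N H)) \<le> real (card (\<Union>k\<in>?K. \<Union>i\<in>I. ?blk k i))"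
      by (intro of_nat_mono card_mono fin sub)
    also have "\<dots> \<le> real (\<Sum>k\<in>?K. \<Sum>i\<in>I. card (?blk k i))"
      by (intro of_nat_mono order.trans[OF card_UN_le[OF finK] sum_mono] card_UN_le finI)
    also have "\<dots> = (\<Sum>k\<in>?K. \<Sum>i\<in>I. real (card (?blk k i)))" by simp
    also have "\<dots> \<le> (\<Sum>k\<in>?K. \<Sum>i\<in>I. 15 ^ (N + 2) * real T ^ N)"
      by (intro sum_mono card_dyadic_block_le) (auto simp: I_def)
    also have "\<dots> = real (card ?K) * (real (card I) * (15 ^ (N + 2) * real T ^ N))" by simp
    also have "\<dots> \<le> real N * (((2 * L + 1) * (ln H + 1)) * (15 ^ (N + 2) * (c * H) ^ N))"
      using cardK cardI T H L1 by (intro mult_mono power_mono) auto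
    also have "\<dots> = C * H ^ N * (ln H + 1)" by (simp add: C_def power_mult_distrib)
    finally show "finite (reducibles N H) \<and> real (card (reducibles N H)) \<le> C * H ^ N * (ln H + 1)"
      using finite_subset[OF sub fin] by blast
  qed
qed

lemma irreducible_in_polys:
  assumes "irreducible_of_degree N P" "N > 0" "n \<ge> 2"
  shows "P \<in> polys n N"
  unfolding polys_def
proof (intro CollectI conjI allI impI)
  show dP: "degree P = N" using assms by (simp add: irreducible_of_degree_def)
  fix z :: complex assume z: "poly (cpoly P) z = 0"
  have P0: "cpoly P \<noteq> 0" using dP assms(2) by auto
  show "order z (cpoly P) \<le> n - 1"
  proof (rule ccontr)
    assume "\<not> order z (cpoly P) \<le> n - 1"
    then have "[:- z, 1:] ^ 2 dvd cpoly P" using assms(3) P0 by (subst order_divides) auto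
    then obtain q where "cpoly P = [:- z, 1:] ^ 2 * q" by blast
    then have "cpoly P = [:- z, 1:] * ([:- z, 1:] * q)" by (simp only: power2_eq_square mult.assoc)
    then have "poly (pderiv (cpoly P)) z = 0" by (simp only: pderiv_mult) simp
    then show False using irreducible_simple_root[OF assms(1,2) z] by simp
  qed
qed

text \<open>Non-negative coefficients and a positive leading one already give the right order
  \<open>H ^ (N + 1)\<close>. The irreducible polynomials among them lie in \<open>polys\<close>
  because their roots are simple.\<close>

lemma card_polys_upto_ge:
  assumes N: "N > 0" and n: "n \<ge> 2" and H: "H \<ge> 1" and fin: "finite (reducibles N H)"
  shows "real (card (polys_upto n N H)) \<ge> (H / 2) ^ Suc N - real (card (reducibles N H))"
proof -
  define X where "X = nat \<lfloor>H\<rfloor>"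
  have "real X \<le> H" "real X > H - 1" "X \<ge> 1" using H unfolding X_def by linarith+
  then have X: "real X \<le> H" "real X \<ge> H / 2" by linarith+
  let ?h = "\<lambda>(f, c). f + monom c N"
  let ?D = "ibox N X \<times> {1..int X}"
  have cN: "coeff (f + monom c N) N = c" "\<And>i. i < N \<Longrightarrow> coeff (f + monom c N) i = coeff f i" if "f \<in> ibox N X" for f and c :: int
    using that by (auto simp: ibox_def)
  have inj: "inj_on ?h ?D"
  proof (rule inj_onI, clarify)
    fix f c f' c' assume *: "f \<in> ibox N X" "f' \<in> ibox N X" "f + monom c N = f' + monom c' N"
    then have "c = c'" using cN(1) by metis
    then show "f = f' \<and> c = c'" using * by simp
  qed
  have "?h ` ?D \<subseteq> polys_upto n N H \<union> reducibles N H"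
  proof clarify
    fix f c assume f: "f \<in> ibox N X" and c: "c \<in> {1..int X}" and nr: "f + monom c N \<notin> reducibles N H"
    let ?P = "f + monom c N"
    have dP: "degree ?P = N"
      by (rule antisym[OF degree_le le_degree]) (use f c in \<open>auto simp: ibox_def\<close>)
    have "\<bar>coeff ?P i\<bar> \<le> int X" for i
    proof -
      consider "i < N" | "i = N" | "i > N" by linarith
      then show ?thesis
      proof cases
        case 1
        then have "coeff ?P i = coeff f i" "0 \<le> coeff f i" "coeff f i < int X" using f by (auto simp: ibox_def)
        then show ?thesis by linarith
      qed (use f c in \<open>auto simp: ibox_def\<close>)
    qed
    then have "height ?P \<le> int X" by (metis height_attained)
    then have hP: "real_of_int (height ?P) \<le> H" using X by linarith
    then have "irreducible_of_degree N ?P" using nr dP by (simp add: reducibles_def)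
    then show "?P \<in> polys_upto n N H"
      using irreducible_in_polys[OF _ N n] hP by (simp add: polys_upto_def)
  qed
  then have "card (?h ` ?D) \<le> card (polys_upto n N H \<union> reducibles N H)"
    by (rule card_mono[rotated]) (use fin finite_polys_upto in auto)
  also have "\<dots> \<le> card (polys_upto n N H) + card (reducibles N H)" by (rule card_Un_le)
  also have "card (?h ` ?D) = X ^ Suc N" using inj by (simp add: card_image card_cartesian_product card_ibox mult.commute)
  finally have "real (X ^ Suc N) \<le> real (card (polys_upto n N H) + card (reducibles N H))" by (simp only: of_nat_le_iff)
  moreover have "(H / 2) ^ Suc N \<le> real X ^ Suc N" using X H by (intro power_mono) auto
  ultimately show ?thesis by simp
qed

section \<open>Densities\<close>

text \<open>Once the bound for the reducible polynomials is at most half of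
  \<open>(H / 2) ^ (N + 1)\<close>, their proportion is at most
  \<open>C * 2 ^ (N + 2) * (ln H + 1) / H\<close>. One more factor 2 covers
  \<open>ln H + 1 \<le> 2 * ln H\<close>, and the denominator \<open>H\<close> is weakened to
  \<open>sqrt H\<close>.\<close>

lemma irreducible_proportion:
  assumes n: "n \<ge> 2" and N: "N > 0"
  obtains K where "K \<ge> 0" "eventually (\<lambda>H.
     0 \<le> 1 - real (card ({P. irreducible_of_degree N P} \<inter> polys_upto n N H)) / real (card (polys_upto n N H)) \<and>
     1 - real (card ({P. irreducible_of_degree N P} \<inter> polys_upto n N H)) / real (card (polys_upto n N H)) \<le> K * (ln H / sqrt H)) at_top"
proof -
  obtain C where C: "C \<ge> 0" "\<And>H. H \<ge> 1 \<Longrightarrow> finite (reducibles N H) \<and> real (card (reducibles N H)) \<le> C * H ^ N * (ln H + 1)"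
    using card_reducibles_le[OF N] by blast
  let ?K = "C * 2 ^ (N + 3)"
  have "((\<lambda>H::real. (ln H + 1) / H) \<longlongrightarrow> 0) at_top" by real_asymp
  then have "((\<lambda>H::real. (C * 2 ^ (N + 2)) * ((ln H + 1) / H)) \<longlongrightarrow> 0) at_top" by (rule tendsto_mult_right_zero)
  then have ev: "eventually (\<lambda>H. (C * 2 ^ (N + 2)) * ((ln H + 1) / H) < 1) at_top"
    by (rule order_tendstoD) simp
  show ?thesis
  proof (rule that[of ?K])
    show "?K \<ge> 0" using C by simp
    show "eventually (\<lambda>H.
     0 \<le> 1 - real (card ({P. irreducible_of_degree N P} \<inter> polys_upto n N H)) / real (card (polys_upto n N H)) \<and>
     1 - real (card ({P. irreducible_of_degree N P} \<inter> polys_upto n N H)) / real (card (polys_upto n N H)) \<le> ?K * (ln H / sqrt H)) at_top"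
      using ev eventually_ge_at_top[of 3]
    proof eventually_elim
      case (elim H)
      let ?U = "polys_upto n N H"
      let ?I = "{P. irreducible_of_degree N P} \<inter> ?U"
      let ?B = "C * H ^ N * (ln H + 1)"
      have H: "H \<ge> 3" by (rule elim)
      have fr: "finite (reducibles N H)" "real (card (reducibles N H)) \<le> ?B" using C(2)[of H] H by auto
      have lnH: "ln H \<ge> 1"
        using ln_le_cancel_iff[of "exp 1" H] H exp_le by (simp add: order.trans)
      have pos: "(H / 2) ^ Suc N > 0" using H by simp
      have "?B * 2 = (C * 2 ^ (N + 2)) * ((ln H + 1) / H) * (H / 2) ^ Suc N"
        using H by (simp add: power_divide field_simps)
      also have "\<dots> \<le> 1 * (H / 2) ^ Suc N"
        using elim(1) pos by (intro mult_right_mono) auto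
      finally have B: "?B * 2 \<le> (H / 2) ^ Suc N" by simp
      have "(H / 2) ^ Suc N - real (card (reducibles N H)) \<le> real (card ?U)"
        by (rule card_polys_upto_ge[OF N n _ fr(1)]) (use H in simp)
      then have U: "(H / 2) ^ Suc N / 2 \<le> real (card ?U)" using B fr by linarith
      have U0: "real (card ?U) > 0" using U pos by linarith
      have "?U \<subseteq> ?I \<union> reducibles N H" by (auto simp: polys_upto_def polys_def reducibles_def)
      then have "card ?U \<le> card (?I \<union> reducibles N H)"
        by (rule card_mono[rotated]) (use fr finite_polys_upto in auto)
      also have "\<dots> \<le> card ?I + card (reducibles N H)" by (rule card_Un_le)
      finally have "real (card ?U) - real (card ?I) \<le> ?B" using fr(2) by linarith
      then have "(real (card ?U) - real (card ?I)) / real (card ?U) \<le> ?B / ((H / 2) ^ Suc N / 2)"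
        using U pos C(1) H lnH by (intro frac_le) auto
      also have "\<dots> = C * 2 ^ (N + 2) * ((ln H + 1) / H)"
        using H by (simp add: power_divide field_simps)
      also have "\<dots> \<le> C * 2 ^ (N + 2) * (2 * (ln H / sqrt H))"
      proof (rule mult_left_mono)
        have "sqrt H \<le> H"
          using H real_sqrt_ge_one[of H] mult_left_mono[of 1 "sqrt H" "sqrt H"] by simp
        then have "(ln H + 1) / H \<le> (2 * ln H) / sqrt H" using lnH H by (intro frac_le) auto
        then show "(ln H + 1) / H \<le> 2 * (ln H / sqrt H)" by simp
      qed (use C in simp)
      also have "\<dots> = ?K * (ln H / sqrt H)" by (simp add: power_add)
      finally have upper: "(real (card ?U) - real (card ?I)) / real (card ?U) \<le> ?K * (ln H / sqrt H)" .
      have "card ?I \<le> card ?U" by (rule card_mono[OF finite_polys_upto]) auto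
      then have "0 \<le> (real (card ?U) - real (card ?I)) / real (card ?U)" by simp
      moreover have "(real (card ?U) - real (card ?I)) / real (card ?U) = 1 - real (card ?I) / real (card ?U)"
        using U0 by (simp add: diff_divide_distrib)
      ultimately show ?case using upper by simp
    qed
  qed
qed

theorem theorem4p2:
  fixes n N :: nat
  assumes "n \<ge> 2" and "N > 0" and "n dvd N"
  shows "\<exists>S \<subseteq> polys n N.
    (\<lambda>H::real. 1 - real (card (S \<inter> polys_upto n N H)) / real (card (polys_upto n N H)))
      \<in> O[at_top](\<lambda>H. ln H / sqrt H) \<and>
    ((\<lambda>H::real. real (card (S \<inter> polys_upto n N H)) / real (card (polys_upto n N H)))
      \<longlongrightarrow> 1) at_top \<and>
    (\<forall>P\<in>S.
      (\<exists>\<alpha>::real. 0 < \<alpha> \<and> \<alpha> < 1 \<and>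
        (\<lambda>x::real. real (card (twists_upto n P x))) \<in> O[at_top](\<lambda>x. x * ln x powr (- \<alpha>))) \<and>
      ((\<lambda>x::real. real (card (twists_upto n P x)) / real (card (free_ints_upto n x)))
        \<longlongrightarrow> 0) at_top)"
proof -
  let ?S = "{P. irreducible_of_degree N P}"
  let ?r = "\<lambda>H. real (card (?S \<inter> polys_upto n N H)) / real (card (polys_upto n N H))"
  obtain K where K: "K \<ge> 0" "eventually (\<lambda>H. 0 \<le> 1 - ?r H \<and> 1 - ?r H \<le> K * (ln H / sqrt H)) at_top"
    using irreducible_proportion[OF assms(1,2)] by blast
  show ?thesis
  proof (intro exI[of _ ?S] conjI ballI)
    show "?S \<subseteq> polys n N" using irreducible_in_polys[OF _ assms(2,1)] by blast
    show "(\<lambda>H. 1 - ?r H) \<in> O[at_top](\<lambda>H. ln H / sqrt H)"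
    proof (rule bigoI[of _ K])
      show "eventually (\<lambda>H. norm (1 - ?r H) \<le> K * norm (ln H / sqrt H)) at_top"
        using K(2)
      proof eventually_elim
        case (elim H)
        have "K * (ln H / sqrt H) \<le> K * norm (ln H / sqrt H)"
          using K(1) by (intro mult_left_mono) (simp_all only: real_norm_def abs_ge_self)
        then show ?case using elim by simp
      qed
    qed
    have "((\<lambda>H. 1 - ?r H) \<longlongrightarrow> 0) at_top"
    proof (rule tendsto_sandwich)
      show "eventually (\<lambda>H. 0 \<le> 1 - ?r H) at_top" using K(2) by eventually_elim simp
      show "eventually (\<lambda>H. 1 - ?r H \<le> K * (ln H / sqrt H)) at_top" using K(2) by eventually_elim simp
      have "((\<lambda>H::real. ln H / sqrt H) \<longlongrightarrow> 0) at_top" by real_asymp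
      then show "((\<lambda>H. K * (ln H / sqrt H)) \<longlongrightarrow> 0) at_top" by (rule tendsto_mult_right_zero)
    qed simp
    then have "((\<lambda>H. 1 - (1 - ?r H)) \<longlongrightarrow> 1 - 0) at_top" by (intro tendsto_diff tendsto_const)
    then show "(?r \<longlongrightarrow> 1) at_top" by simp
  next
    fix P assume "P \<in> ?S"
    then have P: "irreducible_of_degree N P" by simp
    obtain \<alpha> C where a: "0 < \<alpha>" "\<alpha> < 1" "C \<ge> 0"
      and bound: "\<And>x. x \<ge> 3 \<Longrightarrow> real (card (twists_upto n P x)) \<le> C * (x * ln x powr (- \<alpha>))"
      using twists_bound[OF assms(1,3,2) P] by blast
    have "(\<lambda>x. real (card (twists_upto n P x))) \<in> O[at_top](\<lambda>x. x * ln x powr (- \<alpha>))"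
    proof (rule bigoI[of _ C])
      show "eventually (\<lambda>x. norm (real (card (twists_upto n P x))) \<le> C * norm (x * ln x powr (- \<alpha>))) at_top"
        using eventually_ge_at_top[of 3]
      proof eventually_elim
        case (elim x)
        have "C * (x * ln x powr (- \<alpha>)) \<le> C * norm (x * ln x powr (- \<alpha>))"
          using a(3) by (intro mult_left_mono) (simp_all only: real_norm_def abs_ge_self)
        then show ?case using bound[OF elim] by simp
      qed
    qed
    then show "\<exists>\<alpha>::real. 0 < \<alpha> \<and> \<alpha> < 1 \<and> (\<lambda>x. real (card (twists_upto n P x))) \<in> O[at_top](\<lambda>x. x * ln x powr (- \<alpha>))"
      using a by blast
    show "((\<lambda>x. real (card (twists_upto n P x)) / real (card (free_ints_upto n x))) \<longlongrightarrow> 0) at_top"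
    proof (rule tendsto_sandwich[of "\<lambda>_. 0"])
      show "eventually (\<lambda>x. real (card (twists_upto n P x)) / real (card (free_ints_upto n x)) \<le> 16 * C * ln x powr (- \<alpha>)) at_top"
        using eventually_ge_at_top[of 16]
      proof eventually_elim
        case (elim x)
        have "real (card (twists_upto n P x)) / real (card (free_ints_upto n x)) \<le> C * (x * ln x powr (- \<alpha>)) / (x / 16)"
          using bound[of x] card_free_ints_upto_ge[OF assms(1) elim] elim a(3) by (intro frac_le) auto
        also have "\<dots> = 16 * C * ln x powr (- \<alpha>)" using elim by simp
        finally show ?case .
      qed
      have "((\<lambda>x::real. ln x powr (- \<alpha>)) \<longlongrightarrow> 0) at_top"
        using a(1) by (intro tendsto_neg_powr ln_at_top) auto
      then show "((\<lambda>x. 16 * C * ln x powr (- \<alpha>)) \<longlongrightarrow> 0) at_top" by (rule tendsto_mult_right_zero)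
    qed auto
  qed
qed

end
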